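(* For every even integer $\Delta$ there exists a constant $g(\Delta)$ such that every graph $G$ with maximum degree $\Delta$ and girth at least $g(\Delta)$ satisfies $\chi''_f(G) = \Delta+1$.
   Context: For a graph $G$, the total graph $T(G)$ has vertex set $V(G)\cup E(G)$, where two elements are adjacent if they are adjacent vertices of $G$, or an edge and one of its endvertices, or two incident edges of $G$. A fractional colouring of a graph $H$ is a function $w$ assigning to each independent set $I$ of $H$ a number $w(I)\in[0,1]$ such that for every vertex $v$, the sum of $w(I)$ over independent sets $I\ni v$ is at least $1$; its size is $\sum_I w(I)$, and $\chi_f(H)$ is the infimum of the sizes of fractional colourings of $H$. The fractional total chromatic number is $\chi''_f(G)=\chi_f(T(G))$. The girth of a graph is the length of its shortest cycle.
   Formalization: The case Δ = 2 is excluded, since the claim is false there: cycles of length 3k+1 have maximum degree 2 and arbitrarily large girth but fractional total chromatic number at least 3 + 1/k > 3. *)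

theory Defs
  imports Complex_Main "HOL-Library.Extended_Nat"
begin

record 'a ugraph =
  verts :: "'a set"
  edges :: "'a set set"

text \<open>Finite simple undirected graphs. The vertex set is required to be nonempty, so that the
  maximum degree is meaningful.\<close>

definition simple_graph :: "'a ugraph \<Rightarrow> bool" where
  "simple_graph G \<longleftrightarrow> finite (verts G) \<and> verts G \<noteq> {} \<and>
     (\<forall>e\<in>edges G. \<exists>u v. u \<in> verts G \<and> v \<in> verts G \<and> u \<noteq> v \<and> e = {u, v})"

definition adjacent :: "'a ugraph \<Rightarrow> 'a \<Rightarrow> 'a \<Rightarrow> bool" where
  "adjacent G u v \<longleftrightarrow> {u, v} \<in> edges G"

definition degree :: "'a ugraph \<Rightarrow> 'a \<Rightarrow> nat" where
  "degree G v = card {e \<in> edges G. v \<in> e}"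

definition max_degree :: "'a ugraph \<Rightarrow> nat" where
  "max_degree G = Max (degree G ` verts G)"

text \<open>A cycle is given by the list of its vertices, the first one not being repeated at the end;
  the length of the list is thus the length of the cycle.\<close>

definition is_cycle :: "'a ugraph \<Rightarrow> 'a list \<Rightarrow> bool" where
  "is_cycle G c \<longleftrightarrow> 3 \<le> length c \<and> distinct c \<and> set c \<subseteq> verts G \<and>
     (\<forall>i < length c. adjacent G (c ! i) (c ! (Suc i mod length c)))"

text \<open>The girth of a graph without cycles is \<open>\<infinity>\<close>, the infimum of the empty set in
  \<^typ>\<open>enat\<close>.\<close>

definition girth :: "'a ugraph \<Rightarrow> enat" where
  "girth G = (INF c\<in>{c. is_cycle G c}. enat (length c))"

definition total_graph :: "'a ugraph \<Rightarrow> ('a + 'a set) ugraph" where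
  "total_graph G =
     \<lparr> verts = Inl ` verts G \<union> Inr ` edges G,
       edges = {{Inl u, Inl v} | u v. adjacent G u v}
             \<union> {{Inl v, Inr e} | v e. e \<in> edges G \<and> v \<in> e}
             \<union> {{Inr e, Inr f} | e f. e \<in> edges G \<and> f \<in> edges G \<and> e \<noteq> f \<and> e \<inter> f \<noteq> {}} \<rparr>"

definition independent_sets :: "'a ugraph \<Rightarrow> 'a set set" where
  "independent_sets H = {I. I \<subseteq> verts H \<and> (\<forall>u\<in>I. \<forall>v\<in>I. \<not> adjacent H u v)}"

text \<open>Only the values of \<open>w\<close> on the independent sets of \<open>H\<close> matter.\<close>

definition fractional_colouring :: "'a ugraph \<Rightarrow> ('a set \<Rightarrow> real) \<Rightarrow> bool" where
  "fractional_colouring H w \<longleftrightarrow>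
     (\<forall>I\<in>independent_sets H. 0 \<le> w I \<and> w I \<le> 1) \<and>
     (\<forall>v\<in>verts H. (\<Sum>I\<in>{I \<in> independent_sets H. v \<in> I}. w I) \<ge> 1)"

definition colouring_size :: "'a ugraph \<Rightarrow> ('a set \<Rightarrow> real) \<Rightarrow> real" where
  "colouring_size H w = (\<Sum>I\<in>independent_sets H. w I)"

definition fractional_chromatic_number :: "'a ugraph \<Rightarrow> real" where
  "fractional_chromatic_number H = Inf {colouring_size H w | w. fractional_colouring H w}"

definition fractional_total_chromatic_number :: "'a ugraph \<Rightarrow> real" where
  "fractional_total_chromatic_number G = fractional_chromatic_number (total_graph G)"

lemma simple_graph_total_graph:
  assumes "simple_graph G"
  shows "simple_graph (total_graph G)"
proof -
  have fin: "finite (edges G)"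
    by (rule finite_subset[of _ "Pow (verts G)"])
      (use assms in \<open>fastforce simp: simple_graph_def\<close>)+
  have *: "u \<in> verts G \<and> v \<in> verts G \<and> u \<noteq> v" if "{u, v} \<in> edges G" for u v
    using assms that unfolding simple_graph_def by (metis doubleton_eq_iff)
  have **: "v \<in> verts G" if "e \<in> edges G" "v \<in> e" for e v
    using assms that unfolding simple_graph_def by fastforce
  have "\<exists>x y. x \<in> verts (total_graph G) \<and> y \<in> verts (total_graph G) \<and> x \<noteq> y \<and> a = {x, y}"
    if "a \<in> edges (total_graph G)" for a
  proof -
    from that consider
        (vv) u v where "a = {Inl u, Inl v}" "{u, v} \<in> edges G"
      | (ve) v e where "a = {Inl v, Inr e}" "e \<in> edges G" "v \<in> e"
      | (ee) e f where "a = {Inr e, Inr f}" "e \<in> edges G" "f \<in> edges G" "e \<noteq> f"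
      unfolding total_graph_def adjacent_def by simp blast
    then show ?thesis
    proof cases
      case vv
      then show ?thesis using *[of u v]
        by (intro exI[of _ "Inl u"] exI[of _ "Inl v"]) (simp add: total_graph_def)
    next
      case ve
      then show ?thesis using **[of e v]
        by (intro exI[of _ "Inl v"] exI[of _ "Inr e"]) (simp add: total_graph_def)
    next
      case ee
      then show ?thesis
        by (intro exI[of _ "Inr e"] exI[of _ "Inr f"]) (simp add: total_graph_def)
    qed
  qed
  moreover have "finite (verts (total_graph G))" "verts (total_graph G) \<noteq> {}"
    using assms fin by (auto simp: total_graph_def simple_graph_def)
  ultimately show ?thesis unfolding simple_graph_def by blast
qed

text \<open>The infimum in \<^const>\<open>fractional_chromatic_number\<close> is over a nonempty set of reals that is
  bounded below.\<close>

lemma fractional_colouring_exists: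
  assumes "simple_graph H"
  shows "fractional_colouring H (\<lambda>_. 1)"
proof -
  have fin: "finite (independent_sets H)"
    by (rule finite_subset[of _ "Pow (verts H)"])
      (use assms in \<open>auto simp: simple_graph_def independent_sets_def\<close>)
  have noloop: "{v} \<notin> edges H" for v
  proof
    assume "{v} \<in> edges H"
    then obtain x y where "x \<noteq> y" "{v} = {x, y}"
      using assms unfolding simple_graph_def by blast
    then show False by (metis doubleton_eq_iff insert_absorb2)
  qed
  have "1 \<le> (\<Sum>I\<in>{I \<in> independent_sets H. v \<in> I}. (1::real))" if "v \<in> verts H" for v
  proof -
    have "{v} \<in> {I \<in> independent_sets H. v \<in> I}"
      using that noloop by (auto simp: independent_sets_def adjacent_def)
    then have "card {I \<in> independent_sets H. v \<in> I} \<noteq> 0"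
      using fin by (metis (no_types, lifting) card_0_eq empty_iff finite_Collect_conjI finite_subset
          mem_Collect_eq subsetI)
    then show ?thesis by simp
  qed
  then show ?thesis by (simp add: fractional_colouring_def)
qed

lemma colouring_size_nonneg:
  "fractional_colouring H w \<Longrightarrow> 0 \<le> colouring_size H w"
  by (auto simp: colouring_size_def fractional_colouring_def intro: sum_nonneg)

end

theory Submission imports Defs "HOL-Combinatorics.Permutations" begin

text \<open>Let \<open>\<Delta> = 2 * k\<close>. The edges of \<open>G\<close> split into \<open>k\<close> classes of directed paths and cycles
  (lines). It suffices to find, for each class, a random matching \<open>M\<close> in its lines that leaves an
  independent set of \<open>G\<close> uncovered, such that every vertex is uncovered with probability \<open>1 / (\<Delta> +
  1)\<close> and every edge of the class is in \<open>M\<close> with probability \<open>k / (\<Delta> + 1)\<close>: averaging over the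
  classes then covers every element of the total graph with probability exactly \<open>1 / (\<Delta> + 1)\<close>.

  Such an \<open>M\<close> is generated vertex by vertex along the lines. At a vertex whose predecessor is
  already matched backwards a coin decides whether it stays uncovered; this is forbidden if a
  neighbour in another line has been left uncovered before. In a graph of large girth the states
  of these neighbours are independent of the past of the line, so a union bound over the at most
  \<open>2 * k - 2\<close> neighbours shows that the vertex is free often enough to give it exactly the
  prescribed probability.

  To keep dependencies bounded, the lines are cut at places where the parity of the tiling is
  repaired by a reserved vertex whose neighbours are always covered. The probabilities near these
  places deviate from the desired ones. Taking the average over many choices of the places, each
  vertex being affected by few of them, the deviation is compensated by small changes of the
  probabilities elsewhere.\<close>

section \<open>Matchings, edge colourings and orientations\<close>


text \<open>The union bound has slack precisely because \<open>k\<close> is at least 2. A vertex is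
  single with probability \<open>\<delta> = 1 / (2 * k + 1)\<close> and a head with probability
  \<open>t = k * \<delta>\<close>, and the bound asks for
  \<open>\<delta> \<le> t * (1 - (2 * k - 2) * \<delta>)\<close>. The bracket equals
  \<open>3 * \<delta>\<close>, so this says \<open>2 * k + 1 \<le> 3 * k\<close>. For
  \<open>k = 1\<close> it is an equality and no deviation could be compensated. Cuts are needed
  because the state of a vertex depends on the whole earlier part of its line, and no girth that
  depends on \<Delta> alone could keep this apart from the past of a neighbour. At a cut the state
  has to be fixed, whereas the tiling arrives there in a random phase. One vertex that may be left
  single whatever happened around it can absorb the difference.\<close>

definition partial_matching :: "('x \<Rightarrow> 'x \<Rightarrow> bool) \<Rightarrow> bool" where
  "partial_matching \<alpha> \<longleftrightarrow>
     (\<forall>x y. \<alpha> x y \<longrightarrow> \<alpha> y x \<and> x \<noteq> y) \<and> (\<forall>x y z. \<alpha> x y \<longrightarrow> \<alpha> x z \<longrightarrow> y = z)"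

text \<open>The union of two matchings consists of paths and even cycles. A vertex with at most one
  neighbour is removed and coloured last. If there is none, an \<open>\<alpha>\<close>-edge
  \<open>x y\<close> is removed and its outer \<open>\<beta>\<close>-neighbours \<open>x'\<close>,
  \<open>y'\<close> are joined by a new \<open>\<beta>\<close>-edge, which shortens a cycle by
  two.\<close>

lemma two_matchings:
  assumes "finite X" "partial_matching \<alpha>" "partial_matching \<beta>"
  shows "\<exists>c :: 'x \<Rightarrow> bool. \<forall>x\<in>X. \<forall>y\<in>X. \<alpha> x y \<or> \<beta> x y \<longrightarrow> c x \<noteq> c y"
  using assms
proof (induction "card X" arbitrary: X \<beta> rule: less_induct)
  case less
  note fin = less.prems(1)
  have \<alpha>: "\<And>u v. \<alpha> u v \<Longrightarrow> \<alpha> v u" "\<And>u. \<not> \<alpha> u u" "\<And>u v w. \<alpha> u v \<Longrightarrow> \<alpha> u w \<Longrightarrow> v = w"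
    using less.prems(2) unfolding partial_matching_def by blast+
  have \<beta>: "\<And>u v. \<beta> u v \<Longrightarrow> \<beta> v u" "\<And>u. \<not> \<beta> u u" "\<And>u v w. \<beta> u v \<Longrightarrow> \<beta> u w \<Longrightarrow> v = w"
    using less.prems(3) unfolding partial_matching_def by blast+
  consider (empty) "X = {}"
    | (leaf) x z where "x \<in> X" "\<forall>y\<in>X. \<alpha> x y \<or> \<beta> x y \<longrightarrow> y = z"
    | (inner) "X \<noteq> {}" "\<And>x z. x \<in> X \<Longrightarrow> \<exists>y\<in>X. (\<alpha> x y \<or> \<beta> x y) \<and> y \<noteq> z"
    by blast
  then show ?case
  proof cases
    case empty
    then show ?thesis by simp
  next
    case leaf
    then have "card (X - {x}) < card X" using fin by (meson card_Diff1_less)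
    then obtain c :: "'x \<Rightarrow> bool"
      where c: "\<forall>u\<in>X - {x}. \<forall>v\<in>X - {x}. \<alpha> u v \<or> \<beta> u v \<longrightarrow> c u \<noteq> c v"
      using less.hyps[of "X - {x}" \<beta>] less.prems by blast
    have "(c(x := \<not> c z)) u \<noteq> (c(x := \<not> c z)) v" if "u \<in> X" "v \<in> X" "\<alpha> u v \<or> \<beta> u v" for u v
    proof (cases "u = x \<or> v = x")
      case True
      have "u \<noteq> v" using that(3) \<alpha>(2) \<beta>(2) by blast
      moreover have "\<alpha> v u \<or> \<beta> v u" using that(3) \<alpha>(1) \<beta>(1) by blast
      ultimately show ?thesis using True that leaf(2) by auto
    next
      case False
      then show ?thesis using c that by (metis DiffI fun_upd_other singletonD)
    qed
    then show ?thesis by blast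
  next
    case inner
    have both: "\<exists>y\<in>X. \<exists>z\<in>X. \<alpha> x y \<and> \<beta> x z \<and> y \<noteq> z" if x: "x \<in> X" for x
    proof -
      obtain y where y: "y \<in> X" "\<alpha> x y \<or> \<beta> x y" using inner(2)[OF x] by blast
      obtain z where z: "z \<in> X" "\<alpha> x z \<or> \<beta> x z" "z \<noteq> y" using inner(2)[OF x] by blast
      have "\<not> (\<alpha> x y \<and> \<alpha> x z)" "\<not> (\<beta> x y \<and> \<beta> x z)" using z(3) \<alpha>(3) \<beta>(3) by blast+
      then show ?thesis using y z by blast
    qed
    obtain x where x: "x \<in> X" using inner(1) by blast
    obtain y x' where y: "y \<in> X" "x' \<in> X" "\<alpha> x y" "\<beta> x x'" "y \<noteq> x'" using both[OF x] by blast
    obtain y' where y': "y' \<in> X" "\<beta> y y'" "y' \<noteq> x"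
      using both[OF y(1)] \<alpha>(3)[OF \<alpha>(1)[OF y(3)]] by blast
    have ne: "x \<noteq> y" "x \<noteq> x'" "y \<noteq> y'" "x' \<noteq> y'"
      using \<alpha>(2) \<beta>(2) y(3,4) y'(2) \<beta>(3)[OF \<beta>(1)[OF y(4)], of y] \<beta>(1)[OF y'(2)] by blast+
    define \<beta>' where "\<beta>' = (\<lambda>u v. u \<notin> {x, y} \<and> v \<notin> {x, y} \<and>
        (\<beta> u v \<or> (u = x' \<and> v = y') \<or> (u = y' \<and> v = x')))"
    have b: "\<beta> u x \<longleftrightarrow> u = x'" "\<beta> u y \<longleftrightarrow> u = y'" "\<beta> x u \<longleftrightarrow> u = x'" "\<beta> y u \<longleftrightarrow> u = y'"
      "\<beta> x' u \<longleftrightarrow> u = x" "\<beta> y' u \<longleftrightarrow> u = y" for u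
      using \<beta>(1) \<beta>(3)[OF y(4)] \<beta>(3)[OF \<beta>(1)[OF y(4)]] \<beta>(3)[OF y'(2)] \<beta>(3)[OF \<beta>(1)[OF y'(2)]]
        y(4) y'(2) by blast+
    have a: "\<alpha> x u \<longleftrightarrow> u = y" "\<alpha> u x \<longleftrightarrow> u = y" "\<alpha> y u \<longleftrightarrow> u = x" "\<alpha> u y \<longleftrightarrow> u = x" for u
      using \<alpha>(1) \<alpha>(3)[OF y(3)] \<alpha>(3)[OF \<alpha>(1)[OF y(3)]] y(3) by blast+
    have "partial_matching \<beta>'"
      unfolding partial_matching_def
    proof (intro conjI allI impI)
      fix u v w assume uvw: "\<beta>' u v" "\<beta>' u w"
      consider "u = x'" | "u = y'" | "u \<noteq> x'" "u \<noteq> y'" by blast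
      then show "v = w"
        using uvw b ne \<beta>(3)[of u v w] unfolding \<beta>'_def by cases auto
    next
      fix u v assume uv: "\<beta>' u v"
      then show "\<beta>' v u" using \<beta> unfolding \<beta>'_def by blast
      show "u \<noteq> v" using uv \<beta> ne unfolding \<beta>'_def by blast
    qed
    moreover have "card (X - {x, y}) < card X"
      using fin x by (intro psubset_card_mono) auto
    ultimately obtain c :: "'x \<Rightarrow> bool"
      where c: "\<forall>u\<in>X - {x, y}. \<forall>v\<in>X - {x, y}. \<alpha> u v \<or> \<beta>' u v \<longrightarrow> c u \<noteq> c v"
      using less.hyps[of "X - {x, y}" \<beta>'] less.prems by blast
    have xy: "c x' \<noteq> c y'"
      using c y y' ne by (auto simp: \<beta>'_def)
    have c': "c u \<noteq> c v" if "u \<in> X" "v \<in> X" "u \<notin> {x, y}" "v \<notin> {x, y}" "\<alpha> u v \<or> \<beta> u v" for u v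
      using c that by (auto simp: \<beta>'_def)
    define c2 where "c2 = c(x := \<not> c x', y := \<not> c y')"
    have "c2 u \<noteq> c2 v" if uv: "u \<in> X" "v \<in> X" "\<alpha> u v \<or> \<beta> u v" for u v
    proof (cases "u \<in> {x, y} \<or> v \<in> {x, y}")
      case True
      then show ?thesis
        using uv a b ne y y' xy unfolding c2_def by auto
    next
      case False
      then show ?thesis using c'[of u v] uv by (simp add: c2_def)
    qed
    then show ?thesis by blast
  qed
qed

lemma greedy_colouring:
  assumes "finite X" "\<And>x y. r x y \<Longrightarrow> r y x"
    and "\<And>x. x \<in> X \<Longrightarrow> card {y \<in> X. r x y \<and> y \<noteq> x} \<le> D"
  shows "\<exists>c :: 'x \<Rightarrow> nat. (\<forall>x\<in>X. c x \<le> D) \<and> (\<forall>x\<in>X. \<forall>y\<in>X. x \<noteq> y \<and> r x y \<longrightarrow> c x \<noteq> c y)"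
  using assms(1,3)
proof (induction X rule: finite_induct)
  case (insert x X)
  have "card {z \<in> X. r y z \<and> z \<noteq> y} \<le> D" if "y \<in> X" for y
    by (rule order_trans[OF card_mono insert.prems[of y]]) (use insert.hyps that in auto)
  then obtain c where c: "\<forall>x\<in>X. c x \<le> D" "\<forall>x\<in>X. \<forall>y\<in>X. x \<noteq> y \<and> r x y \<longrightarrow> c x \<noteq> c y"
    using insert.IH by blast
  let ?N = "{y \<in> insert x X. r x y \<and> y \<noteq> x}"
  have "card (c ` ?N) \<le> D"
    using insert.prems[of x] insert.hyps by (intro order_trans[OF card_image_le]) auto
  then have "\<not> {..D} \<subseteq> c ` ?N"
    using insert.hyps card_mono[of "c ` ?N" "{..D}"] by auto
  then obtain n where n: "n \<le> D" "n \<notin> c ` ?N" by auto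
  show ?case
    by (rule exI[of _ "c(x := n)"]) (use c n insert.hyps assms(2) in auto)
qed simp

text \<open>Distinct elements of a fibre of \<open>p\<close> have distinct colours and only two
  colours are available, so a fibre has at most two elements.\<close>

lemma two_colours_partial_matching:
  assumes "\<And>x. x \<in> S \<Longrightarrow> c x = i \<or> c x = j"
    and "\<And>x y. x \<in> S \<Longrightarrow> y \<in> S \<Longrightarrow> x \<noteq> y \<Longrightarrow> p x = p y \<Longrightarrow> c x \<noteq> c y"
  shows "partial_matching (\<lambda>x y. x \<in> S \<and> y \<in> S \<and> x \<noteq> y \<and> p x = p y)"
  unfolding partial_matching_def
proof (intro conjI allI impI)
  fix x y z assume xyz: "x \<in> S \<and> y \<in> S \<and> x \<noteq> y \<and> p x = p y" "x \<in> S \<and> z \<in> S \<and> x \<noteq> z \<and> p x = p z"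
  then have "c x \<noteq> c y" "c x \<noteq> c z" using assms(2)[of x y] assms(2)[of x z] by auto
  then have "c y = c z" using assms(1)[of x] assms(1)[of y] assms(1)[of z] xyz by auto
  then show "y = z" using assms(2)[of y z] xyz by auto
qed auto

text \<open>An \<open>e\<close> is an edge from \<open>f e\<close> to \<open>h e\<close> of a
  bipartite multigraph. For a new edge, some \<open>i\<close> is free at one end and some
  \<open>j\<close> at the other. Instead of switching a single alternating path, all edges coloured
  \<open>i\<close> or \<open>j\<close> are recoloured at once by
  \<open>two_matchings\<close>.\<close>

lemma konig_edge_colouring:
  fixes f :: "'e \<Rightarrow> 'a" and h :: "'e \<Rightarrow> 'b"
  assumes "finite E" "\<And>v. card {e \<in> E. f e = v} \<le> k" "\<And>v. card {e \<in> E. h e = v} \<le> k"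
  shows "\<exists>c :: 'e \<Rightarrow> nat. (\<forall>e\<in>E. c e < k) \<and>
    (\<forall>e\<in>E. \<forall>e'\<in>E. e \<noteq> e' \<and> c e = c e' \<longrightarrow> f e \<noteq> f e' \<and> h e \<noteq> h e')"
  using assms
proof (induction E rule: finite_induct)
  case (insert e E)
  have le: "card {x \<in> E. p x = v} \<le> k" if "\<And>v. card {x \<in> insert e E. p x = v} \<le> k"
      for p :: "'e \<Rightarrow> 'c" and v
    by (rule order_trans[OF card_mono that[of v]]) (use insert.hyps in auto)
  note insert.IH[OF le le, OF insert.prems]
  then obtain c where c: "\<forall>e\<in>E. c e < k"
      "\<forall>e\<in>E. \<forall>e'\<in>E. e \<noteq> e' \<and> c e = c e' \<longrightarrow> f e \<noteq> f e' \<and> h e \<noteq> h e'"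
    by (elim exE conjE)
  have free: "\<exists>i<k. \<forall>x\<in>E. p x = p e \<longrightarrow> c x \<noteq> i"
    if "\<And>v. card {x \<in> insert e E. p x = v} \<le> k" for p :: "'e \<Rightarrow> 'c"
  proof -
    have "{x \<in> insert e E. p x = p e} = insert e {x \<in> E. p x = p e}" by auto
    then have "card {x \<in> E. p x = p e} < k"
      using that[of "p e"] insert.hyps by auto
    then have "card (c ` {x \<in> E. p x = p e}) < k"
      using insert.hyps by (intro le_less_trans[OF card_image_le]) auto
    then have "\<not> {..<k} \<subseteq> c ` {x \<in> E. p x = p e}"
      using insert.hyps card_mono[of "c ` {x \<in> E. p x = p e}" "{..<k}"] by auto
    then show ?thesis by auto
  qed
  obtain i where i: "i < k" "\<forall>x\<in>E. f x = f e \<longrightarrow> c x \<noteq> i" using free[OF insert.prems(1)]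
      by (elim exE conjE)
  obtain j where j: "j < k" "\<forall>x\<in>E. h x = h e \<longrightarrow> c x \<noteq> j" using free[OF insert.prems(2)]
      by (elim exE conjE)
  show ?case
  proof (cases "i = j")
    case True
    have "f x \<noteq> f y \<and> h x \<noteq> h y"
      if xy: "x \<in> insert e E" "y \<in> insert e E" "x \<noteq> y" "(c(e := i)) x = (c(e := i)) y" for x y
    proof (cases "x = e \<or> y = e")
      case True
      then consider "x = e" "y \<in> E" | "y = e" "x \<in> E" using xy(1-3) by blast
      then show ?thesis
      proof cases
        case 1
        then have "c y = i" using xy(3,4) by simp
        then show ?thesis using 1 i(2) j(2) \<open>i = j\<close> by metis
      next
        case 2
        then have "c x = i" using xy(3,4) by simp
        then show ?thesis using 2 i(2) j(2) \<open>i = j\<close> by metis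
      qed
    next
      case False
      then have "x \<in> E" "y \<in> E" "c x = c y" using xy by simp_all
      then show ?thesis using c(2) xy(3) by blast
    qed
    moreover have "\<forall>x\<in>insert e E. (c(e := i)) x < k" using c(1) i(1) by simp
    ultimately show ?thesis by blast
  next
    case False
    define S where "S = insert e {x \<in> E. c x = i \<or> c x = j}"
    define \<alpha> where "\<alpha> = (\<lambda>x y. x \<in> S \<and> y \<in> S \<and> x \<noteq> y \<and> f x = f y)"
    define \<beta> where "\<beta> = (\<lambda>x y. x \<in> S \<and> y \<in> S \<and> x \<noteq> y \<and> h x = h y)"
    \<comment> \<open>The new edge counts as coloured \<open>i\<close> at its \<open>f\<close> end
      and as coloured \<open>j\<close> at its \<open>h\<close> end; the two conflict relations are
      examined separately, so the colours need not agree.\<close>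
    have "partial_matching \<alpha>"
      unfolding \<alpha>_def
    proof (rule two_colours_partial_matching[where c = "c(e := i)" and i = i and j = j])
      show "(c(e := i)) x \<noteq> (c(e := i)) y" if "x \<in> S" "y \<in> S" "x \<noteq> y" "f x = f y" for x y
        using that c(2) i(2) by (cases "x = e"; cases "y = e") (auto simp: S_def)
    qed (auto simp: S_def)
    moreover have "partial_matching \<beta>"
      unfolding \<beta>_def
    proof (rule two_colours_partial_matching[where c = "c(e := j)" and i = i and j = j])
      show "(c(e := j)) x \<noteq> (c(e := j)) y" if "x \<in> S" "y \<in> S" "x \<noteq> y" "h x = h y" for x y
        using that c(2) j(2) by (cases "x = e"; cases "y = e") (auto simp: S_def)
    qed (auto simp: S_def)
    moreover have "finite S" using insert.hyps by (auto simp: S_def)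
    ultimately obtain d :: "'e \<Rightarrow> bool"
      where d: "\<forall>x\<in>S. \<forall>y\<in>S. \<alpha> x y \<or> \<beta> x y \<longrightarrow> d x \<noteq> d y"
      using two_matchings[of S \<alpha> \<beta>] by blast
    define c' where "c' = (\<lambda>x. if x \<in> S then if d x then i else j else c x)"
    have c'_S: "x \<in> S \<longleftrightarrow> c' x = i \<or> c' x = j" if "x \<in> insert e E" for x
      using that by (cases "x \<in> S"; cases "d x") (simp_all add: c'_def S_def)
    have "f x \<noteq> f y \<and> h x \<noteq> h y" if "x \<in> insert e E" "y \<in> insert e E" "x \<noteq> y" "c' x = c' y" for x y
    proof (cases "x \<in> S")
      case True
      then have "y \<in> S" using that c'_S[of x] c'_S[of y] by simp
      then have "d x = d y" using that True False
          by (cases "d x"; cases "d y") (simp_all add: c'_def)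
      then have "\<not> \<alpha> x y \<and> \<not> \<beta> x y" using d True \<open>y \<in> S\<close> by blast
      then show ?thesis using True \<open>y \<in> S\<close> \<open>x \<noteq> y\<close> by (simp add: \<alpha>_def \<beta>_def)
    next
      case xS: False
      then have "y \<notin> S" using that c'_S[of x] c'_S[of y] by simp
      then have "c x = c y" "x \<in> E" "y \<in> E" using xS that by (auto simp: c'_def S_def)
      then show ?thesis using c(2) \<open>x \<noteq> y\<close> by blast
    qed
    moreover have "\<forall>x\<in>insert e E. c' x < k"
      using c(1) i(1) j(1) by (simp add: c'_def S_def)
    ultimately show ?thesis by blast
  qed
qed simp

text \<open>Enumerating each part and matching the positions \<open>2j\<close> and \<open>2j+1\<close>.\<close>

lemma pairing_exists:
  assumes "finite X"
  shows "\<exists>\<beta>. partial_matching \<beta> \<and>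
    (\<forall>c :: 'x \<Rightarrow> bool. (\<forall>x\<in>X. \<forall>y\<in>X. \<beta> x y \<longrightarrow> c x \<noteq> c y) \<longrightarrow>
      (\<forall>P. card {x \<in> X. part x = P \<and> c x} \<le> (card {x \<in> X. part x = P} + 1) div 2))"
proof -
  have "\<forall>P. \<exists>i. bij_betw i {x \<in> X. part x = P} {0..<card {x \<in> X. part x = P}}"
    using assms by (intro allI ex_bij_betw_finite_nat) auto
  from choice[OF this] obtain i
    where i: "\<And>P. bij_betw (i P) {x \<in> X. part x = P} {0..<card {x \<in> X. part x = P}}"
    by blast
  have inj: "x = y" if "x \<in> X" "y \<in> X" "part x = part y" "i (part x) x = i (part y) y" for x y
    by (rule inj_onD[OF bij_betw_imp_inj_on[OF i[of "part x"]]]) (use that in simp_all)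
  define \<beta> where "\<beta> = (\<lambda>x y. x \<in> X \<and> y \<in> X \<and> x \<noteq> y \<and> part x = part y \<and>
      i (part x) x div 2 = i (part y) y div 2)"
  have "partial_matching \<beta>"
    unfolding partial_matching_def
  proof (intro conjI allI impI)
    fix x y z assume xyz: "\<beta> x y" "\<beta> x z"
    have half: "b = (if even a then a + 1 else a - 1)" if "a div 2 = b div 2" "a \<noteq> b" for a b :: nat
      using that by (cases "even a"; cases "even b") (auto elim!: evenE oddE)
    have "i (part w) w = (if even (i (part x) x) then i (part x) x + 1 else i (part x) x - 1)"
      if "\<beta> x w" for w
    proof (rule half)
      show "i (part x) x div 2 = i (part w) w div 2" "i (part x) x \<noteq> i (part w) w"
        using that inj[of x w] unfolding \<beta>_def by blast+
    qed
    then have "i (part y) y = i (part z) z" using xyz by metis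
    then show "y = z"
      by (intro inj) (use xyz in \<open>simp_all add: \<beta>_def\<close>)
  qed (auto simp: \<beta>_def)
  moreover have "card {x \<in> X. part x = P \<and> c x} \<le> (card {x \<in> X. part x = P} + 1) div 2"
    if c: "\<forall>x\<in>X. \<forall>y\<in>X. \<beta> x y \<longrightarrow> c x \<noteq> c y" for c :: "'x \<Rightarrow> bool" and P
  proof -
    let ?n = "card {x \<in> X. part x = P}"
    have "inj_on (\<lambda>x. i P x div 2) {x \<in> X. part x = P \<and> c x}"
    proof (rule inj_onI, rule ccontr)
      fix x y assume "x \<in> {x \<in> X. part x = P \<and> c x}" "y \<in> {x \<in> X. part x = P \<and> c x}"
        "i P x div 2 = i P y div 2" "x \<noteq> y"
      then have "\<beta> x y" "x \<in> X" "y \<in> X" "c x = c y" by (simp_all add: \<beta>_def)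
      then show False using c by blast
    qed
    moreover have "(\<lambda>x. i P x div 2) ` {x \<in> X. part x = P \<and> c x} \<subseteq> {..<(?n + 1) div 2}"
    proof clarsimp
      fix x assume "x \<in> X" "P = part x"
      then have "i P x < ?n" using bij_betwE[OF i[of P]] by auto
      then show "i (part x) x div 2 < Suc (card {xa \<in> X. part xa = part x}) div 2"
        using \<open>P = part x\<close> by auto
    qed
    ultimately have "card {x \<in> X. part x = P \<and> c x} \<le> card {..<(?n + 1) div 2}"
      by (rule card_inj_on_le) simp
    then show ?thesis by simp
  qed
  ultimately show ?thesis by blast
qed


text \<open>Splitting the half-edges at each vertex into pairs and colouring them alternately gives an
  Eulerian orientation; Koenig's theorem then splits it into \<open>k\<close> classes of directed paths and
  cycles.\<close>

lemma two_factorisation: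
  assumes "finite E" and edge: "\<And>e. e \<in> E \<Longrightarrow> \<exists>u v. u \<noteq> v \<and> e = {u, v}"
    and deg: "\<And>v. card {e \<in> E. v \<in> e} \<le> 2 * k"
  shows "\<exists>tl hd :: 'a set \<Rightarrow> 'a. \<exists>col :: 'a set \<Rightarrow> nat.
    (\<forall>e\<in>E. e = {tl e, hd e} \<and> tl e \<noteq> hd e \<and> col e < k) \<and>
    (\<forall>e\<in>E. \<forall>e'\<in>E. e \<noteq> e' \<and> col e = col e' \<longrightarrow> tl e \<noteq> tl e' \<and> hd e \<noteq> hd e')"
proof -
  \<comment> \<open>Elements of \<open>X\<close> are half-edges. \<open>\<alpha>\<close> joins the
    two halves of an edge and \<open>\<beta>\<close> pairs half-edges at a vertex, so a 2-colouring
    proper for both orients every edge and balances every vertex.\<close>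
  define X where "X = (SIGMA e:E. e)"
  have "finite e" if "e \<in> E" for e using edge[OF that] by auto
  then have finX: "finite X" using assms(1) by (auto simp: X_def)
  define \<alpha> where "\<alpha> = (\<lambda>x y. x \<in> X \<and> y \<in> X \<and> fst x = fst y \<and> snd x \<noteq> (snd y :: 'a))"
  have \<alpha>: "partial_matching \<alpha>"
    unfolding partial_matching_def
  proof (intro conjI allI impI)
    fix x y z assume xyz: "\<alpha> x y" "\<alpha> x z"
    have mem: "snd w \<in> fst w \<and> fst w \<in> E" if "w \<in> X" for w using that unfolding X_def by force
    have in_x: "fst x \<in> E" "snd x \<in> fst x" "snd y \<in> fst x" "snd z \<in> fst x"
      using xyz mem[of x] mem[of y] mem[of z] unfolding \<alpha>_def by simp_all
    obtain u v where uv: "fst x = {u, v}" using edge[OF in_x(1)] by blast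
    have ne: "snd x \<noteq> snd y" "snd x \<noteq> snd z" "fst y = fst z" using xyz unfolding \<alpha>_def by simp_all
    have "snd y = snd z" using ne(1,2) in_x(2-4) unfolding uv by (elim insertE emptyE) simp_all
    then show "y = z" using ne(3) by (simp add: prod_eq_iff)
  next
    fix x y assume "\<alpha> x y"
    then show "\<alpha> y x" unfolding \<alpha>_def by metis
    show "x \<noteq> y" using \<open>\<alpha> x y\<close> unfolding \<alpha>_def by blast
  qed
  obtain \<beta> where \<beta>: "partial_matching \<beta>"
    "\<forall>c. (\<forall>x\<in>X. \<forall>y\<in>X. \<beta> x y \<longrightarrow> c x \<noteq> c y) \<longrightarrow>
      (\<forall>P. card {x \<in> X. snd x = P \<and> c x} \<le> (card {x \<in> X. snd x = P} + 1) div 2)"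
    using pairing_exists[OF finX, of snd] by (elim exE conjE)
  obtain c :: "'a set \<times> 'a \<Rightarrow> bool" where c: "\<forall>x\<in>X. \<forall>y\<in>X. \<alpha> x y \<or> \<beta> x y \<longrightarrow> c x \<noteq> c y"
    using two_matchings[OF finX \<alpha> \<beta>(1)] by (elim exE)
  have cardX: "card {x \<in> X. snd x = v} \<le> 2 * k" for v
  proof -
    have "card {x \<in> X. snd x = v} \<le> card {e \<in> E. v \<in> e}"
      using assms(1) by (intro card_inj_on_le[of fst]) (auto simp: X_def inj_on_def)
    then show ?thesis using deg[of v] by simp
  qed
  have half: "card {x \<in> X. snd x = v \<and> c' x} \<le> k"
    if "\<forall>x\<in>X. \<forall>y\<in>X. \<beta> x y \<longrightarrow> c' x \<noteq> c' y" for c' v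
  proof -
    have "card {x \<in> X. snd x = v \<and> c' x} \<le> (card {x \<in> X. snd x = v} + 1) div 2"
      using \<beta>(2)[THEN spec, THEN mp, OF that] by (rule spec)
    \<comment> \<open>An odd degree leaves one half-edge unpaired; the rounding is harmless because
      the bound \<open>2 * k\<close> is even.\<close>
    also have "\<dots> \<le> (2 * k + 1) div 2" using cardX[of v] by (intro div_le_mono) simp
    finally show ?thesis by simp
  qed
  define tl where "tl = (\<lambda>e. SOME u. u \<in> e \<and> c (e, u))"
  define hd where "hd = (\<lambda>e. SOME u. u \<in> e \<and> \<not> c (e, u))"
  have th: "e = {tl e, hd e} \<and> tl e \<noteq> hd e \<and> c (e, tl e) \<and> \<not> c (e, hd e)" if e: "e \<in> E" for e
  proof -
    obtain u v where uv: "u \<noteq> v" "e = {u, v}" using edge[OF e] by blast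
    then have "\<alpha> (e, u) (e, v)" "(e, u) \<in> X" "(e, v) \<in> X" using e by (simp_all add: \<alpha>_def X_def)
    then have "c (e, u) \<noteq> c (e, v)" using c by blast
    then have ex: "\<exists>u. u \<in> e \<and> c (e, u)" "\<exists>u. u \<in> e \<and> \<not> c (e, u)" using uv(2) by blast+
    have tl: "tl e \<in> e \<and> c (e, tl e)" unfolding tl_def by (rule someI_ex[OF ex(1)])
    have hd: "hd e \<in> e \<and> \<not> c (e, hd e)" unfolding hd_def by (rule someI_ex[OF ex(2)])
    have ne: "tl e \<noteq> hd e" using tl hd by auto
    have "tl e \<in> {u, v}" "hd e \<in> {u, v}" using tl hd unfolding uv(2)[symmetric] by blast+
    then have "{tl e, hd e} = {u, v}" using ne by auto
    then show ?thesis using tl hd ne unfolding uv(2)[symmetric] by metis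
  qed
  have mem: "(e, tl e) \<in> X \<and> c (e, tl e)" "(e, hd e) \<in> X \<and> \<not> c (e, hd e)" if "e \<in> E" for e
    using th[OF that] that unfolding X_def by blast+
  have tl_le: "card {e \<in> E. tl e = v} \<le> k" for v
  proof -
    have "card {e \<in> E. tl e = v} \<le> card {x \<in> X. snd x = v \<and> c x}"
      using finX mem by (intro card_inj_on_le[of "\<lambda>e. (e, v)"]) (auto simp: inj_on_def)
    moreover have "\<forall>x\<in>X. \<forall>y\<in>X. \<beta> x y \<longrightarrow> c x \<noteq> c y" using c by blast
    ultimately show ?thesis using half[of c v] by simp
  qed
  have hd_le: "card {e \<in> E. hd e = v} \<le> k" for v
  proof -
    have "card {e \<in> E. hd e = v} \<le> card {x \<in> X. snd x = v \<and> \<not> c x}"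
      using finX mem by (intro card_inj_on_le[of "\<lambda>e. (e, v)"]) (auto simp: inj_on_def)
    moreover have "\<forall>x\<in>X. \<forall>y\<in>X. \<beta> x y \<longrightarrow> (\<not> c x) \<noteq> (\<not> c y)" using c by blast
    ultimately show ?thesis using half[of "\<lambda>x. \<not> c x" v] by simp
  qed
  obtain col where "\<forall>e\<in>E. col e < k"
    "\<forall>e\<in>E. \<forall>e'\<in>E. e \<noteq> e' \<and> col e = col e' \<longrightarrow> tl e \<noteq> tl e' \<and> hd e \<noteq> hd e'"
    using konig_edge_colouring[OF assms(1) tl_le hd_le] by (elim exE conjE)
  moreover have "\<forall>e\<in>E. e = {tl e, hd e} \<and> tl e \<noteq> hd e" using th by blast
  ultimately show ?thesis by blast
qed

text \<open>The conflict graph splits into \<open>2d+1\<close> matchings; each of them is destroyed by keeping one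
  element of every pair of a pairing of the parts, which halves the parts.\<close>

lemma independent_selection:
  assumes fin: "finite X" and sym: "\<And>x y. r x y \<Longrightarrow> r y x"
    and deg: "\<And>x. x \<in> X \<Longrightarrow> card {y \<in> X. r x y \<and> y \<noteq> x} \<le> d"
    and size: "\<And>x. x \<in> X \<Longrightarrow> card {y \<in> X. part y = part x} = 2 ^ (2 * d + 1) * R"
  shows "\<exists>W\<subseteq>X. (\<forall>x\<in>X. card {y \<in> W. part y = part x} = R) \<and>
    (\<forall>x\<in>W. \<forall>y\<in>W. x \<noteq> y \<longrightarrow> \<not> r x y)"
proof -
  define E where "E = {{x, y} | x y. x \<in> X \<and> y \<in> X \<and> x \<noteq> y \<and> r x y}"
  have "E \<subseteq> Pow X" by (auto simp: E_def)
  then have finE: "finite E" using fin by (simp add: finite_subset)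
  \<comment> \<open>An edge of the conflict graph meets at most \<open>d\<close> others at each end,
    so a greedy colouring of these edges yields \<open>2 * d + 1\<close> matchings.\<close>
  have degE: "card {f \<in> E. e \<inter> f \<noteq> {} \<and> f \<noteq> e} \<le> 2 * d" if e: "e \<in> E" for e
  proof -
    obtain x y where xy: "e = {x, y}" "x \<in> X" "y \<in> X" "x \<noteq> y" "r x y"
      using e by (auto simp: E_def)
    define nb where "nb = (\<lambda>z. {y \<in> X. r z y \<and> y \<noteq> z})"
    have nb: "finite (nb z)" for z using fin by (simp add: nb_def)
    have "{f \<in> E. e \<inter> f \<noteq> {} \<and> f \<noteq> e} \<subseteq> (\<lambda>z. {x, z}) ` nb x \<union> (\<lambda>z. {y, z}) ` nb y"
    proof
      fix f assume f: "f \<in> {f \<in> E. e \<inter> f \<noteq> {} \<and> f \<noteq> e}"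
      then obtain u v where uv: "f = {u, v}" "u \<in> X" "v \<in> X" "u \<noteq> v" "r u v"
        by (auto simp: E_def)
      have "u \<in> nb v" "v \<in> nb u" using uv sym by (auto simp: nb_def)
      moreover have "u = x \<or> u = y \<or> v = x \<or> v = y" using f xy uv by auto
      ultimately show "f \<in> (\<lambda>z. {x, z}) ` nb x \<union> (\<lambda>z. {y, z}) ` nb y"
        unfolding uv(1) by (auto simp: insert_commute)
    qed
    then have "card {f \<in> E. e \<inter> f \<noteq> {} \<and> f \<noteq> e} \<le>
        card ((\<lambda>z. {x, z}) ` nb x \<union> (\<lambda>z. {y, z}) ` nb y)"
      using nb by (intro card_mono) auto
    also have "\<dots> \<le> card ((\<lambda>z. {x, z}) ` nb x) + card ((\<lambda>z. {y, z}) ` nb y)"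
      by (rule card_Un_le)
    also have "\<dots> \<le> card (nb x) + card (nb y)"
      by (intro add_mono card_image_le nb)
    also have "\<dots> \<le> 2 * d" using deg[of x] deg[of y] xy by (simp add: nb_def)
    finally show ?thesis .
  qed
  obtain col where col: "\<forall>e\<in>E. col e \<le> 2 * d"
    "\<forall>e\<in>E. \<forall>f\<in>E. e \<noteq> f \<and> e \<inter> f \<noteq> {} \<longrightarrow> col e \<noteq> col f"
    using greedy_colouring[OF finE, of "\<lambda>e f. e \<inter> f \<noteq> {}" "2 * d"] degE by (auto simp: Int_commute)
  have "\<exists>W\<subseteq>X. (\<forall>x\<in>X. card {y \<in> W. part y = part x} = 2 ^ (2 * d + 1 - j) * R) \<and>
    (\<forall>x\<in>W. \<forall>y\<in>W. x \<noteq> y \<and> r x y \<longrightarrow> j \<le> col {x, y})" if "j \<le> 2 * d + 1" for j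
    using that
  proof (induction j)
    case 0
    then show ?case using size by (intro exI[of _ X]) simp
  next
    case (Suc j)
    then obtain W where W: "W \<subseteq> X"
      "\<forall>x\<in>X. card {y \<in> W. part y = part x} = 2 ^ (2 * d + 1 - j) * R"
      "\<forall>x\<in>W. \<forall>y\<in>W. x \<noteq> y \<and> r x y \<longrightarrow> j \<le> col {x, y}" by auto
    have finW: "finite W" using W(1) fin finite_subset by blast
    define \<alpha> where "\<alpha> = (\<lambda>x y. x \<in> X \<and> y \<in> X \<and> x \<noteq> y \<and> r x y \<and> col {x, y} = j)"
    have \<alpha>: "partial_matching \<alpha>"
      unfolding partial_matching_def
    proof (intro conjI allI impI)
      fix x y z assume xyz: "\<alpha> x y" "\<alpha> x z"
      then have "{x, y} \<in> E" "{x, z} \<in> E" by (auto simp: \<alpha>_def E_def)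
      moreover have "col {x, y} = col {x, z}" "{x, y} \<inter> {x, z} \<noteq> {}"
        using xyz by (auto simp: \<alpha>_def)
      ultimately have "{x, y} = {x, z}"
        using col(2)[rule_format, of "{x, y}" "{x, z}"] by (cases "{x, y} = {x, z}") simp_all
      then show "y = z" by (auto simp: doubleton_eq_iff)
    qed (auto simp: \<alpha>_def insert_commute sym)
    obtain \<beta> where \<beta>: "partial_matching \<beta>"
      "\<And>c. \<forall>x\<in>W. \<forall>y\<in>W. \<beta> x y \<longrightarrow> c x \<noteq> c y \<Longrightarrow>
        \<forall>P. card {x \<in> W. part x = P \<and> c x} \<le> (card {x \<in> W. part x = P} + 1) div 2"
      using pairing_exists[OF finW, of part] by blast
    obtain c :: "'a \<Rightarrow> bool" where c: "\<forall>x\<in>W. \<forall>y\<in>W. \<alpha> x y \<or> \<beta> x y \<longrightarrow> c x \<noteq> c y"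
      using two_matchings[OF finW \<alpha> \<beta>(1)] by blast
    define m where "m = 2 ^ (2 * d - j) * R"
    have m: "card {y \<in> W. part y = part x} = 2 * m" if "x \<in> X" for x
    proof -
      have "2 * d + 1 - j = Suc (2 * d - j)" using Suc.prems by simp
      then show ?thesis using W(2) that by (simp add: m_def)
    qed
    have half: "card {y \<in> W. part y = part x \<and> c' y} \<le> m"
      if "x \<in> X" "\<forall>x\<in>W. \<forall>y\<in>W. \<beta> x y \<longrightarrow> c' x \<noteq> c' y" for c' x
    proof -
      have "card {y \<in> W. part y = part x \<and> c' y} \<le> (2 * m + 1) div 2"
        using \<beta>(2)[OF that(2), rule_format, of "part x"] unfolding m[OF that(1)] .
      then show ?thesis by simp
    qed
    \<comment> \<open>Both classes of \<open>c\<close> contain at most \<open>m\<close> of the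
      \<open>2 * m\<close> elements of a part, hence exactly \<open>m\<close>.\<close>
    have "card {y \<in> {y \<in> W. c y}. part y = part x} = m" if x: "x \<in> X" for x
    proof -
      have "card {y \<in> W. part y = part x} = card ({y \<in> W. part y = part x \<and> c y} \<union>
          {y \<in> W. part y = part x \<and> \<not> c y})" by (rule arg_cong[of _ _ card]) auto
      also have "\<dots> = card {y \<in> W. part y = part x \<and> c y} + card {y \<in> W. part y = part x \<and> \<not> c y}"
        using finW by (intro card_Un_disjoint) auto
      finally have "2 * m = card {y \<in> W. part y = part x \<and> c y} +
          card {y \<in> W. part y = part x \<and> \<not> c y}"
        using m[OF x] by simp
      moreover have "card {y \<in> W. part y = part x \<and> c y} \<le> m" using half[OF x, of c] c by blast
      moreover have "card {y \<in> W. part y = part x \<and> \<not> c y} \<le> m"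
        using half[OF x, of "\<lambda>y. \<not> c y"] c by blast
      ultimately have "card {y \<in> W. part y = part x \<and> c y} = m" by simp
      moreover have "{y \<in> {y \<in> W. c y}. part y = part x} = {y \<in> W. part y = part x \<and> c y}" by auto
      ultimately show ?thesis by simp
    qed
    moreover have "Suc j \<le> col {x, y}" if "x \<in> W" "y \<in> W" "c x" "c y" "x \<noteq> y" "r x y" for x y
    proof -
      have "col {x, y} \<noteq> j" using c that W(1) unfolding \<alpha>_def by blast
      then show ?thesis using W(3) that by (simp add: Suc_le_eq le_neq_implies_less)
    qed
    ultimately show ?case
      using W(1) Suc.prems by (intro exI[of _ "{y \<in> W. c y}"]) (auto simp: m_def)
  qed
  from this[of "2 * d + 1"] obtain W where W: "W \<subseteq> X"
    "\<forall>x\<in>X. card {y \<in> W. part y = part x} = R"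
    "\<forall>x\<in>W. \<forall>y\<in>W. x \<noteq> y \<and> r x y \<longrightarrow> 2 * d + 1 \<le> col {x, y}" by auto
  have "\<not> r x y" if "x \<in> W" "y \<in> W" "x \<noteq> y" for x y
  proof
    assume "r x y"
    then have "2 * d + 1 \<le> col {x, y}" "{x, y} \<in> E" using W that by (auto simp: E_def)
    then show False using col(1) by force
  qed
  then show ?thesis using W by blast
qed


section \<open>Sequential random tilings\<close>

text \<open>Finite distributions are weighted lists in which outcomes may repeat; splitting an
  outcome or mixing distributions is then mere concatenation.\<close>

definition expect :: "(real \<times> 's) list \<Rightarrow> ('s \<Rightarrow> real) \<Rightarrow> real" where
  "expect D g = (\<Sum>(q, s)\<leftarrow>D. q * g s)"

definition distribution :: "(real \<times> 's) list \<Rightarrow> bool" where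
  "distribution D \<longleftrightarrow> (\<forall>(q, s)\<in>set D. 0 \<le> q) \<and> expect D (\<lambda>_. 1) = 1"

text \<open>Entries of weight 0 are discarded, since splitting an outcome may list impossible states
  with weight 0.\<close>

definition supp :: "(real \<times> 's) list \<Rightarrow> 's set" where
  "supp D = {s. \<exists>q. (q, s) \<in> set D \<and> q \<noteq> 0}"

lemma expect_Nil [simp]: "expect [] g = 0"
  and expect_Cons [simp]: "expect ((q, s) # D) g = q * g s + expect D g"
  by (simp_all add: expect_def)

lemma expect_append: "expect (D @ D') g = expect D g + expect D' g"
  by (induction D) auto

lemma expect_diff: "expect D (\<lambda>s. g s - h s) = expect D g - expect D h"
  by (induction D) (auto simp: algebra_simps)

lemma expect_cmult: "expect D (\<lambda>s. c * g s) = c * expect D g"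
  by (induction D) (auto simp: algebra_simps)

lemma expect_sum: "expect D (\<lambda>s. \<Sum>i\<in>I. g i s) = (\<Sum>i\<in>I. expect D (g i))"
  by (induction D) (auto simp: sum.distrib sum_distrib_left)

lemma expect_cong: "(\<And>s. s \<in> supp D \<Longrightarrow> g s = h s) \<Longrightarrow> expect D g = expect D h"
proof (induction D)
  case (Cons a D)
  then show ?case by (cases a) (fastforce simp: supp_def)
qed simp

lemma expect_mono:
  "distribution D \<Longrightarrow> (\<And>s. g s \<le> h s) \<Longrightarrow> expect D g \<le> expect D h"
  unfolding expect_def distribution_def by (intro sum_list_mono) (auto intro!: mult_left_mono)

lemma expect_nonneg: "distribution D \<Longrightarrow> (\<And>s. 0 \<le> g s) \<Longrightarrow> 0 \<le> expect D g"
  using expect_mono[of D "\<lambda>_. 0" g] expect_cmult[of D 0 "\<lambda>_. 0"] by simp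

lemma expect_eq_0_iff:
  assumes "distribution D" "\<And>s. 0 \<le> g s"
  shows "expect D g = 0 \<longleftrightarrow> (\<forall>s\<in>supp D. g s = 0)"
proof -
  have "\<forall>(q, s)\<in>set D. 0 \<le> q \<Longrightarrow> expect D g = 0 \<longleftrightarrow> (\<forall>s\<in>supp D. g s = 0)"
  proof (induction D)
    case (Cons a D)
    obtain q s where a: "a = (q, s)" by fastforce
    have "0 \<le> q * g s" "0 \<le> expect D g"
      using Cons.prems assms(2) unfolding a expect_def
      by (auto intro!: sum_list_nonneg mult_nonneg_nonneg)
    then have "expect (a # D) g = 0 \<longleftrightarrow> q * g s = 0 \<and> expect D g = 0"
      by (simp add: a add_nonneg_eq_0_iff)
    then show ?case using Cons by (auto simp: a supp_def)
  qed (simp add: supp_def)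
  then show ?thesis using assms(1) by (simp add: distribution_def)
qed

datatype cell = Single | Tail | Head

text \<open>Takes the place of measurability with respect to the states on \<open>A\<close>.\<close>

definition depends_on :: "'v set \<Rightarrow> (('v \<Rightarrow> 'c) \<Rightarrow> 'r) \<Rightarrow> bool" where
  "depends_on A g \<longleftrightarrow> (\<forall>s s'. (\<forall>w\<in>A. s w = s' w) \<longrightarrow> g s = g s')"

text \<open>A matching along lines with predecessor map \<open>p\<close> is encoded by marking each vertex as the tail
  or the head of an edge of the matching, or as single. The prescribed probability of \<open>v\<close> being a
  tail is \<open>x v\<close>; then \<open>v\<close> is a head with probability \<open>x (p v)\<close> and single with probability \<open>a v\<close>.
  States are revealed in the order of \<open>T\<close>, and the state of \<open>v\<close> is a
  function of a coin at \<open>v\<close> and of the states of the vertices \<open>u\<close>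
  with \<open>dep v u\<close>. The predecessor of a vertex of \<open>Y\<close> is a head with
  certainty, so that the state there need not be known.\<close>

locale sequential_tiling =
  fixes V :: "'v set" and p :: "'v \<Rightarrow> 'v" and N :: "'v \<Rightarrow> 'v \<Rightarrow> bool"
    and Y :: "'v set" and x :: "'v \<Rightarrow> real" and T :: "'v \<Rightarrow> nat"
  fixes a dep
  defines "a v \<equiv> 1 - x (p v) - x v"
    and "dep v u \<equiv> (u = p v \<and> v \<notin> Y) \<or> (N v u \<and> T u < T v)"
  assumes finite_V: "finite V"
    and p_in: "v \<in> V \<Longrightarrow> p v \<in> V"
    and N_in: "N u v \<Longrightarrow> u \<in> V"
    and N_sym: "N u v \<Longrightarrow> N v u"
    and T_p: "v \<in> V \<Longrightarrow> v \<notin> Y \<Longrightarrow> T (p v) < T v"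
    and T_N: "N u v \<Longrightarrow> T u \<noteq> T v"
    and restart: "y \<in> Y \<Longrightarrow> x (p y) = 0 \<and> x (p (p y)) = 1"
    and a_nonneg: "v \<in> V \<Longrightarrow> 0 \<le> a v"
    and a_bound: "v \<in> V \<Longrightarrow> a v = 0 \<or> a v \<le> x (p (p v)) * (1 - (\<Sum>u | N v u. a u))"
    and cones_disjoint: "v \<in> V \<Longrightarrow> v \<notin> Y \<Longrightarrow> N v u \<Longrightarrow> T u < T v \<Longrightarrow>
      dep\<^sup>*\<^sup>* (p v) w \<Longrightarrow> \<not> dep\<^sup>*\<^sup>* u w"
begin

definition dep_closed :: "'v set \<Rightarrow> bool" where
  "dep_closed A \<longleftrightarrow> A \<subseteq> V \<and> (\<forall>v\<in>A. \<forall>u. dep v u \<longrightarrow> u \<in> A)"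

definition free :: "('v \<Rightarrow> cell) \<Rightarrow> 'v \<Rightarrow> bool" where
  "free s v \<longleftrightarrow> (\<forall>u. N v u \<and> T u < T v \<longrightarrow> s u \<noteq> Single)"

text \<open>After a tail its head is forced, and after a single vertex a tail, as consecutive
  vertices of a line must not both be uncovered. Only after a head is there a choice. On
  \<open>Y\<close> the predecessor is treated as a head without being looked at.\<close>

definition legal :: "('v \<Rightarrow> cell) \<Rightarrow> 'v \<Rightarrow> bool" where
  "legal s v \<longleftrightarrow>
     (if v \<in> Y then s v \<noteq> Head
      else (s v = Head \<longleftrightarrow> s (p v) = Tail) \<and> (s (p v) = Single \<longrightarrow> s v = Tail)) \<and>
     (s v = Single \<longrightarrow> free s v)"

text \<open>The last clause provides the independence for the union bound. It speaks of closed sets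
  because the states on a closed set are determined by the coins of that set, and disjoint sets have
  disjoint coins.\<close>

definition invariant :: "'v set \<Rightarrow> (real \<times> ('v \<Rightarrow> cell)) list \<Rightarrow> bool" where
  "invariant P D \<longleftrightarrow> distribution D \<and>
     (\<forall>v\<in>P. expect D (\<lambda>s. of_bool (s v = Tail)) = x v \<and>
            expect D (\<lambda>s. of_bool (s v = Head)) = x (p v)) \<and>
     (\<forall>s\<in>supp D. \<forall>v\<in>P. legal s v) \<and>
     (\<forall>A B g h. A \<subseteq> P \<longrightarrow> B \<subseteq> P \<longrightarrow> dep_closed A \<longrightarrow> dep_closed B \<longrightarrow> A \<inter> B = {} \<longrightarrow>
        depends_on A g \<longrightarrow> depends_on B h \<longrightarrow>
        expect D (\<lambda>s. g s * h s) = expect D g * expect D h)"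

lemma invariant_product:
  assumes "invariant P D" "A \<subseteq> P" "B \<subseteq> P" "dep_closed A" "dep_closed B" "A \<inter> B = {}"
    "depends_on A g" "depends_on B h"
  shows "expect D (\<lambda>s. g s * h s) = expect D g * expect D h"
  using assms(1)[unfolded invariant_def] assms(2-) by (elim conjE allE impE) assumption+

lemma dep_in: "v \<in> V \<Longrightarrow> dep v u \<Longrightarrow> u \<in> V"
  unfolding dep_def using p_in N_in N_sym by blast

lemma dep_less: "v \<in> V \<Longrightarrow> dep v u \<Longrightarrow> T u < T v"
  unfolding dep_def using T_p by blast

lemma closed_cone: "v \<in> V \<Longrightarrow> dep_closed {w. dep\<^sup>*\<^sup>* v w}"
proof -
  assume v: "v \<in> V"
  have "w \<in> V" if "dep\<^sup>*\<^sup>* v w" for w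
    using that by (induction rule: rtranclp_induct) (auto intro: v dep_in)
  then show ?thesis unfolding dep_closed_def by (auto intro: rtranclp.rtrancl_into_rtrancl)
qed

lemma cone_subset: "dep_closed P \<Longrightarrow> v \<in> P \<Longrightarrow> {w. dep\<^sup>*\<^sup>* v w} \<subseteq> P"
proof (intro subsetI, simp)
  fix w assume "dep_closed P" "v \<in> P" and w: "dep\<^sup>*\<^sup>* v w"
  show "w \<in> P"
    using w by (induction rule: rtranclp_induct) (use \<open>dep_closed P\<close> \<open>v \<in> P\<close> in \<open>auto simp:
        dep_closed_def\<close>)
qed

lemma expect_Single:
  assumes "invariant P D" "v \<in> P"
  shows "expect D (\<lambda>s. of_bool (s v = Single)) = a v"
proof -
  have "of_bool (s v = Single) = 1 - of_bool (s v = Tail) - (of_bool (s v = Head) :: real)" for s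
    by (cases "s v") auto
  then show ?thesis
    using assms by (simp add: expect_diff invariant_def distribution_def a_def)
qed

text \<open>Given that the predecessor of \<open>v\<close> is a head, each earlier neighbour \<open>u\<close> is single with the
  unconditional probability \<open>a u\<close>, since the two events depend on disjoint sets of coins. The union
  bound then leaves enough room for \<open>v\<close> to become single.\<close>

lemma prob_free_ge:
  assumes "invariant P D" "dep_closed P" "v \<in> V" "\<And>u. dep v u \<Longrightarrow> u \<in> P"
    and "a v \<noteq> 0"
  shows "a v \<le> expect D (\<lambda>s. of_bool ((v \<in> Y \<or> s (p v) = Head) \<and> free s v))"
proof -
  define hit :: "('v \<Rightarrow> cell) \<Rightarrow> real" where "hit = (\<lambda>s. of_bool (v \<in> Y \<or> s (p v) = Head))"
  define E where "E = {u. N v u \<and> T u < T v}"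
  have finN: "finite {u. N v u}"
    by (rule finite_subset[OF _ finite_V]) (use N_in N_sym in auto)
  then have finE: "finite E" unfolding E_def by (rule rev_finite_subset) auto
  have dist: "distribution D" using assms(1) by (simp add: invariant_def)
  have EP: "u \<in> P" if "u \<in> E" for u using assms(4)[of u] that by (auto simp: E_def dep_def)
  have hit: "expect D hit = x (p (p v))"
  proof (cases "v \<in> Y")
    case True
    then show ?thesis using restart[of v] dist by (simp add: hit_def distribution_def)
  next
    case False
    then have "p v \<in> P" using assms(4) by (simp add: dep_def)
    then show ?thesis using assms(1) False by (simp add: hit_def invariant_def)
  qed
  have indep: "expect D (\<lambda>s. hit s * of_bool (s u = Single)) = x (p (p v)) * a u" if u: "u \<in> E"
      for u
  proof (cases "v \<in> Y")
    case True
    then show ?thesis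
      using restart[of v] expect_Single[OF assms(1) EP[OF u]] by (simp add: hit_def)
  next
    case False
    then have pP: "p v \<in> P" using assms(4) by (simp add: dep_def)
    have PV: "P \<subseteq> V" using assms(2) by (simp add: dep_closed_def)
    have "expect D (\<lambda>s. hit s * of_bool (s u = Single)) =
      expect D hit * expect D (\<lambda>s. of_bool (s u = Single))"
    proof -
      have "{w. dep\<^sup>*\<^sup>* (p v) w} \<inter> {w. dep\<^sup>*\<^sup>* u w} = {}"
        using cones_disjoint[OF assms(3) False, of u] u by (auto simp: E_def)
      moreover have "depends_on {w. dep\<^sup>*\<^sup>* (p v) w} hit"
        unfolding depends_on_def hit_def by auto
      moreover have "depends_on {w. dep\<^sup>*\<^sup>* u w} (\<lambda>s. of_bool (s u = Single) :: real)"
        unfolding depends_on_def by auto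
      moreover have "p v \<in> V" "u \<in> V" using pP EP[OF u] PV by auto
      ultimately show ?thesis
        using cone_subset[OF assms(2) pP] cone_subset[OF assms(2) EP[OF u]] closed_cone
        by (intro invariant_product[OF assms(1)]) auto
    qed
    then show ?thesis using hit expect_Single[OF assms(1) EP[OF u]] by simp
  qed
  have "a v \<le> x (p (p v)) * (1 - (\<Sum>u | N v u. a u))" using a_bound assms(3,5) by blast
  also have "\<dots> \<le> x (p (p v)) * (1 - (\<Sum>u\<in>E. a u))"
  proof (rule mult_left_mono)
    show "1 - (\<Sum>u | N v u. a u) \<le> 1 - (\<Sum>u\<in>E. a u)"
      using finN by (auto simp: E_def intro!: sum_mono2 a_nonneg N_in[OF N_sym])
    show "0 \<le> x (p (p v))"
      unfolding hit[symmetric] by (rule expect_nonneg[OF dist]) (simp add: hit_def)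
  qed
  also have "\<dots> = expect D (\<lambda>s. hit s - (\<Sum>u\<in>E. hit s * of_bool (s u = Single)))"
    by (simp add: expect_diff expect_sum indep hit right_diff_distrib sum_distrib_left)
  also have "\<dots> \<le> expect D (\<lambda>s. of_bool ((v \<in> Y \<or> s (p v) = Head) \<and> free s v))"
  proof (rule expect_mono[OF dist])
    fix s :: "'v \<Rightarrow> cell"
    show "hit s - (\<Sum>u\<in>E. hit s * of_bool (s u = Single)) \<le>
      of_bool ((v \<in> Y \<or> s (p v) = Head) \<and> free s v)"
    proof (cases "free s v \<or> hit s = 0")
      case True
      moreover have "0 \<le> (\<Sum>u\<in>E. hit s * of_bool (s u = Single))"
        by (intro sum_nonneg) (simp add: hit_def)
      ultimately show ?thesis by (auto simp: hit_def)
    next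
      case False
      then obtain u where u: "u \<in> E" "s u = Single" by (auto simp: free_def E_def)
      then have "hit s * of_bool (s u = Single) \<le> (\<Sum>u\<in>E. hit s * of_bool (s u = Single))"
        using finE by (intro member_le_sum) (auto simp: hit_def)
      then show ?thesis using u by simp
    qed
  qed
  finally show ?thesis .
qed

text \<open>Every outcome is split into one where \<open>v\<close> is single and one where the
  predecessor dictates its state. The coin has bias \<open>c\<close> on the event \<open>hf\<close>
  that \<open>v\<close> may be single, whose probability is \<open>H\<close>; so \<open>v\<close> is
  single with probability \<open>c * H = a v\<close>, a head as often as \<open>p v\<close> is a
  tail, and a tail with the remaining probability \<open>x v\<close>. The bound
  \<open>c \<le> 1\<close> is \<open>prob_free_ge\<close>, available for nonzero
  \<open>a v\<close>.\<close>

lemma invariant_step: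
  assumes inv: "invariant P D" and P: "dep_closed P" and v: "v \<in> V" "v \<notin> P"
    and deps: "\<And>u. dep v u \<Longrightarrow> u \<in> P"
  shows "\<exists>D'. invariant (insert v P) D'"
proof -
  define hf where "hf = (\<lambda>s. (v \<in> Y \<or> s (p v) = Head) \<and> free s v)"
  define H where "H = expect D (\<lambda>s. of_bool (hf s))"
  define c where "c = (if a v = 0 then 0 else a v / H)"
  have aH: "a v \<le> H" if "a v \<noteq> 0"
    unfolding H_def hf_def by (rule prob_free_ge[OF inv P v(1) deps that])
  have c: "0 \<le> c" "c \<le> 1" "c * H = a v"
  proof -
    have "a v = 0 \<or> (0 < a v \<and> a v \<le> H)" using aH a_nonneg[OF v(1)] by linarith
    then show "0 \<le> c" "c \<le> 1" "c * H = a v" by (auto simp: c_def)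
  qed
  define \<kappa> where "\<kappa> = (\<lambda>s. c * of_bool (hf s))"
  define f where "f = (\<lambda>s. if v \<in> Y \<or> s (p v) \<noteq> Tail then Tail else Head)"
  have \<kappa>: "0 \<le> \<kappa> s" "\<kappa> s \<le> 1" for s using c by (auto simp: \<kappa>_def)
  define D' where "D' = concat (map (\<lambda>(q, s). [(q * \<kappa> s, s(v := Single)), (q * (1 - \<kappa> s), s(v := f
      s))]) D)"
  have E': "expect D' g = expect D (\<lambda>s. \<kappa> s * g (s(v := Single)) + (1 - \<kappa> s) * g (s(v := f s)))"
      for g
    unfolding D'_def by (induction D) (auto simp: expect_append algebra_simps)
  have dist: "distribution D" using inv by (simp add: invariant_def)
  have dist': "distribution D'"
    using dist \<kappa> unfolding distribution_def E' by (auto simp: D'_def)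
  have supp': "\<exists>s\<in>supp D. (hf s \<and> s' = s(v := Single)) \<or> s' = s(v := f s)" if "s' \<in> supp D'" for s'
    using that by (fastforce simp: supp_def D'_def \<kappa>_def split: if_splits)
  have same: "expect D' g = expect D g" if "\<And>s c. g (s(v := c)) = g s" for g
    unfolding E' that by (simp add: algebra_simps)
  have pv: "p v \<noteq> v" if "v \<notin> Y" using T_p[OF v(1) that] by auto
  have nd: "\<not> dep w v" if "w \<in> P" for w
    using P that v(2) unfolding dep_closed_def by blast
  have nN: "\<not> (N v v)" using T_N by blast
  have marg: "expect D' (\<lambda>s. of_bool (s v = Head)) = x (p v)"
    "expect D' (\<lambda>s. of_bool (s v = Tail)) = x v"
  proof -
    have "expect D' (\<lambda>s. of_bool (s v = Single)) = expect D \<kappa>"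
      unfolding E' by (intro expect_cong) (auto simp: f_def)
    then have S: "expect D' (\<lambda>s. of_bool (s v = Single)) = a v"
      using c by (simp add: \<kappa>_def expect_cmult H_def)
    have "expect D' (\<lambda>s. of_bool (s v = Head)) =
        expect D (\<lambda>s. of_bool (v \<notin> Y \<and> s (p v) = Tail))"
      unfolding E' by (intro expect_cong) (auto simp: f_def \<kappa>_def hf_def)
    also have "\<dots> = x (p v)"
    proof (cases "v \<in> Y")
      case True
      then show ?thesis using restart[of v] expect_cmult[of D 0] by simp
    next
      case False
      then have "p v \<in> P" using deps by (simp add: dep_def)
      then show ?thesis using inv False by (simp add: invariant_def)
    qed
    finally show H: "expect D' (\<lambda>s. of_bool (s v = Head)) = x (p v)" .
    have "of_bool (s v = Tail) = 1 - of_bool (s v = Single) - (of_bool (s v = Head) :: real)" for s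
      by (cases "s v") auto
    then show "expect D' (\<lambda>s. of_bool (s v = Tail)) = x v"
      using S H dist' by (simp add: expect_diff a_def distribution_def)
  qed
  have marg': "expect D' (\<lambda>s. of_bool (s w = Tail)) = x w \<and> expect D' (\<lambda>s. of_bool (s w = Head)) =
      x (p w)"
    if "w \<in> insert v P" for w
  proof (cases "w = v")
    case True
    then show ?thesis using marg by simp
  next
    case False
    then show ?thesis
      using that inv by (subst (1 2) same) (auto simp: invariant_def)
  qed
  have legal': "legal s' w" if s': "s' \<in> supp D'" and w: "w \<in> insert v P" for s' w
  proof -
    obtain s where s: "s \<in> supp D" "(hf s \<and> s' = s(v := Single)) \<or> s' = s(v := f s)"
      using supp'[OF s'] by blast
    have "free (s(v := d)) v = free s v" for d
      using nN unfolding free_def by (metis fun_upd_other)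
    then have free_v: "free s' v = free s v" using s(2) by blast
    show ?thesis
    proof (cases "w = v")
      case True
      show ?thesis
        using s(2) free_v pv unfolding True legal_def hf_def f_def
        by (cases "s (p v)") auto
    next
      case False
      then have wP: "w \<in> P" using w by simp
      then have leg: "legal s w" using inv s(1) by (simp add: invariant_def)
      have eq: "s' u = s u" if "u = w \<or> dep w u" for u
        using s(2) nd[OF wP] False that by auto
      have "s' w = s w" "w \<notin> Y \<Longrightarrow> s' (p w) = s (p w)"
        using eq by (simp_all add: dep_def)
      moreover have "free s' w = free s w"
        using eq unfolding free_def dep_def by (intro all_cong) simp
      ultimately show ?thesis using leg unfolding legal_def by simp
    qed
  qed
  have prod: "expect D' (\<lambda>s. g s * h s) = expect D' g * expect D' h"
    if AB: "A \<subseteq> insert v P" "B \<subseteq> P" "dep_closed A" "dep_closed B" "A \<inter> B = {}"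
      "depends_on A g" "depends_on B h" for A B and g h :: "('v \<Rightarrow> cell) \<Rightarrow> real"
  proof -
    have "v \<notin> B" using AB(2) v(2) by blast
    then have hv: "h (s(v := d)) = h s" for s d
      using AB(7) unfolding depends_on_def by (metis fun_upd_other)
    \<comment> \<open>Only one of two disjoint sets contains \<open>v\<close>. \<open>K\<close>
      averages the function of that set over the coin at \<open>v\<close>; it depends on
      \<open>A - {v}\<close> alone because a closed \<open>A\<close> containing \<open>v\<close>
      also contains everything the coin looks at.\<close>
    define K where "K = (\<lambda>s. \<kappa> s * g (s(v := Single)) + (1 - \<kappa> s) * g (s(v := f s)))"
    have "expect D' (\<lambda>s. g s * h s) = expect D (\<lambda>s. K s * h s)"
      unfolding E' hv K_def by (simp add: algebra_simps)
    also have "\<dots> = expect D K * expect D h"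
    proof -
      have "depends_on (A - {v}) K"
      proof (cases "v \<in> A")
        case True
        show ?thesis
          unfolding depends_on_def
        proof (intro allI impI)
          fix s s' :: "'v \<Rightarrow> cell" assume eq: "\<forall>w\<in>A - {v}. s w = s' w"
          have d: "s u = s' u" if "dep v u" for u
            using eq that AB(3) True dep_less[OF v(1) that] unfolding dep_closed_def by blast
          have "\<kappa> s = \<kappa> s'"
          proof -
            have "free s v = free s' v"
              using d unfolding free_def dep_def by (intro all_cong) simp
            moreover have "v \<in> Y \<or> s (p v) = s' (p v)" using d by (auto simp: dep_def)
            ultimately show ?thesis by (auto simp: \<kappa>_def hf_def)
          qed
          moreover have "f s = f s'" using d[of "p v"] by (auto simp: f_def dep_def)
          moreover have "g (s(v := d)) = g (s'(v := d))" for d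
            by (rule AB(6)[unfolded depends_on_def, rule_format]) (use eq in auto)
          ultimately show "K s = K s'" unfolding K_def by simp
        qed
      next
        case False
        then have "g (s(v := d)) = g s" for s d
          using AB(6) unfolding depends_on_def by (metis fun_upd_other)
        then have "K = g" unfolding K_def by (simp add: algebra_simps)
        then show ?thesis using AB(6) False by simp
      qed
      moreover have "dep_closed (A - {v})"
        using AB(1,3) nd unfolding dep_closed_def by blast
      moreover have "A - {v} \<subseteq> P" "(A - {v}) \<inter> B = {}" using AB by blast+
      ultimately show ?thesis using AB by (intro invariant_product[OF inv])
    qed
    also have "expect D K = expect D' g" unfolding E' K_def ..
    also have "expect D h = expect D' h" using same[of h] hv by simp
    finally show ?thesis .
  qed
  have prod': "expect D' (\<lambda>s. g s * h s) = expect D' g * expect D' h"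
    if "A \<subseteq> insert v P" "B \<subseteq> insert v P" "dep_closed A" "dep_closed B" "A \<inter> B = {}"
      "depends_on A g" "depends_on B h" for A B and g h :: "('v \<Rightarrow> cell) \<Rightarrow> real"
  proof (cases "v \<in> B")
    case True
    then have "A \<subseteq> P" using that by blast
    then show ?thesis using prod[of B A h g] that by (simp add: mult.commute Int_commute)
  next
    case False
    then have "B \<subseteq> P" using that by blast
    then show ?thesis using prod[of A B g h] that by simp
  qed
  have "invariant (insert v P) D'"
    unfolding invariant_def
    by (intro conjI ballI allI impI) (use dist' marg' legal' prod' in simp_all)
  then show ?thesis by (rule exI)
qed

lemma invariant_exists: "dep_closed P \<Longrightarrow> \<exists>D. invariant P D"
proof (induction "card P" arbitrary: P)
  case 0
  then have "P = {}" using finite_V by (auto simp: dep_closed_def dest: finite_subset)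
  then have "invariant P [(1, \<lambda>_. Tail)]"
    by (auto simp: invariant_def distribution_def)
  then show ?case by blast
next
  case (Suc n)
  have fin: "finite P" using Suc.prems finite_V by (auto simp: dep_closed_def dest: finite_subset)
  have ne: "P \<noteq> {}" using Suc.hyps(2) by auto
  \<comment> \<open>Nothing in \<open>P\<close> depends on a vertex with the largest
    \<open>T\<close>, so what remains without it is still closed.\<close>
  have "Max (T ` P) \<in> T ` P" using fin ne by (intro Max_in) auto
  then obtain v where "v \<in> P" "T v = Max (T ` P)" by auto
  then have v: "v \<in> P" "\<And>w. w \<in> P \<Longrightarrow> T w \<le> T v" using fin by simp_all
  have vV: "v \<in> V" using Suc.prems v by (auto simp: dep_closed_def)
  have cl: "dep_closed (P - {v})"
    unfolding dep_closed_def
  proof (intro conjI ballI allI impI)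
    fix w u assume w: "w \<in> P - {v}" "dep w u"
    then have "u \<in> P" "w \<in> V" using Suc.prems by (auto simp: dep_closed_def)
    then show "u \<in> P - {v}" using dep_less[of w u] w v(2)[of w] by auto
  qed (use Suc.prems in \<open>auto simp: dep_closed_def\<close>)
  have "n = card (P - {v})" using Suc.hyps(2) v(1) fin by simp
  from Suc.hyps(1)[OF this cl] obtain D where "invariant (P - {v}) D" by blast
  then have "\<exists>D'. invariant (insert v (P - {v})) D'"
    using cl vV
  proof (rule invariant_step)
    fix u assume "dep v u"
    then show "u \<in> P - {v}"
      using Suc.prems v(1) dep_less[OF vV, of u] by (auto simp: dep_closed_def)
  qed auto
  then show ?case using v(1) by (simp add: insert_absorb)
qed

theorem random_tiling:
  "\<exists>D. distribution D \<and>
     (\<forall>v\<in>V. expect D (\<lambda>s. of_bool (s v = Tail)) = x v \<and>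
            expect D (\<lambda>s. of_bool (s v = Head)) = x (p v)) \<and>
     (\<forall>s\<in>supp D. (\<forall>v\<in>V. (s v = Head \<longleftrightarrow> s (p v) = Tail) \<and> (s (p v) = Single \<longrightarrow> s v = Tail)) \<and>
        (\<forall>u v. N u v \<longrightarrow> \<not> (s u = Single \<and> s v = Single)))"
proof -
  have "dep_closed V" using dep_in by (auto simp: dep_closed_def)
  then obtain D where D: "invariant V D" using invariant_exists by blast
  then have dist: "distribution D"
    and marg: "\<And>v. v \<in> V \<Longrightarrow> expect D (\<lambda>s. of_bool (s v = Tail)) = x v"
      "\<And>v. v \<in> V \<Longrightarrow> expect D (\<lambda>s. of_bool (s v = Head)) = x (p v)"
    and leg: "\<And>s v. s \<in> supp D \<Longrightarrow> v \<in> V \<Longrightarrow> legal s v"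
    unfolding invariant_def by auto
  \<comment> \<open>By \<open>restart\<close> this event has probability 1, so it holds throughout
    the support. It upgrades the weak rule of \<open>legal\<close> on \<open>Y\<close> to the
    general one.\<close>
  have Y: "s (p v) = Head" if "s \<in> supp D" "v \<in> V" "v \<in> Y" for s v
  proof -
    have "expect D (\<lambda>s. 1 - of_bool (s (p v) = Head)) = 0"
      using marg(2)[OF p_in[OF that(2)]] restart[OF that(3)] dist
      by (simp add: expect_diff distribution_def)
    then have "1 - of_bool (s (p v) = Head) = (0 :: real)"
      using that(1) dist by (subst (asm) expect_eq_0_iff) auto
    then show ?thesis by (simp split: if_splits)
  qed
  have "(s v = Head \<longleftrightarrow> s (p v) = Tail) \<and> (s (p v) = Single \<longrightarrow> s v = Tail)"
    if "s \<in> supp D" "v \<in> V" for s v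
    using leg[OF that] Y[OF that] unfolding legal_def by (auto split: if_splits)
  moreover have "\<not> (s u = Single \<and> s v = Single)" if s: "s \<in> supp D" and N: "N u v" for s u v
  proof -
    have "\<not> (s u = Single \<and> s v = Single)" if "N u v" "T u < T v" for u v
      using leg[OF s, of v] that N_sym N_in unfolding legal_def free_def by blast
    then show ?thesis using T_N[OF N] N N_sym by (metis nat_neq_iff)
  qed
  ultimately show ?thesis
    using dist marg by (intro exI[of _ D] conjI ballI allI impI) simp_all
qed

end


section \<open>Lines in a graph of large girth\<close>

definition cyclic_walk :: "('v \<Rightarrow> 'v \<Rightarrow> bool) \<Rightarrow> 'v list \<Rightarrow> bool" where
  "cyclic_walk adj c \<longleftrightarrow> 3 \<le> length c \<and> distinct c \<and>
     (\<forall>i<length c. adj (c ! i) (c ! (Suc i mod length c)))"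

lemma mixture_exists:
  assumes "0 < R" "\<And>\<rho>. \<rho> < R \<Longrightarrow> distribution (D \<rho>)"
  shows "\<exists>D'. distribution D' \<and> (\<forall>g. expect D' g = (\<Sum>\<rho><R. expect (D \<rho>) g) / real R) \<and>
    supp D' \<subseteq> (\<Union>\<rho><R. supp (D \<rho>))"
proof -
  define D' where "D' = concat (map (\<lambda>\<rho>. map (\<lambda>(q, s). (q / real R, s)) (D \<rho>)) [0..<R])"
  have scale: "expect (map (\<lambda>(q, s). (q / real R, s)) L) g = expect L g / real R" for L g
    by (induction L) (auto simp: add_divide_distrib)
  have "expect (concat (map (\<lambda>\<rho>. map (\<lambda>(q, s). (q / real R, s)) (D \<rho>)) [0..<n])) g =
      (\<Sum>\<rho><n. expect (D \<rho>) g) / real R" for n g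
    by (induction n) (auto simp: expect_append scale add_divide_distrib)
  then have E: "expect D' g = (\<Sum>\<rho><R. expect (D \<rho>) g) / real R" for g
    by (simp add: D'_def)
  have "distribution D'"
    unfolding distribution_def E using assms by (fastforce simp: D'_def distribution_def)
  moreover have "supp D' \<subseteq> (\<Union>\<rho><R. supp (D \<rho>))"
    unfolding supp_def D'_def by clarsimp blast
  ultimately show ?thesis using E by blast
qed

text \<open>The lines are the cycles of the permutation \<sigma>, so that every vertex has a
  predecessor. \<open>N\<close> stands for the edges of the other \<open>k - 1\<close> classes; each
  class contributes at most two neighbours, whence \<open>2 * k - 2\<close>.\<close>

locale line_system =
  fixes V :: "'v set" and \<sigma> :: "'v \<Rightarrow> 'v" and N :: "'v \<Rightarrow> 'v \<Rightarrow> bool" and k g :: nat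
  fixes adj
  defines "adj u v \<equiv> u \<in> V \<and> v \<in> V \<and> (\<sigma> u = v \<or> \<sigma> v = u \<or> N u v)"
  assumes finite_V: "finite V"
    and perm: "\<sigma> permutes V"
    and N_in: "N u v \<Longrightarrow> u \<in> V"
    and N_sym: "N u v \<Longrightarrow> N v u"
    and N_irrefl: "\<not> N v v"
    and N_\<sigma>: "\<not> N v (\<sigma> v)"
    and card_N: "card {u. N v u} \<le> 2 * k - 2"
    and no_fixed: "v \<in> V \<Longrightarrow> \<sigma> v \<noteq> v"
    and no_2_cycle: "v \<in> V \<Longrightarrow> \<sigma> (\<sigma> v) \<noteq> v"
    and girth: "cyclic_walk adj c \<Longrightarrow> g \<le> length c"
begin

abbreviation p :: "'v \<Rightarrow> 'v" where "p \<equiv> inv \<sigma>"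

lemma bij: "bij \<sigma>" using perm permutes_bij by blast

lemma \<sigma>_p [simp]: "\<sigma> (p v) = v" and p_\<sigma> [simp]: "p (\<sigma> v) = v"
  using permutes_inverses[OF perm] by auto

lemma \<sigma>_eq_iff [simp]: "\<sigma> u = \<sigma> v \<longleftrightarrow> u = v"
  using bij by (auto simp: bij_def inj_eq)

lemma \<sigma>_in [simp]: "\<sigma> v \<in> V \<longleftrightarrow> v \<in> V" using permutes_in_image[OF perm] .

lemma p_in [simp]: "p v \<in> V \<longleftrightarrow> v \<in> V" using permutes_in_image[OF permutes_inv[OF perm]] .

lemma pow_in [simp]: "(\<sigma> ^^ n) v \<in> V \<longleftrightarrow> v \<in> V" by (induction n) auto

lemma p_pow_in [simp]: "(p ^^ n) v \<in> V \<longleftrightarrow> v \<in> V" by (induction n) auto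

lemma pow_eq_iff [simp]: "(\<sigma> ^^ n) u = (\<sigma> ^^ n) v \<longleftrightarrow> u = v" by (induction n) auto

lemma pow_p_pow [simp]: "(\<sigma> ^^ n) ((p ^^ n) v) = v"
proof (induction n)
  case (Suc n)
  have "(\<sigma> ^^ Suc n) ((p ^^ Suc n) v) = (\<sigma> ^^ n) (\<sigma> (p ((p ^^ n) v)))"
    by (subst funpow_Suc_right[of n \<sigma>]) simp
  then show ?case using Suc by simp
qed simp

lemma p_pow_pow [simp]: "(p ^^ n) ((\<sigma> ^^ n) v) = v"
  by (metis pow_eq_iff pow_p_pow)

lemma pow_add: "(\<sigma> ^^ i) ((\<sigma> ^^ j) v) = (\<sigma> ^^ (i + j)) v"
  by (simp add: funpow_add)

lemma pow_p_Suc [simp]: "(\<sigma> ^^ Suc n) (p v) = (\<sigma> ^^ n) v"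
  by (simp add: funpow_Suc_right del: funpow.simps)

lemma adj_sym: "adj u v \<Longrightarrow> adj v u" using N_sym by (auto simp: adj_def)

lemma adj_\<sigma>: "v \<in> V \<Longrightarrow> adj v (\<sigma> v)" by (simp add: adj_def)

lemma adj_N: "N u v \<Longrightarrow> adj u v" using N_in N_sym by (auto simp: adj_def)

text \<open>A shortest such walk together with \<open>z\<close> is a cycle.\<close>

lemma detour_length:
  assumes walk: "((\<lambda>u w. adj u w \<and> u \<noteq> z \<and> w \<noteq> z) ^^ n) u w"
    and "u \<noteq> w" "adj z u" "adj w z"
  shows "g \<le> n + 2"
proof -
  let ?R = "\<lambda>u w. adj u w \<and> u \<noteq> z \<and> w \<noteq> z"
  define n' where "n' = (LEAST n. (?R ^^ n) u w)"
  have n': "(?R ^^ n') u w" "n' \<le> n" and least: "\<And>j. (?R ^^ j) u w \<Longrightarrow> n' \<le> j"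
    unfolding n'_def using walk by (auto intro: LeastI Least_le)
  obtain f where f: "f 0 = u" "f n' = w" "\<And>i. i < n' \<Longrightarrow> ?R (f i) (f (Suc i))"
    using n'(1) unfolding relpowp_fun_conv by blast
  have "0 < n'" using f(1,2) assms(2) by (cases n') auto
  have ne: "f i \<noteq> z" if "i \<le> n'" for i
    using f(3)[of i] f(3)[of "n' - 1"] that \<open>0 < n'\<close> by (cases "i = n'") auto
  have part: "(?R ^^ (j - i)) (f i) (f j)" if "i \<le> j" "j \<le> n'" for i j
    unfolding relpowp_fun_conv
    by (rule exI[of _ "\<lambda>l. f (i + l)"]) (use that f(3) in auto)
  have inj: "i = j" if "i \<le> j" "j \<le> n'" "f i = f j" for i j
  proof -
    have "(?R ^^ (i + (n' - j))) u w"
      unfolding relpowp_add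
      using part[of 0 i] part[of j n'] that f(1,2) by auto
    then show ?thesis using least[of "i + (n' - j)"] that by simp
  qed
  define c where "c = z # map f [0..<Suc n']"
  have len: "length c = n' + 2" by (simp add: c_def)
  have "inj_on f {0..<Suc n'}"
    by (intro inj_onI) (metis atLeastLessThan_iff inj less_Suc_eq_le nat_le_linear)
  then have "distinct c"
    using ne less_Suc_eq_le by (fastforce simp: c_def distinct_map simp del: upt_Suc)
  moreover have "adj (c ! i) (c ! (Suc i mod length c))" if i: "i < length c" for i
  proof (cases i)
    case 0
    then show ?thesis using assms(3) f(1) by (simp add: c_def nth_Cons' del: upt_Suc)
  next
    case (Suc j)
    show ?thesis
    proof (cases "j = n'")
      case True
      then show ?thesis using assms(4) f(2) Suc by (simp add: c_def del: upt_Suc)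
    next
      case False
      then show ?thesis using Suc i f(3)[of j] len by (simp add: c_def nth_Cons' del: upt_Suc)
    qed
  qed
  ultimately have "cyclic_walk adj c" using len \<open>0 < n'\<close> by (simp add: cyclic_walk_def)
  then show ?thesis using girth[of c] len n'(2) by simp
qed

lemma line_walk:
  assumes "u \<in> V" "\<And>i. i \<le> n \<Longrightarrow> (\<sigma> ^^ i) u \<noteq> z"
  shows "((\<lambda>u w. adj u w \<and> u \<noteq> z \<and> w \<noteq> z) ^^ n) u ((\<sigma> ^^ n) u)"
  unfolding relpowp_fun_conv
proof (intro exI[of _ "\<lambda>i. (\<sigma> ^^ i) u"] conjI allI impI)
  fix i assume "i < n"
  then show "(\<sigma> ^^ i) u \<noteq> z" "(\<sigma> ^^ Suc i) u \<noteq> z" using assms(2)[of i] assms(2)[of "Suc i"] by auto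
qed (use assms(1) in \<open>auto intro: adj_\<sigma>\<close>)

text \<open>The least period of \<open>v\<close> would be the length of a cycle:
  \<open>detour_length\<close> applies to \<open>v\<close> and the rest of its line. Periods 1 and
  2, which give no cycle, are excluded by \<open>no_fixed\<close> and
  \<open>no_2_cycle\<close>.\<close>

lemma pow_neq: "v \<in> V \<Longrightarrow> 0 < n \<Longrightarrow> n < g \<Longrightarrow> (\<sigma> ^^ n) v \<noteq> v"
proof
  assume v: "v \<in> V" and n: "0 < n" "n < g" "(\<sigma> ^^ n) v = v"
  define l where "l = (LEAST n. 0 < n \<and> (\<sigma> ^^ n) v = v)"
  have l: "0 < l" "(\<sigma> ^^ l) v = v" "l \<le> n"
    using LeastI[of "\<lambda>n. 0 < n \<and> (\<sigma> ^^ n) v = v" n] n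
      Least_le[of "\<lambda>n. 0 < n \<and> (\<sigma> ^^ n) v = v" n] by (auto simp: l_def)
  have least: "(\<sigma> ^^ j) v \<noteq> v" if "0 < j" "j < l" for j
    using not_less_Least[of j "\<lambda>n. 0 < n \<and> (\<sigma> ^^ n) v = v"] that by (auto simp: l_def)
  have "l \<noteq> 1" "l \<noteq> 2"
    using l(2) no_fixed[OF v] no_2_cycle[OF v] by (auto simp: numeral_2_eq_2)
  then have l3: "3 \<le> l" using l(1) by simp
  have pw: "(\<sigma> ^^ j) (\<sigma> v) = (\<sigma> ^^ Suc j) v" for j by (simp add: funpow_swap1)
  have "((\<lambda>u w. adj u w \<and> u \<noteq> v \<and> w \<noteq> v) ^^ (l - 2)) (\<sigma> v) ((\<sigma> ^^ (l - 2)) (\<sigma> v))"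
    using v l3 least unfolding pw[symmetric]
    by (intro line_walk) (auto simp: pw simp del: funpow.simps)
  moreover have "(\<sigma> ^^ (l - 2)) (\<sigma> v) = (\<sigma> ^^ (l - 1)) v"
  proof -
    have "Suc (l - 2) = l - 1" using l3 by simp
    then show ?thesis unfolding pw by presburger
  qed
  moreover have "\<sigma> v \<noteq> (\<sigma> ^^ (l - 1)) v"
  proof
    assume "\<sigma> v = (\<sigma> ^^ (l - 1)) v"
    also have "l - 1 = Suc (l - 2)" using l3 by simp
    finally have "(\<sigma> ^^ (l - 2)) v = v" by simp
    then show False using least[of "l - 2"] l3 by simp
  qed
  moreover have "adj ((\<sigma> ^^ (l - 1)) v) v"
  proof -
    have "\<sigma> ((\<sigma> ^^ (l - 1)) v) = (\<sigma> ^^ Suc (l - 1)) v" by simp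
    also have "\<dots> = v" using l(1,2) by simp
    finally show ?thesis using v by (simp add: adj_def)
  qed
  ultimately have "g \<le> l - 2 + 2" using v by (intro detour_length) (auto intro: adj_\<sigma>)
  then show False using l n l3 by simp
qed

lemma pow_inj: "v \<in> V \<Longrightarrow> i < g \<Longrightarrow> j < g \<Longrightarrow> (\<sigma> ^^ i) v = (\<sigma> ^^ j) v \<Longrightarrow> i = j"
proof (induction i j rule: linorder_wlog)
  case (le i j)
  then have "(\<sigma> ^^ i) ((\<sigma> ^^ (j - i)) v) = (\<sigma> ^^ i) v"
    unfolding pow_add by simp
  then have "(\<sigma> ^^ (j - i)) v = v" unfolding pow_eq_iff .
  then show ?case using pow_neq[of v "j - i"] le by fastforce
qed simp

text \<open>The \<open>N\<close>-edge would close the stretch of line from \<open>z\<close> to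
  \<open>u\<close> to a cycle of length \<open>n + 1\<close>. The degenerate cases of
  \<open>n\<close> being 0 or 1 fall to \<open>N_irrefl\<close> and
  \<open>N_\<sigma>\<close>.\<close>

lemma N_line_neq: "N z u \<Longrightarrow> Suc n < g \<Longrightarrow> (\<sigma> ^^ n) z \<noteq> u"
proof
  assume N: "N z u" and n: "Suc n < g" "(\<sigma> ^^ n) z = u"
  have z: "z \<in> V" using N N_in by blast
  have "n \<noteq> 0" "n \<noteq> 1" using n(2) N N_irrefl[of z] N_\<sigma>[of z] by (auto intro!: Nat.gr0I)
  then obtain j where j: "n = Suc (Suc j)" by (metis One_nat_def not0_implies_Suc)
  have pw: "(\<sigma> ^^ i) (\<sigma> z) = (\<sigma> ^^ Suc i) z" for i by (simp add: funpow_swap1)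
  have "((\<lambda>u w. adj u w \<and> u \<noteq> z \<and> w \<noteq> z) ^^ Suc j) (\<sigma> z) ((\<sigma> ^^ Suc j) (\<sigma> z))"
    using z n j pow_neq[of z] by (intro line_walk) (auto simp: pw simp del: funpow.simps)
  moreover have "(\<sigma> ^^ Suc j) (\<sigma> z) = u" unfolding pw using n j by simp
  moreover have "\<sigma> z \<noteq> u" using N N_\<sigma> by blast
  ultimately have "g \<le> Suc j + 2" using z N by (intro detour_length) (auto intro: adj_\<sigma> adj_N
      adj_sym)
  then show False using n j by simp
qed

lemma N_common_neighbour:
  assumes "N z u" "N z u'" "u \<noteq> u'" "n + 2 < g"
  shows "(\<sigma> ^^ n) u \<noteq> u'"
proof
  assume n: "(\<sigma> ^^ n) u = u'"
  have "((\<lambda>u w. adj u w \<and> u \<noteq> z \<and> w \<noteq> z) ^^ n) u ((\<sigma> ^^ n) u)"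
    using assms(4) N_line_neq[OF N_sym[OF assms(1)]] N_in[OF N_sym[OF assms(1)]]
    by (intro line_walk) auto
  then have "g \<le> n + 2" using assms n by (intro detour_length) (auto intro: adj_N adj_sym)
  then show False using assms(4) by simp
qed

text \<open>A maximal set with gaps of at least \<open>m\<close> works. The vertex \<open>w\<close>
  lying \<open>m\<close> steps before \<open>v\<close> is in it or in conflict with an element less
  than \<open>m\<close> steps away on either side; that element still precedes \<open>v\<close>, by
  at most \<open>2 * m\<close>.\<close>

lemma separated_set_exists:
  assumes "m < g"
  shows "\<exists>S\<subseteq>V. (\<forall>y\<in>S. \<forall>y'\<in>S. \<forall>i<m. y' = (\<sigma> ^^ i) y \<longrightarrow> i = 0) \<and>
    (\<forall>v\<in>V. \<exists>y\<in>S. \<exists>i\<le>2 * m. v = (\<sigma> ^^ i) y)"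
proof -
  define sep where "sep = (\<lambda>S. S \<subseteq> V \<and> (\<forall>y\<in>S. \<forall>y'\<in>S. \<forall>i<m. y' = (\<sigma> ^^ i) y \<longrightarrow> i = 0))"
  have "finite {S. sep S}"
    by (rule finite_subset[of _ "Pow V"]) (use finite_V in \<open>auto simp: sep_def\<close>)
  moreover have "{} \<in> {S. sep S}" by (simp add: sep_def)
  ultimately obtain S where S: "sep S" "\<And>S'. sep S' \<Longrightarrow> S \<subseteq> S' \<Longrightarrow> S' = S"
    using finite_has_maximal[of "{S. sep S}"] by auto
  have "\<exists>y\<in>S. \<exists>i\<le>2 * m. v = (\<sigma> ^^ i) y" if v: "v \<in> V" for v
  proof -
    define w where "w = (p ^^ m) v"
    have w: "w \<in> V" "v = (\<sigma> ^^ m) w" using v by (simp_all add: w_def)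
    show ?thesis
    proof (cases "w \<in> S")
      case True
      then show ?thesis using w by (intro bexI[of _ w] exI[of _ m]) auto
    next
      case False
      then have "\<not> sep (insert w S)" using S(2)[of "insert w S"] by blast
      then obtain y y' i where i: "y \<in> insert w S" "y' \<in> insert w S" "i < m" "y' = (\<sigma> ^^ i) y" "i
          \<noteq> 0"
        using S(1) w(1) unfolding sep_def by blast
      have "y \<in> V" using i(1) w(1) S(1) by (auto simp: sep_def)
      then have "(\<sigma> ^^ i) y \<noteq> y" using pow_neq[of y i] i assms by simp
      then consider "y = w" "y' \<in> S" | "y \<in> S" "y' = w"
        using i S(1) unfolding sep_def by blast
      then show ?thesis
      proof cases
        case 1
        have "(\<sigma> ^^ (m - i)) y' = (\<sigma> ^^ (m - i + i)) w" unfolding i(4) 1(1) pow_add ..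
        then show ?thesis using 1 i w by (intro bexI[of _ y'] exI[of _ "m - i"]) auto
      next
        case 2
        have "v = (\<sigma> ^^ (m + i)) y" unfolding w(2) 2(2)[symmetric] i(4) pow_add ..
        then show ?thesis using 2 i by (intro bexI[of _ y] exI[of _ "m + i"]) auto
      qed
    qed
  qed
  then show ?thesis using S(1) unfolding sep_def by blast
qed

text \<open>Every \<open>B \<rho>\<close> contains one vertex of each window of \<open>m\<close> consecutive vertices of a line; \<open>Sp b\<close>
  stands for the region in which the choice of \<open>b\<close> prescribes the probabilities.\<close>

lemma bases_exist:
  fixes Sp :: "'v \<Rightarrow> 'v set"
  assumes Sp: "\<And>b. finite (Sp b)" "\<And>b. card (Sp b) \<le> c" "\<And>v. card {b. v \<in> Sp b} \<le> c"
    "\<And>v. finite {b. v \<in> Sp b}"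
    and m: "m = 2 ^ (2 * (c * c) + 1) * R" "m < g"
  shows "\<exists>B :: nat \<Rightarrow> 'v set. \<forall>\<rho><R. B \<rho> \<subseteq> V \<and>
    (\<forall>b\<in>B \<rho>. \<forall>b'\<in>B \<rho>. b \<noteq> b' \<longrightarrow> Sp b \<inter> Sp b' = {}) \<and>
    (\<forall>v\<in>V. \<exists>b\<in>B \<rho>. \<exists>i\<le>3 * m. v = (\<sigma> ^^ (i + l)) b) \<and>
    (\<forall>\<rho>'<R. \<rho> \<noteq> \<rho>' \<longrightarrow> B \<rho> \<inter> B \<rho>' = {})"
proof -
  obtain S where S: "S \<subseteq> V" "\<And>y y' i. y \<in> S \<Longrightarrow> y' \<in> S \<Longrightarrow> i < m \<Longrightarrow> y' = (\<sigma> ^^ i) y \<Longrightarrow> i = 0"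
    "\<And>v. v \<in> V \<Longrightarrow> \<exists>y\<in>S. \<exists>i\<le>2 * m. v = (\<sigma> ^^ i) y"
  proof -
    obtain S where S: "S \<subseteq> V" "\<forall>y\<in>S. \<forall>y'\<in>S. \<forall>i<m. y' = (\<sigma> ^^ i) y \<longrightarrow> i = 0"
      "\<forall>v\<in>V. \<exists>y\<in>S. \<exists>i\<le>2 * m. v = (\<sigma> ^^ i) y"
      using separated_set_exists[OF m(2)] by blast
    show ?thesis by (rule that[of S]) (use S in blast)+
  qed
  define window where "window = (\<lambda>y. (\<lambda>i. (\<sigma> ^^ i) y) ` {..<m})"
  define X where "X = (\<Union>y\<in>S. window y)"
  have uniq: "y = y'" if "y \<in> S" "y' \<in> S" "v \<in> window y" "v \<in> window y'" for y y' v
  proof -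
    have *: "y = y'" if "y \<in> S" "y' \<in> S" "i \<le> j" "j < m" "(\<sigma> ^^ i) y = (\<sigma> ^^ j) y'" for i j y y'
    proof -
      have ij: "i + (j - i) = j" using that(3) by simp
      have "(\<sigma> ^^ i) y = (\<sigma> ^^ (i + (j - i))) y'" unfolding ij by (rule that(5))
      also have "\<dots> = (\<sigma> ^^ i) ((\<sigma> ^^ (j - i)) y')" by (rule pow_add[symmetric])
      finally have "y = (\<sigma> ^^ (j - i)) y'" unfolding pow_eq_iff .
      moreover from this have "j - i = 0" using that(4) by (intro S(2)[OF that(2,1)]) simp_all
      ultimately show ?thesis by simp
    qed
    obtain i j where "i < m" "j < m" "(\<sigma> ^^ i) y = (\<sigma> ^^ j) y'"
      using \<open>v \<in> window y\<close> \<open>v \<in> window y'\<close> by (auto simp: window_def)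
    then show ?thesis using *[of y y' i j] *[of y' y j i] \<open>y \<in> S\<close> \<open>y' \<in> S\<close> by (metis nat_le_linear)
  qed
  have XV: "X \<subseteq> V" using S(1) by (auto simp: X_def window_def)
  have finX: "finite X" using XV finite_V finite_subset by blast
  define part where "part = (\<lambda>v. THE y. y \<in> S \<and> v \<in> window y)"
  have part: "part v = y" if "y \<in> S" "v \<in> window y" for v y
    unfolding part_def using that uniq by blast
  have win: "{v \<in> X. part v = y} = window y" if "y \<in> S" for y
    using that part by (auto simp: X_def)
  have inj: "inj_on (\<lambda>i. (\<sigma> ^^ i) y) {..<m}" if "y \<in> S" for y
    using that S(1) m(2) pow_inj[of y] by (auto intro!: inj_onI)
  have size: "card {v \<in> X. part v = part x} = 2 ^ (2 * (c * c) + 1) * R" if x: "x \<in> X" for x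
  proof -
    obtain y where y: "y \<in> S" "x \<in> window y" using x by (auto simp: X_def)
    then have "card {v \<in> X. part v = part x} = card (window y)" using part[OF y] win[OF y(1)]
        by simp
    also have "\<dots> = m" using inj[OF y(1)] by (simp add: window_def card_image)
    finally show ?thesis using m(1) by simp
  qed
  define r where "r = (\<lambda>b b'. Sp b \<inter> Sp b' \<noteq> {})"
  \<comment> \<open>The footprint of \<open>b\<close> has at most \<open>c\<close> vertices, each in
    at most \<open>c\<close> footprints.\<close>
  have deg: "card {b' \<in> X. r b b' \<and> b' \<noteq> b} \<le> c * c" for b
  proof -
    have "card {b' \<in> X. r b b' \<and> b' \<noteq> b} \<le> card (\<Union>v\<in>Sp b. {b'. v \<in> Sp b'})"
      using Sp by (intro card_mono) (auto simp: r_def)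
    also have "\<dots> \<le> (\<Sum>v\<in>Sp b. card {b'. v \<in> Sp b'})" using Sp by (intro card_UN_le)
    also have "\<dots> \<le> (\<Sum>v\<in>Sp b. c)" using Sp by (intro sum_mono)
    also have "\<dots> \<le> c * c" using Sp(2)[of b] by simp
    finally show ?thesis .
  qed
  \<comment> \<open>Candidates with overlapping regions conflict. A selection with \<open>R\<close>
    vertices in each window supplies one vertex per window to each of the \<open>R\<close> sets of
    bases.\<close>
  have "\<exists>W\<subseteq>X. (\<forall>x\<in>X. card {y \<in> W. part y = part x} = R) \<and> (\<forall>x\<in>W. \<forall>y\<in>W. x \<noteq> y \<longrightarrow> \<not> r x y)"
    by (rule independent_selection[OF finX _ deg size]) (auto simp: r_def)
  then obtain W where W: "W \<subseteq> X" "\<And>x. x \<in> X \<Longrightarrow> card {y \<in> W. part y = part x} = R"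
    "\<And>x y. x \<in> W \<Longrightarrow> y \<in> W \<Longrightarrow> x \<noteq> y \<Longrightarrow> \<not> r x y" by blast
  have finW: "finite W" using W(1) finX finite_subset by blast
  show ?thesis
  proof (cases "R = 0")
    case False
    then have "0 < m" using m(1) by simp
    have card_win: "card (W \<inter> window y) = R" if "y \<in> S" for y
    proof -
      have "y \<in> window y" using \<open>0 < m\<close> by (auto simp: window_def intro!: image_eqI[of _ _ 0])
      then have "y \<in> X" "part y = y" using that part by (auto simp: X_def)
      moreover have "{v \<in> W. part v = y} = W \<inter> window y" using win[OF that] W(1) by blast
      ultimately show ?thesis using W(2)[of y] by simp
    qed
    have "\<forall>y\<in>S. \<exists>f. bij_betw f {0..<R} (W \<inter> window y)"
    proof
      fix y assume "y \<in> S"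
      have "finite (W \<inter> window y)" using finW by simp
      from ex_bij_betw_nat_finite[OF this] card_win[OF \<open>y \<in> S\<close>]
      show "\<exists>f. bij_betw f {0..<R} (W \<inter> window y)" by simp
    qed
    then obtain f where f: "\<And>y. y \<in> S \<Longrightarrow> bij_betw (f y) {0..<R} (W \<inter> window y)" by metis
    have fW: "f y \<rho> \<in> W \<inter> window y" if "y \<in> S" "\<rho> < R" for y \<rho>
      using bij_betwE[OF f[OF that(1)]] that(2) by simp
    define B where "B = (\<lambda>\<rho>. (\<lambda>y. f y \<rho>) ` S)"
    show ?thesis
    proof (intro exI[of _ B] allI impI conjI ballI)
      fix \<rho> assume \<rho>: "\<rho> < R"
      show BV: "B \<rho> \<subseteq> V" using fW \<rho> W(1) XV by (auto simp: B_def)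
      show "Sp b \<inter> Sp b' = {}" if "b \<in> B \<rho>" "b' \<in> B \<rho>" "b \<noteq> b'" for b b'
        using W(3)[of b b'] that fW \<rho> by (auto simp: B_def r_def)
      show "B \<rho> \<inter> B \<rho>' = {}" if \<rho>': "\<rho>' < R" "\<rho> \<noteq> \<rho>'" for \<rho>'
      proof (rule ccontr)
        assume "B \<rho> \<inter> B \<rho>' \<noteq> {}"
        then obtain y y' where y: "y \<in> S" "y' \<in> S" "f y \<rho> = f y' \<rho>'" by (auto simp: B_def)
        have "f y \<rho> \<in> window y" "f y \<rho> \<in> window y'"
          using fW[OF y(1) \<rho>] fW[OF y(2) \<rho>'(1)] y(3) by simp_all
        then have "y = y'" by (rule uniq[OF y(1,2)])
        then show False
          using y \<rho> \<rho>' bij_betw_imp_inj_on[OF f[OF y(1)]] by (auto dest: inj_onD)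
      qed
      show "\<exists>b\<in>B \<rho>. \<exists>i\<le>3 * m. v = (\<sigma> ^^ (i + l)) b" if v: "v \<in> V" for v
      proof -
        \<comment> \<open>Going back \<open>m + l\<close> steps first guarantees at least
          \<open>l\<close> steps between the base and \<open>v\<close>: the base lies less than
          \<open>m\<close> steps behind an element of \<open>S\<close>, which is at most
          \<open>2 * m\<close> steps further back.\<close>
        obtain y i where y: "y \<in> S" "i \<le> 2 * m" "(p ^^ (m + l)) v = (\<sigma> ^^ i) y"
          using S(3)[of "(p ^^ (m + l)) v"] v by auto
        obtain j where j: "j < m" "f y \<rho> = (\<sigma> ^^ j) y" using fW[OF y(1) \<rho>]
            by (auto simp: window_def)
        have "v = (\<sigma> ^^ (m + l)) ((p ^^ (m + l)) v)" by simp
        also have "\<dots> = (\<sigma> ^^ (m + l + i)) y" unfolding y(3) pow_add ..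
        also have "m + l + i = (m + i - j + l) + j" using j(1) by simp
        also have "(\<sigma> ^^ \<dots>) y = (\<sigma> ^^ (m + i - j + l)) (f y \<rho>)" unfolding j(2) pow_add ..
        finally have "v = (\<sigma> ^^ (m + i - j + l)) (f y \<rho>)" .
        moreover have "f y \<rho> \<in> B \<rho>" "m + i - j \<le> 3 * m" using y by (auto simp: B_def)
        ultimately show ?thesis by blast
      qed
    qed
  qed simp
qed

end


lemma relpowp_sym:
  assumes "\<And>a b. R a b \<Longrightarrow> R b a"
  shows "(R ^^ n) a b \<Longrightarrow> (R ^^ n) b a"
proof (induction n arbitrary: b)
  case (Suc n)
  then obtain c where "(R ^^ n) a c" "R c b" by auto
  then have "R b c" "(R ^^ n) c a" using assms Suc.IH by auto
  then show ?case by (rule relpowp_Suc_I2)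
qed simp

section \<open>Prescribed probabilities around reserved vertices\<close>

context line_system
begin

text \<open>A base \<open>b\<close> reserves \<open>z = (\<sigma> ^^ 3) b\<close>. Along its line the tail probabilities follow
  \<open>profile\<close>, which makes \<open>(\<sigma> ^^ 6) b\<close> the beginning of a tile with certainty. The first
  three values, repeated around the neighbours of \<open>z\<close>, keep these covered; so \<open>z\<close> may be left
  uncovered whenever the parity of the tiling requires it.\<close>

definition slot :: "'v \<Rightarrow> nat \<Rightarrow> 'v \<Rightarrow> bool" where
  "slot b i v \<longleftrightarrow> (i \<le> 2 * k + 5 \<and> v = (\<sigma> ^^ i) b) \<or>
     (i \<le> 2 \<and> (\<exists>u. N ((\<sigma> ^^ 3) b) u \<and> v = (\<sigma> ^^ i) (p u)))"

definition footprint :: "'v \<Rightarrow> 'v set" where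
  "footprint b = {v. \<exists>i. slot b i v}"

definition tagged :: "'v set \<Rightarrow> nat \<Rightarrow> 'v \<Rightarrow> bool" where
  "tagged B i v \<longleftrightarrow> (\<exists>b\<in>B. slot b i v)"

definition t :: real where "t = real k / (2 * real k + 1)"

definition \<delta> :: real where "\<delta> = 1 / (2 * real k + 1)"

text \<open>The values \<open>t\<close>, \<open>1 - t\<close>, \<open>t\<close> leave no probability
  for a single vertex in slots 1 and 2. The reserved vertex in slot 3 is never a tail, so slots 4
  and 5 are a tail and its head with certainty. From there the even slots descend from 1 and the odd
  ones ascend from 0 in steps of \<delta>. As \<open>t = k * \<delta>\<close>, they arrive at
  \<open>1 - t\<close> and \<open>t\<close> after \<open>k\<close> steps, which is why the slots end
  at \<open>2 * k + 5\<close>.\<close>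

definition profile :: "nat \<Rightarrow> real" where
  "profile i = (if i = 0 \<or> i = 2 then t else if i = 1 then 1 - t else if i = 3 then 0
     else if even i then 1 - real ((i - 4) div 2) * \<delta> else real ((i - 5) div 2) * \<delta>)"

definition marginal :: "'v set \<Rightarrow> ('v \<Rightarrow> real) \<Rightarrow> 'v \<Rightarrow> real" where
  "marginal B \<tau> v = (if \<exists>i. tagged B i v then profile (THE i. tagged B i v) else \<tau> v)"

lemma finite_N: "finite {u. N v u}"
  by (rule finite_subset[OF _ finite_V]) (use N_in N_sym in blast)

text \<open>There are \<open>2 * k + 6\<close> slots on the line of \<open>b\<close> and three
  around each of at most \<open>2 * k - 2\<close> neighbours of the reserved vertex, together
  \<open>8 * k\<close>.\<close>

lemma finite_footprint: "finite (footprint b)"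
  and card_footprint: "0 < k \<Longrightarrow> card (footprint b) \<le> 8 * k"
proof -
  let ?A = "(\<lambda>i. (\<sigma> ^^ i) b) ` {..2 * k + 5}"
  let ?B = "(\<lambda>(i, u). (\<sigma> ^^ i) (p u)) ` ({..2} \<times> {u. N ((\<sigma> ^^ 3) b) u})"
  have sub: "footprint b \<subseteq> ?A \<union> ?B"
  proof
    fix v assume "v \<in> footprint b"
    then obtain i where "slot b i v" by (auto simp: footprint_def)
    then show "v \<in> ?A \<union> ?B"
      unfolding slot_def
    proof (elim disjE conjE exE)
      assume "i \<le> 2 * k + 5" "v = (\<sigma> ^^ i) b"
      then show ?thesis by blast
    next
      fix u assume "i \<le> 2" "N ((\<sigma> ^^ 3) b) u" "v = (\<sigma> ^^ i) (p u)"
      then have "v \<in> ?B" by (intro image_eqI[of _ _ "(i, u)"]) simp_all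
      then show ?thesis ..
    qed
  qed
  have fin: "finite ?A" "finite ?B" using finite_N by auto
  then show "finite (footprint b)" by (intro finite_subset[OF sub] finite_UnI)
  assume "0 < k"
  have "card (footprint b) \<le> card (?A \<union> ?B)" using fin by (intro card_mono[OF _ sub] finite_UnI)
  also have "\<dots> \<le> card ?A + card ?B" by (rule card_Un_le)
  also have "card ?A \<le> 2 * k + 6" using card_image_le[of "{..2 * k + 5}" "\<lambda>i. (\<sigma> ^^ i) b"] by simp
  also have "card ?B \<le> card ({..2::nat} \<times> {u. N ((\<sigma> ^^ 3) b) u})"
    using finite_N by (intro card_image_le) auto
  also have "\<dots> \<le> 3 * (2 * k - 2)" using card_N[of "(\<sigma> ^^ 3) b"]
      by (simp add: card_cartesian_product)
  finally show "card (footprint b) \<le> 8 * k" using \<open>0 < k\<close> by simp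
qed

lemma finite_footprint_inverse: "finite {b. v \<in> footprint b}"
  and card_footprint_inverse: "0 < k \<Longrightarrow> card {b. v \<in> footprint b} \<le> 8 * k"
proof -
  let ?A = "(\<lambda>i. (p ^^ i) v) ` {..2 * k + 5}"
  let ?B = "\<Union>i\<in>{..2}. (p ^^ 3) ` {w. N (\<sigma> ((p ^^ i) v)) w}"
  have sub: "{b. v \<in> footprint b} \<subseteq> ?A \<union> ?B"
  proof
    fix b assume "b \<in> {b. v \<in> footprint b}"
    then obtain i where "slot b i v" by (auto simp: footprint_def)
    then show "b \<in> ?A \<union> ?B"
      unfolding slot_def
    proof (elim disjE conjE exE)
      assume i: "i \<le> 2 * k + 5" "v = (\<sigma> ^^ i) b"
      then have "b = (p ^^ i) v" by (simp only: p_pow_pow)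
      then have "b \<in> ?A" using i(1) by (intro image_eqI[of _ _ i]) simp_all
      then show ?thesis ..
    next
      fix u assume i: "i \<le> 2" and u: "N ((\<sigma> ^^ 3) b) u" "v = (\<sigma> ^^ i) (p u)"
      then have "\<sigma> ((p ^^ i) v) = u" by (simp only: p_pow_pow \<sigma>_p)
      moreover have "b = (p ^^ 3) ((\<sigma> ^^ 3) b)" by (simp only: p_pow_pow)
      ultimately have "b \<in> (p ^^ 3) ` {w. N (\<sigma> ((p ^^ i) v)) w}"
        using N_sym[OF u(1)] by (intro image_eqI[of _ _ "(\<sigma> ^^ 3) b"]) simp_all
      then have "b \<in> ?B" using i by (intro UN_I[of i]) simp_all
      then show ?thesis ..
    qed
  qed
  have fin: "finite ?A" "finite ?B" using finite_N by auto
  then show "finite {b. v \<in> footprint b}" by (intro finite_subset[OF sub] finite_UnI)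
  assume "0 < k"
  have "card {b. v \<in> footprint b} \<le> card (?A \<union> ?B)" using fin
      by (intro card_mono[OF _ sub] finite_UnI)
  also have "\<dots> \<le> card ?A + card ?B" by (rule card_Un_le)
  also have "card ?A \<le> 2 * k + 6" using card_image_le[of "{..2 * k + 5}" "\<lambda>i. (p ^^ i) v"] by simp
  also have "card ?B \<le> (\<Sum>i\<in>{..2::nat}. card ((p ^^ 3) ` {w. N (\<sigma> ((p ^^ i) v)) w}))"
    by (rule card_UN_le) simp
  also have "\<dots> \<le> (\<Sum>i\<in>{..2::nat}. 2 * k - 2)"
    by (intro sum_mono order_trans[OF card_image_le[OF finite_N] card_N])
  finally show "card {b. v \<in> footprint b} \<le> 8 * k" using \<open>0 < k\<close> by simp
qed

lemma N_lines_disjoint: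
  assumes "N z u" "Suc i < g" "Suc j < g"
  shows "(\<sigma> ^^ i) z \<noteq> (\<sigma> ^^ j) u"
proof
  assume eq: "(\<sigma> ^^ i) z = (\<sigma> ^^ j) u"
  show False
  proof (cases "i \<le> j")
    case True
    then have "j = i + (j - i)" by simp
    then have "(\<sigma> ^^ i) z = (\<sigma> ^^ i) ((\<sigma> ^^ (j - i)) u)" using eq pow_add by metis
    moreover have "Suc (j - i) < g" using assms(3) by linarith
    ultimately show False using N_line_neq[OF N_sym[OF assms(1)], of "j - i"] by simp
  next
    case False
    then have "i = j + (i - j)" by simp
    then have "(\<sigma> ^^ j) u = (\<sigma> ^^ j) ((\<sigma> ^^ (i - j)) z)" using eq pow_add by metis
    moreover have "Suc (i - j) < g" using assms(2) by linarith
    ultimately show False using N_line_neq[OF assms(1), of "i - j"] by simp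
  qed
qed

lemma neighbour_lines_disjoint:
  assumes "N z u" "N z u'" "u \<noteq> u'" "i + 2 < g" "j + 2 < g"
  shows "(\<sigma> ^^ i) u \<noteq> (\<sigma> ^^ j) u'"
proof
  assume eq: "(\<sigma> ^^ i) u = (\<sigma> ^^ j) u'"
  show False
  proof (cases "i \<le> j")
    case True
    then have "j = i + (j - i)" by simp
    then have "(\<sigma> ^^ i) u = (\<sigma> ^^ i) ((\<sigma> ^^ (j - i)) u')" using eq pow_add by metis
    moreover have "j - i + 2 < g" using assms(5) by linarith
    ultimately show False
      using N_common_neighbour[OF assms(2,1) assms(3)[symmetric], of "j - i"] by simp
  next
    case False
    then have "i = j + (i - j)" by simp
    then have "(\<sigma> ^^ j) u' = (\<sigma> ^^ j) ((\<sigma> ^^ (i - j)) u)" using eq pow_add by metis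
    moreover have "i - j + 2 < g" using assms(4) by linarith
    ultimately show False using N_common_neighbour[OF assms(1-3), of "i - j"] by simp
  qed
qed

text \<open>Moving three steps forward turns every slot into a forward iterate of the reserved
  vertex or of one of its neighbours, the form in which the disjointness lemmas apply.\<close>

lemma slot_cases:
  assumes "slot b i v"
  obtains "i \<le> 2 * k + 5" "(\<sigma> ^^ 3) v = (\<sigma> ^^ i) ((\<sigma> ^^ 3) b)"
    | u where "i \<le> 2" "N ((\<sigma> ^^ 3) b) u" "(\<sigma> ^^ 3) v = (\<sigma> ^^ (i + 2)) u"
proof -
  from assms consider "i \<le> 2 * k + 5" "v = (\<sigma> ^^ i) b"
    | u where "i \<le> 2" "N ((\<sigma> ^^ 3) b) u" "v = (\<sigma> ^^ i) (p u)"
    unfolding slot_def by blast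
  then show ?thesis
  proof cases
    case 1
    have "(\<sigma> ^^ 3) v = (\<sigma> ^^ i) ((\<sigma> ^^ 3) b)" unfolding 1(2) pow_add by (simp only: add.commute)
    then show ?thesis using 1 that(1) by blast
  next
    case 2
    have "(\<sigma> ^^ 3) v = (\<sigma> ^^ (3 + i)) (p u)" unfolding 2(3) pow_add ..
    also have "3 + i = Suc (i + 2)" by simp
    also have "(\<sigma> ^^ Suc (i + 2)) (p u) = (\<sigma> ^^ (i + 2)) u" by (rule pow_p_Suc)
    finally show ?thesis using 2 that(2) by blast
  qed
qed

lemma slot_unique:
  assumes "b \<in> V" "2 * k + 10 \<le> g" "slot b i v" "slot b j v"
  shows "i = j"
  using assms(3)
proof (cases rule: slot_cases)
  case i: 1
  have ig: "Suc i < g" using i(1) assms(2) by linarith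
  show ?thesis
    using assms(4)
  proof (cases rule: slot_cases)
    case 1
    show ?thesis
    proof (rule pow_inj)
      show "(\<sigma> ^^ 3) b \<in> V" using assms(1) by simp
      show "i < g" "j < g" using i(1) 1(1) assms(2) by linarith+
      show "(\<sigma> ^^ i) ((\<sigma> ^^ 3) b) = (\<sigma> ^^ j) ((\<sigma> ^^ 3) b)" by (rule trans[OF sym[OF i(2)] 1(2)])
    qed
  next
    case (2 u)
    have "Suc (j + 2) < g" using 2(1) assms(2) by linarith
    from N_lines_disjoint[OF 2(2) ig this] trans[OF sym[OF i(2)] 2(3)] show ?thesis by (rule notE)
  qed
next
  case i: (2 u)
  have ig: "Suc (i + 2) < g" "i + 2 + 2 < g" using i(1) assms(2) by linarith+
  show ?thesis
    using assms(4)
  proof (cases rule: slot_cases)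
    case 1
    have "Suc j < g" using 1(1) assms(2) by linarith
    from N_lines_disjoint[OF i(2) this ig(1)] trans[OF sym[OF 1(2)] i(3)] show ?thesis
        by (rule notE)
  next
    case (2 u')
    have jg: "j + 2 + 2 < g" using 2(1) assms(2) by linarith
    show ?thesis
    proof (cases "u = u'")
      case True
      have "(\<sigma> ^^ (i + 2)) u = (\<sigma> ^^ (j + 2)) u"
        using trans[OF sym[OF i(3)] 2(3)] unfolding True .
      then have "i + 2 = j + 2"
        using ig jg N_in[OF N_sym[OF i(2)]] by (intro pow_inj[of u]) linarith+
      then show ?thesis by simp
    next
      case False
      from neighbour_lines_disjoint[OF i(2) 2(2) False ig(2) jg] trans[OF sym[OF i(3)] 2(3)]
      show ?thesis by (rule notE)
    qed
  qed
qed

lemma slot_le: "slot b i v \<Longrightarrow> i \<le> 2 * k + 5" by (auto simp: slot_def)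

lemma slot_pred: "slot b (Suc i) v \<Longrightarrow> slot b i (p v)"
  by (auto simp: slot_def simp del: pow_p_Suc)

lemma slot_succ: "slot b i (p v) \<Longrightarrow> slot b (Suc i) v \<or> i = 2 \<or> i = 2 * k + 5"
proof -
  assume "slot b i (p v)"
  moreover have "v = (\<sigma> ^^ Suc i) w" if "p v = (\<sigma> ^^ i) w" for w
  proof -
    have "v = \<sigma> (p v)" by simp
    then show ?thesis unfolding that by simp
  qed
  ultimately show ?thesis unfolding slot_def by (metis Suc_leI le_neq_implies_less)
qed

lemma tagged_unique:
  assumes "B \<subseteq> V" "\<And>b b'. b \<in> B \<Longrightarrow> b' \<in> B \<Longrightarrow> b \<noteq> b' \<Longrightarrow> footprint b \<inter> footprint b' = {}"
    and "2 * k + 10 \<le> g" "tagged B i v" "tagged B j v"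
  shows "i = j"
proof -
  obtain b b' where b: "b \<in> B" "b' \<in> B" "slot b i v" "slot b' j v"
    using assms(4,5) unfolding tagged_def by blast
  then have "b = b'" using assms(2)[of b b'] by (auto simp: footprint_def)
  then show ?thesis using slot_unique[of b i v j] b assms(1,3) by blast
qed

end

text \<open>One fixed set of bases. Outside the footprints the tail probability \<tau> may be
  anything within \<epsilon> of \<open>t\<close>; this freedom pays for the prescribed values when
  several sets of bases are averaged.\<close>

locale reserved_lines = line_system V \<sigma> N k g adj
  for V :: "'v set" and \<sigma> N k g adj +
  fixes B :: "'v set" and \<tau> :: "'v \<Rightarrow> real" and m :: nat and \<epsilon> :: real
  assumes k2: "2 \<le> k"
    and B_sub: "B \<subseteq> V"
    and B_disjoint: "b \<in> B \<Longrightarrow> b' \<in> B \<Longrightarrow> b \<noteq> b' \<Longrightarrow> footprint b \<inter> footprint b' = {}"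
    and B_cover: "v \<in> V \<Longrightarrow> \<exists>b\<in>B. \<exists>i\<le>3 * m. v = (\<sigma> ^^ (i + 6)) b"
    and \<epsilon>: "\<epsilon> = 1 / (8 * (2 * real k + 1)\<^sup>2)"
    and \<tau>: "v \<in> V \<Longrightarrow> \<bar>\<tau> v - t\<bar> \<le> \<epsilon>"
    and g_large: "2 * k + 10 \<le> g"
      "2 * (((3 * m + 1) * ((3 * m + 1) * (2 * k - 2)) + 3 * m) + 1) < g"
begin

abbreviation "tag \<equiv> tagged B"
abbreviation "x \<equiv> marginal B \<tau>"
abbreviation "a v \<equiv> 1 - x (p v) - x v"

lemma tag_unique: "tag i v \<Longrightarrow> tag j v \<Longrightarrow> i = j"
  using tagged_unique[OF B_sub B_disjoint g_large(1)] .

lemma x_tag: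
  assumes "tag i v" shows "x v = profile i"
proof -
  have "(THE i. tag i v) = i" using assms tag_unique by (intro the_equality)
  then show ?thesis unfolding marginal_def using assms by metis
qed

lemma tag_pred: "tag (Suc i) v \<Longrightarrow> tag i (p v)"
  unfolding tagged_def using slot_pred by blast

lemma tag_le: "tag i v \<Longrightarrow> i \<le> 2 * k + 5"
  unfolding tagged_def using slot_le by blast

lemma tag_succ: "tag i (p v) \<Longrightarrow> tag (Suc i) v \<or> i = 2 \<or> i = 2 * k + 5"
  unfolding tagged_def using slot_succ by blast

lemma tag_neighbour:
  assumes "tag 3 z" "N z u" shows "tag 1 u"
proof -
  obtain b where b: "b \<in> B" "slot b 3 z" using assms(1) unfolding tagged_def by blast
  have z: "z = (\<sigma> ^^ 3) b" using b(2) unfolding slot_def by (elim disjE conjE) simp_all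
  have "N ((\<sigma> ^^ 3) b) u" using assms(2) unfolding z .
  then have "slot b 1 u" unfolding slot_def by (intro disjI2 conjI exI[of _ u]) simp_all
  then show ?thesis using b(1) unfolding tagged_def by blast
qed

lemma \<delta>_t: "2 * t + \<delta> = 1" "t = real k * \<delta>" "0 < \<delta>"
proof -
  have "2 * real k + 1 \<noteq> 0" by linarith
  then show "2 * t + \<delta> = 1"
    unfolding t_def \<delta>_def times_divide_eq_right add_divide_distrib[symmetric] by (rule divide_self)
  show "t = real k * \<delta>" unfolding t_def \<delta>_def by (metis mult.right_neutral times_divide_eq_right)
  show "0 < \<delta>" unfolding \<delta>_def by simp
qed

text \<open>For \<epsilon> replaced by 0 the last inequality is \<open>1 \<le> 3 * t\<close>, strict
  for \<open>k \<ge> 2\<close>; \<epsilon> is small enough to keep it. In terms of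
  \<open>n = 2 * k + 1\<close> it becomes a cubic inequality with leading term
  \<open>12 * n ^ 3\<close>, true from \<open>n = 5\<close> on.\<close>

lemma \<epsilon>_bounds: "0 < \<epsilon>" "2 * \<epsilon> \<le> \<delta>" "0 \<le> 1 - (2 * real k - 2) * (\<delta> + 2 * \<epsilon>)"
  "\<delta> + 2 * \<epsilon> \<le> (t - \<epsilon>) * (1 - (2 * real k - 2) * (\<delta> + 2 * \<epsilon>))"
proof -
  define n where "n = 2 * real k + 1"
  have n: "5 \<le> n" using k2 by (simp add: n_def)
  have \<epsilon>n: "\<epsilon> = 1 / (8 * n\<^sup>2)" and \<delta>n: "\<delta> = 1 / n" and kn: "2 * real k - 2 = n - 3"
    by (simp_all add: \<epsilon> \<delta>_def n_def)
  have kn2: "real k = (n - 1) / 2" by (simp add: n_def)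
  have "t = real k / n" by (simp add: t_def n_def)
  then have tn: "t = (n - 1) / (2 * n)" unfolding kn2 by simp
  show "0 < \<epsilon>" using n by (simp add: \<epsilon>n)
  have n2: "0 < n" "5 * n \<le> n * n" "5 * (n * n) \<le> n * (n * n)" using n by auto
  show "2 * \<epsilon> \<le> \<delta>" using n2 by (simp add: \<epsilon>n \<delta>n field_simps power2_eq_square)
  have e1: "\<delta> + 2 * \<epsilon> = (4 * n + 1) / (4 * n\<^sup>2)"
    using n2 by (simp add: \<epsilon>n \<delta>n field_simps power2_eq_square)
  have e2: "1 - (2 * real k - 2) * (\<delta> + 2 * \<epsilon>) = (11 * n + 3) / (4 * n\<^sup>2)"
    using n2 unfolding e1 kn by (simp add: field_simps power2_eq_square)
  have e3: "t - \<epsilon> = (4 * n * n - 4 * n - 1) / (8 * n\<^sup>2)"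
    using n2 by (simp add: \<epsilon>n tn field_simps power2_eq_square)
  show "0 \<le> 1 - (2 * real k - 2) * (\<delta> + 2 * \<epsilon>)" unfolding e2 using n by simp
  have "(4 * n + 1) * (8 * n\<^sup>2) \<le> (4 * n * n - 4 * n - 1) * (11 * n + 3)"
  proof -
    have "(4 * n * n - 4 * n - 1) * (11 * n + 3) - (4 * n + 1) * (8 * n\<^sup>2) =
        12 * (n * (n * n)) - 40 * (n * n) - 23 * n - 3"
      by (simp add: algebra_simps power2_eq_square)
    then show ?thesis using n n2 by linarith
  qed
  then have "(4 * n + 1) * (8 * n\<^sup>2) / (8 * n\<^sup>2 * (4 * n\<^sup>2)) \<le>
      (4 * n * n - 4 * n - 1) * (11 * n + 3) / (8 * n\<^sup>2 * (4 * n\<^sup>2))"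
    by (rule divide_right_mono) simp
  note scaled = this
  have "8 * n\<^sup>2 \<noteq> 0" using n2(1) by simp
  then have "\<delta> + 2 * \<epsilon> = (4 * n + 1) * (8 * n\<^sup>2) / (8 * n\<^sup>2 * (4 * n\<^sup>2))"
    unfolding e1 by (metis mult.commute mult_divide_mult_cancel_left)
  also note scaled
  also have "(4 * n * n - 4 * n - 1) * (11 * n + 3) / (8 * n\<^sup>2 * (4 * n\<^sup>2)) =
      (t - \<epsilon>) * (1 - (2 * real k - 2) * (\<delta> + 2 * \<epsilon>))"
    unfolding e2 e3 by (rule times_divide_times_eq[symmetric])
  finally show "\<delta> + 2 * \<epsilon> \<le> (t - \<epsilon>) * (1 - (2 * real k - 2) * (\<delta> + 2 * \<epsilon>))" .
qed

lemma plain: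
  assumes "v \<in> V" "\<nexists>i. tag (Suc i) v"
  shows "\<bar>x v - t\<bar> \<le> \<epsilon>" "tag i (p v) \<Longrightarrow> i = 2 \<or> i = 2 * k + 5"
proof -
  show "tag i (p v) \<Longrightarrow> i = 2 \<or> i = 2 * k + 5" using tag_succ assms(2) by blast
  show "\<bar>x v - t\<bar> \<le> \<epsilon>"
  proof (cases "\<exists>i. tag i v")
    case True
    then obtain i where i: "tag i v" by blast
    then have "i = 0" using assms(2) by (cases i) auto
    then have "x v = t" using x_tag[OF i] by (simp add: profile_def)
    then show ?thesis using \<epsilon>_bounds(1) by simp
  next
    case False
    then show ?thesis using \<tau>[OF assms(1)] by (simp add: marginal_def)
  qed
qed

lemma profile_last: "profile (2 * k + 5) = t" "profile (2 * k + 4) = 1 - t"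
  using \<delta>_t by (simp_all add: profile_def)

text \<open>Every stretch of slots ends with the values \<open>1 - t\<close>, \<open>t\<close>. A
  vertex just behind it therefore sees an ordinary predecessor and, two steps back, a value that is
  even larger than \<open>t\<close>.\<close>

lemma plain_pred:
  assumes "v \<in> V" "\<nexists>i. tag (Suc i) v"
  shows "\<bar>x (p v) - t\<bar> \<le> \<epsilon>" "t - \<epsilon> \<le> x (p (p v))"
proof -
  consider (none) "\<And>i. \<not> tag i (p v)" | (two) "tag 2 (p v)" | (last) "tag (2 * k + 5) (p v)"
    using plain(2)[OF assms] by blast
  then have "\<bar>x (p v) - t\<bar> \<le> \<epsilon> \<and> t - \<epsilon> \<le> x (p (p v))"
  proof cases
    case none
    have pv: "p v \<in> V" using assms(1) by simp
    have 1: "\<bar>x (p v) - t\<bar> \<le> \<epsilon>" using plain(1)[OF pv] none by blast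
    have "\<And>i. tag i (p (p v)) \<Longrightarrow> i = 2 \<or> i = 2 * k + 5" using plain(2)[OF pv] none by blast
    then consider "\<And>i. \<not> tag i (p (p v))" | "tag 2 (p (p v))" | "tag (2 * k + 5) (p (p v))" by blast
    then have "\<bar>x (p (p v)) - t\<bar> \<le> \<epsilon>"
    proof cases
      case 1
      then show ?thesis using plain(1)[of "p (p v)"] assms(1) by simp
    next
      case 2
      then show ?thesis using x_tag[OF 2] \<epsilon>_bounds(1) by (simp add: profile_def)
    next
      case 3
      then show ?thesis using x_tag[OF 3] \<epsilon>_bounds(1) by (simp add: profile_last)
    qed
    then show ?thesis using 1 by linarith
  next
    case two
    then have "tag 1 (p (p v))" using tag_pred[of 1 "p v"] by (simp add: numeral_2_eq_2)
    then have "x (p (p v)) = 1 - t" "x (p v) = t" using x_tag two by (simp_all add: profile_def)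
    then show ?thesis using \<epsilon>_bounds(1) \<delta>_t by linarith
  next
    case last
    then have "tag (Suc (2 * k + 4)) (p v)" by (simp add: add.commute)
    then have "tag (2 * k + 4) (p (p v))" by (rule tag_pred)
    then have "x (p (p v)) = 1 - t" "x (p v) = t" using x_tag last profile_last by metis+
    then show ?thesis using \<epsilon>_bounds(1) \<delta>_t by linarith
  qed
  then show "\<bar>x (p v) - t\<bar> \<le> \<epsilon>" "t - \<epsilon> \<le> x (p (p v))" by auto
qed

lemma tag_3: "tag 3 v \<Longrightarrow> tag 2 (p v)" "tag 3 v \<Longrightarrow> tag 1 (p (p v))"
  using tag_pred[of 2 v] tag_pred[of 1 "p v"] by (simp_all add: eval_nat_numeral)

lemma a_reserved: "tag 3 v \<Longrightarrow> a v = x (p (p v))"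
  using x_tag[of 3 v] x_tag[OF tag_3(1)] x_tag[OF tag_3(2)] by (simp add: profile_def)

lemma a_dead: "tag 1 v \<Longrightarrow> a v = 0"
  using tag_pred[of 0 v] x_tag[of 0 "p v"] x_tag[of 1 v] by (simp add: profile_def)

lemma a_restart:
  assumes "tag 6 v" shows "x (p v) = 0" "x (p (p v)) = 1"
proof -
  have "tag 5 (p v)" using tag_pred[of 5 v] assms by (simp add: eval_nat_numeral)
  moreover from this have "tag 4 (p (p v))" using tag_pred[of 4 "p v"]
      by (simp add: eval_nat_numeral)
  ultimately show "x (p v) = 0" "x (p (p v)) = 1" using x_tag by (simp_all add: profile_def)
qed

text \<open>Between ordinary values \<open>a v\<close> differs from \<delta> by at most
  \<open>2 * \<epsilon>\<close>, and \<open>2 * \<epsilon> \<le> \<delta>\<close>. Inside a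
  footprint it is \<delta> in the even slots from 6 on and 0 in the other positive slots except slot
  3.\<close>

lemma a_bounds:
  assumes "v \<in> V" "\<not> tag 3 v"
  shows "0 \<le> a v" "a v \<le> \<delta> + 2 * \<epsilon>" "a v = 0 \<or> t - \<epsilon> \<le> x (p (p v))"
proof -
  let ?P = "\<lambda>r. 0 \<le> r \<and> r \<le> \<delta> + 2 * \<epsilon> \<and> (r = 0 \<or> t - \<epsilon> \<le> x (p (p v)))"
  have zero: "?P r" if "r = 0" for r using that \<epsilon>_bounds(1) \<delta>_t(3) by simp
  consider (untagged) "\<nexists>i. tag (Suc i) v" | (tag) i where "tag (Suc i) v" by blast
  then have P: "?P (a v)"
  proof cases
    case untagged
    note * = plain(1)[OF assms(1) untagged] plain_pred[OF assms(1) untagged] \<epsilon>_bounds(1,2) \<delta>_t(1)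
    have "0 \<le> a v" using * by linarith
    moreover have "a v \<le> \<delta> + 2 * \<epsilon>" using * by linarith
    ultimately show ?thesis using *(3) by blast
  next
    case tag
    have xv: "x v = profile (Suc i)" "x (p v) = profile i" using x_tag tag tag_pred by blast+
    have il: "Suc i \<le> 2 * k + 5" using tag_le tag by blast
    consider "i = 0" | "i = 1" | "i = 2" | "i = 3" | j where "i = 2 * j + 4" | j
        where "i = 2 * j + 5"
    proof -
      assume *: "i = 0 \<Longrightarrow> thesis" "i = 1 \<Longrightarrow> thesis" "i = 2 \<Longrightarrow> thesis" "i = 3 \<Longrightarrow> thesis"
        "\<And>j. i = 2 * j + 4 \<Longrightarrow> thesis" "\<And>j. i = 2 * j + 5 \<Longrightarrow> thesis"
      have "i = 0 \<or> i = 1 \<or> i = 2 \<or> i = 3 \<or> i = 2 * ((i - 4) div 2) + 4 \<or> i = 2 * ((i - 5) div 2)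
          + 5"
        by presburger
      then show thesis using * by blast
    qed
    then show ?thesis
    proof cases
      case 1
      then have "a v = 0" by (simp add: xv profile_def)
      then show ?thesis by (rule zero)
    next
      case 2
      then have "a v = 0" by (simp add: xv profile_def)
      then show ?thesis by (rule zero)
    next
      case 4
      then have "a v = 0" by (simp add: xv profile_def)
      then show ?thesis by (rule zero)
    next
      case 3
      then show ?thesis using tag assms(2) by (simp add: numeral_3_eq_3)
    next
      case (5 j)
      have "a v = 0" using 5 by (simp add: xv profile_def)
      then show ?thesis by (rule zero)
    next
      case (6 j)
      then have jk: "j < k" using il by simp
      have "tag (Suc (2 * j + 4)) (p v)" using tag_pred[OF tag] 6 by (simp add: add.commute)
      then have "tag (2 * j + 4) (p (p v))" by (rule tag_pred)
      then have "x (p (p v)) = 1 - real j * \<delta>" using x_tag by (simp add: profile_def)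
      moreover have "real j * \<delta> \<le> real k * \<delta>" using jk \<delta>_t by (intro mult_right_mono) auto
      moreover have "a v = \<delta>" using 6 by (simp add: xv profile_def algebra_simps)
      moreover have "t - \<epsilon> \<le> 1 - real k * \<delta>" using \<epsilon>_bounds(1) \<delta>_t by linarith
      ultimately have "a v = \<delta>" "t - \<epsilon> \<le> x (p (p v))" by linarith+
      moreover have "?P r" if "r = \<delta>" "t - \<epsilon> \<le> x (p (p v))" for r
        using that \<epsilon>_bounds(1) \<delta>_t(3) by simp
      ultimately show ?thesis by blast
    qed
  qed
  show "0 \<le> a v" using P by (rule conjunct1)
  show "a v \<le> \<delta> + 2 * \<epsilon>" using P by (elim conjE)
  show "a v = 0 \<or> t - \<epsilon> \<le> x (p (p v))" using P by (elim conjE)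
qed

lemma a_nonneg:
  assumes "v \<in> V" shows "0 \<le> a v"
proof (cases "tag 3 v")
  case True
  have "x (p (p v)) = 1 - t" using x_tag[OF tag_3(2)[OF True]] by (simp add: profile_def)
  then show ?thesis using a_reserved[OF True] \<delta>_t(1,3) by linarith
next
  case False
  then show ?thesis by (rule a_bounds(1)[OF assms])
qed

text \<open>At a reserved vertex equality holds, since its neighbours are in slot 1 and never
  single. By the same token a vertex with a reserved neighbour has \<open>a v = 0\<close>. In all
  other cases the neighbours obey the generic bound and \<open>\<epsilon>_bounds\<close>
  concludes.\<close>

lemma a_le:
  assumes v: "v \<in> V"
  shows "a v = 0 \<or> a v \<le> x (p (p v)) * (1 - (\<Sum>u | N v u. a u))"
proof (cases "tag 3 v")
  case True
  then have "a u = 0" if "N v u" for u using that tag_neighbour a_dead by blast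
  then have "(\<Sum>u | N v u. a u) = 0" by (intro sum.neutral) simp
  then show ?thesis using a_reserved[OF True] by simp
next
  case False
  show ?thesis
  proof (cases "a v = 0")
    case nz: False
    have "a u \<le> \<delta> + 2 * \<epsilon>" if "N v u" for u
    proof -
      have "\<not> tag 3 u" using tag_neighbour[of u v] N_sym[OF that] a_dead[of v] nz by blast
      then show ?thesis using a_bounds(2)[of u] N_in N_sym that by blast
    qed
    then have "(\<Sum>u | N v u. a u) \<le> (\<Sum>u | N v u. \<delta> + 2 * \<epsilon>)" by (intro sum_mono) simp
    also have "\<dots> = real (card {u. N v u}) * (\<delta> + 2 * \<epsilon>)" by simp
    also have "\<dots> \<le> (2 * real k - 2) * (\<delta> + 2 * \<epsilon>)"
    proof (rule mult_right_mono)
      show "real (card {u. N v u}) \<le> 2 * real k - 2" using card_N[of v] k2 by linarith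
      show "0 \<le> \<delta> + 2 * \<epsilon>" using \<epsilon>_bounds \<delta>_t by linarith
    qed
    finally have "1 - (2 * real k - 2) * (\<delta> + 2 * \<epsilon>) \<le> 1 - (\<Sum>u | N v u. a u)" by simp
    moreover have "t - \<epsilon> \<le> x (p (p v))" using a_bounds(3)[OF v False] nz by blast
    moreover have "0 \<le> x (p (p v))"
    proof -
      have "\<epsilon> \<le> t"
      proof -
        have "\<delta> \<le> t" using \<delta>_t k2 by (simp add: mult_le_cancel_right1)
        then show ?thesis using \<epsilon>_bounds by linarith
      qed
      then show ?thesis using \<open>t - \<epsilon> \<le> x (p (p v))\<close> by linarith
    qed
    ultimately have "(t - \<epsilon>) * (1 - (2 * real k - 2) * (\<delta> + 2 * \<epsilon>)) \<le>
        x (p (p v)) * (1 - (\<Sum>u | N v u. a u))"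
      using \<epsilon>_bounds(3) by (intro mult_mono)
    then show ?thesis using a_bounds(2)[OF v False] \<epsilon>_bounds(4) by linarith
  qed simp
qed

section \<open>Segments between restarts and the order of revelation\<close>

definition Y :: "'v set" where "Y = {v. tag 6 v}"

definition lag :: "'v \<Rightarrow> nat" where "lag v = (LEAST i. (p ^^ i) v \<in> Y)"

definition start :: "'v \<Rightarrow> 'v" where "start v = (p ^^ lag v) v"

lemma start_lag:
  assumes "v \<in> V" shows "start v \<in> Y" "lag v \<le> 3 * m" "v = (\<sigma> ^^ lag v) (start v)"
proof -
  obtain b i where b: "b \<in> B" "i \<le> 3 * m" "v = (\<sigma> ^^ (i + 6)) b" using B_cover[OF assms] by blast
  have "v = (\<sigma> ^^ i) ((\<sigma> ^^ 6) b)" unfolding b(3) pow_add ..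
  then have "(p ^^ i) v = (\<sigma> ^^ 6) b" by (simp only: p_pow_pow)
  moreover have "slot b 6 ((\<sigma> ^^ 6) b)" using k2 by (simp add: slot_def)
  ultimately have i: "(p ^^ i) v \<in> Y" using b(1) unfolding Y_def tagged_def by auto
  show "start v \<in> Y" unfolding start_def lag_def by (rule LeastI[of "\<lambda>i. (p ^^ i) v \<in> Y", OF i])
  show "lag v \<le> 3 * m" using Least_le[of "\<lambda>i. (p ^^ i) v \<in> Y", OF i] b(2) by (simp add: lag_def)
  show "v = (\<sigma> ^^ lag v) (start v)" by (simp add: start_def)
qed

lemma lag_pred:
  assumes "v \<in> V" "v \<notin> Y" shows "lag v = Suc (lag (p v))" "start (p v) = start v"
proof -
  have "(p ^^ lag v) v \<in> Y" using start_lag(1)[OF assms(1)] by (simp add: start_def)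
  then have "(LEAST i. (p ^^ i) v \<in> Y) = Suc (LEAST i. (p ^^ Suc i) v \<in> Y)"
    by (rule Least_Suc) (simp add: assms(2))
  then show "lag v = Suc (lag (p v))"
    unfolding lag_def by (simp add: funpow_Suc_right del: funpow.simps)
  then show "start (p v) = start v"
    unfolding start_def by (simp add: funpow_Suc_right del: funpow.simps)
qed

lemma Y_sub: "Y \<subseteq> V"
  using B_sub by (auto simp: Y_def tagged_def slot_def)

text \<open>A segment has at most \<open>3 * m + 1\<close> vertices with at most
  \<open>2 * k - 2\<close> neighbours each. Hence the number of colours does not depend on the size
  of the graph, and neither will the range of the times built from them.\<close>

lemma segment_colouring:
  "\<exists>col :: 'v \<Rightarrow> nat. (\<forall>y\<in>Y. col y \<le> (3 * m + 1) * (2 * k - 2)) \<and>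
    (\<forall>u v. N u v \<longrightarrow> start u \<noteq> start v \<longrightarrow> col (start u) \<noteq> col (start v))"
proof -
  define r where "r = (\<lambda>y y'. \<exists>u w. N u w \<and> start u = y \<and> start w = y')"
  have finY: "finite Y" using Y_sub finite_V finite_subset by blast
  have deg: "card {y' \<in> Y. r y y' \<and> y' \<noteq> y} \<le> (3 * m + 1) * (2 * k - 2)" for y
  proof -
    have "{y' \<in> Y. r y y' \<and> y' \<noteq> y} \<subseteq> (\<Union>i\<in>{..3 * m}. start ` {w. N ((\<sigma> ^^ i) y) w})"
    proof
      fix y' assume "y' \<in> {y' \<in> Y. r y y' \<and> y' \<noteq> y}"
      then obtain u w where uw: "N u w" "start u = y" "start w = y'" by (auto simp: r_def)
      then have u: "u = (\<sigma> ^^ lag u) y" "lag u \<le> 3 * m" using start_lag(2,3)[of u] N_in by auto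
      then have "lag u \<in> {..3 * m}" "y' \<in> start ` {w. N ((\<sigma> ^^ lag u) y) w}"
        using uw(1,3) u(2) unfolding u(1)[symmetric] by auto
      then show "y' \<in> (\<Union>i\<in>{..3 * m}. start ` {w. N ((\<sigma> ^^ i) y) w})" by blast
    qed
    then have "card {y' \<in> Y. r y y' \<and> y' \<noteq> y} \<le> card (\<Union>i\<in>{..3 * m}. start ` {w. N ((\<sigma> ^^ i) y) w})"
      using finite_N by (intro card_mono) auto
    also have "\<dots> \<le> (\<Sum>i\<in>{..3 * m}. card (start ` {w. N ((\<sigma> ^^ i) y) w}))"
      by (rule card_UN_le) simp
    also have "\<dots> \<le> (\<Sum>i\<in>{..3 * m}. 2 * k - 2)"
      by (intro sum_mono order_trans[OF card_image_le[OF finite_N] card_N])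
    finally show ?thesis by simp
  qed
  have "\<exists>c :: 'v \<Rightarrow> nat. (\<forall>y\<in>Y. c y \<le> (3 * m + 1) * (2 * k - 2)) \<and>
      (\<forall>y\<in>Y. \<forall>y'\<in>Y. y \<noteq> y' \<and> r y y' \<longrightarrow> c y \<noteq> c y')"
    by (rule greedy_colouring[OF finY _ deg]) (auto simp: r_def dest: N_sym)
  then obtain c :: "'v \<Rightarrow> nat" where c: "\<forall>y\<in>Y. c y \<le> (3 * m + 1) * (2 * k - 2)"
    "\<forall>y\<in>Y. \<forall>y'\<in>Y. y \<noteq> y' \<and> r y y' \<longrightarrow> c y \<noteq> c y'" by blast
  have "c (start u) \<noteq> c (start v)" if "N u v" "start u \<noteq> start v" for u v
  proof -
    have "start u \<in> Y" "start v \<in> Y" using start_lag(1) N_in N_sym that(1) by blast+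
    moreover have "r (start u) (start v)" using that(1) by (auto simp: r_def)
    ultimately show ?thesis using c(2) that(2) by blast
  qed
  then show ?thesis using c(1) by blast
qed

theorem reserved_tiling:
  "\<exists>D. distribution D \<and>
     (\<forall>v\<in>V. expect D (\<lambda>s. of_bool (s v = Tail)) = x v \<and>
            expect D (\<lambda>s. of_bool (s v = Head)) = x (p v)) \<and>
     (\<forall>s\<in>supp D. (\<forall>v\<in>V. (s v = Head \<longleftrightarrow> s (p v) = Tail) \<and> (s (p v) = Single \<longrightarrow> s v = Tail)) \<and>
        (\<forall>u v. N u v \<longrightarrow> \<not> (s u = Single \<and> s v = Single)))"
proof -
  define M where "M = 3 * m + 1"
  obtain col :: "'v \<Rightarrow> nat" where col: "\<And>y. y \<in> Y \<Longrightarrow> col y \<le> M * (2 * k - 2)"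
    "\<And>u v. N u v \<Longrightarrow> start u \<noteq> start v \<Longrightarrow> col (start u) \<noteq> col (start v)"
    using segment_colouring unfolding M_def by blast
  \<comment> \<open>Segments are treated colour by colour, each from its start onwards. As
    \<open>M\<close> exceeds every lag, \<open>T\<close> determines colour and lag, so neighbours
    get different times.\<close>
  define T where "T = (\<lambda>v. M * col (start v) + lag v)"
  have lag_M: "lag v < M" if "v \<in> V" for v using start_lag(2)[OF that] by (simp add: M_def)
  define W where "W = M * (M * (2 * k - 2))"
  have gW: "2 * (W + 3 * m + 1) < g" using g_large(2) by (simp add: W_def M_def)
  have T_le: "T v \<le> W + 3 * m" if "v \<in> V" for v
    unfolding T_def W_def using col(1)[OF start_lag(1)[OF that]] start_lag(2)[OF that]
    by (intro add_mono mult_left_mono) auto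
  have T_N: "T u \<noteq> T v" if N: "N u v" for u v
  proof
    assume T: "T u = T v"
    have uv: "u \<in> V" "v \<in> V" using N N_in N_sym by blast+
    have "T w div M = col (start w)" "T w mod M = lag w" if "w \<in> V" for w
      using lag_M[OF that] by (simp_all add: T_def)
    then have "col (start u) = col (start v)" "lag u = lag v" using T uv by metis+
    then have "start u = start v" using col(2)[OF N] by blast
    then have "u = v" using start_lag(3)[OF uv(1)] start_lag(3)[OF uv(2)] \<open>lag u = lag v\<close> by metis
    then show False using N N_irrefl by blast
  qed
  define dep where "dep = (\<lambda>v u. (u = p v \<and> v \<notin> Y) \<or> (N v u \<and> T u < T v))"
  have T_p: "T (p v) < T v" if "v \<in> V" "v \<notin> Y" for v
    using lag_pred[OF that] by (simp add: T_def)
  have dep: "adj v u \<and> T u < T v" if "v \<in> V" "dep v u" for v u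
    using that T_p adj_N adj_\<sigma>[of "p v"] adj_sym[of "p v" v] by (auto simp: dep_def)
  have cones: "\<not> dep\<^sup>*\<^sup>* u w"
    if v: "v \<in> V" "v \<notin> Y" and u: "N v u" "T u < T v" and w: "dep\<^sup>*\<^sup>* (p v) w" for v u w
  proof
    assume uw: "dep\<^sup>*\<^sup>* u w"
    let ?R = "\<lambda>a b. adj a b \<and> a \<noteq> v \<and> b \<noteq> v"
    \<comment> \<open>Times decrease along dependencies: a chain from \<open>b\<close> has at most
      \<open>T b\<close> steps and, starting before time \<open>T v\<close>, avoids
      \<open>v\<close>. Chains from \<open>p v\<close> and from \<open>u\<close> to a common
      \<open>w\<close> would thus close up through \<open>v\<close> to a cycle shorter than
      \<open>g\<close>.\<close>
    have walk: "\<exists>n. n \<le> T b \<and> (?R ^^ n) b w" if "dep\<^sup>*\<^sup>* b w" "b \<in> V" "T b < T v" for b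
      using that
    proof (induction rule: converse_rtranclp_induct)
      case base
      then show ?case by (intro exI[of _ 0]) simp
    next
      case (step b b')
      have b': "adj b b'" "T b' < T b" using dep[OF step.prems(1) step.hyps(1)] by auto
      moreover have "b' \<in> V" using b'(1) by (simp add: adj_def)
      ultimately obtain n where n: "n \<le> T b'" "(?R ^^ n) b' w" using step.IH step.prems by auto
      have "?R b b'" using b' step.prems by auto
      then have "(?R ^^ Suc n) b w" using n(2) by (rule relpowp_Suc_I2)
      then show ?case using n(1) b'(2) by (intro exI[of _ "Suc n"]) simp
    qed
    have Tp: "T (p v) < T v" using T_p v by blast
    obtain n1 where n1: "n1 \<le> T (p v)" "(?R ^^ n1) (p v) w" using walk[OF w] v(1) Tp by auto
    obtain n2 where n2: "n2 \<le> T u" "(?R ^^ n2) u w" using walk[OF uw] u N_in N_sym by blast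
    have "(?R ^^ n2) w u" by (rule relpowp_sym[OF _ n2(2)]) (use adj_sym in blast)
    then have "(?R ^^ (n1 + n2)) (p v) u" using n1(2) unfolding relpowp_add by blast
    moreover have "p v \<noteq> u" using u(1) N_\<sigma>[of u] N_sym by auto
    moreover have "adj v (p v)" using adj_sym[OF adj_\<sigma>[of "p v"]] v(1) by simp
    moreover have "adj u v" using adj_N[OF N_sym[OF u(1)]] .
    ultimately have "g \<le> n1 + n2 + 2" by (rule detour_length)
    moreover have "n1 + n2 + 2 \<le> 2 * T v" using n1(1) n2(1) Tp u(2) by linarith
    ultimately have "g \<le> 2 * T v" by (rule le_trans)
    also have "2 * T v \<le> 2 * (W + 3 * m)" using T_le[OF v(1)] by simp
    finally show False using gW by simp
  qed
  interpret sequential_tiling V p N Y x T "\<lambda>v. 1 - x (p v) - x v"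
    "\<lambda>v u. (u = p v \<and> v \<notin> Y) \<or> (N v u \<and> T u < T v)"
  proof (unfold_locales, goal_cases)
    case (7 y)
    then show ?case using a_restart by (simp add: Y_def)
  next
    case (10 v u w)
    then show ?case using cones unfolding dep_def by blast
  qed (use finite_V N_in N_sym T_p T_N a_nonneg a_le in auto)
  show ?thesis by (rule random_tiling)
qed

end

text \<open>Here \<open>c\<close> bounds the sizes of the footprints, \<open>R\<close> is the number of sets of bases over which the
  tilings are averaged, \<open>m\<close> is the length of a window and the first summand bounds the length of a
  closed walk formed by two chains of dependencies.\<close>

definition tiling_girth :: "nat \<Rightarrow> nat" where
  "tiling_girth k = (let c = 8 * k; R = c + c * (8 * (2 * k + 1)\<^sup>2); m = 2 ^ (2 * (c * c) + 1) * R
     in 2 * (((3 * m + 1) * ((3 * m + 1) * (2 * k - 2)) + 3 * m) + 1) + 2 * k + 10)"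

section \<open>Averaging over sets of bases\<close>

context line_system
begin

lemma profile_range:
  assumes "i \<le> 2 * k + 5" shows "0 \<le> profile i" "profile i \<le> 1"
proof -
  have n: "0 < 2 * real k + 1" by linarith
  have t: "0 \<le> t" "t \<le> 1" unfolding t_def by simp_all
  have j: "0 \<le> real j * \<delta> \<and> real j * \<delta> \<le> 1" if "j \<le> k" for j
    using that unfolding \<delta>_def by simp
  have "(i - 4) div 2 \<le> k \<or> odd i" "(i - 5) div 2 \<le> k" using assms by presburger+
  then show "0 \<le> profile i" "profile i \<le> 1"
    using t j[of "(i - 4) div 2"] j[of "(i - 5) div 2"] unfolding profile_def by auto
qed

text \<open>Outside the footprints the probabilities \<open>\<tau> v\<close> are chosen so that the average over all sets of
  bases is exactly \<open>t\<close>.\<close>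

theorem uniform_tiling:
  assumes k: "2 \<le> k" and g: "tiling_girth k < g"
  shows "\<exists>D. distribution D \<and>
     (\<forall>v\<in>V. expect D (\<lambda>s. of_bool (s v = Tail)) = t \<and> expect D (\<lambda>s. of_bool (s v = Head)) = t) \<and>
     (\<forall>s\<in>supp D. (\<forall>v\<in>V. (s v = Head \<longleftrightarrow> s (p v) = Tail) \<and> (s (p v) = Single \<longrightarrow> s v = Tail)) \<and>
        (\<forall>u v. N u v \<longrightarrow> \<not> (s u = Single \<and> s v = Single)))"
proof -
  define c R m where "c = 8 * k" and "R = c + c * (8 * (2 * k + 1)\<^sup>2)"
    and "m = 2 ^ (2 * (c * c) + 1) * R"
  have gm: "2 * (((3 * m + 1) * ((3 * m + 1) * (2 * k - 2)) + 3 * m) + 1) + 2 * k + 10 < g"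
    using g unfolding tiling_girth_def Let_def c_def R_def m_def .
  have m_g: "m < g" by (rule le_less_trans[OF _ gm]) simp
  have g10: "2 * k + 10 \<le> g" by (rule less_imp_le, rule le_less_trans[OF _ gm]) simp
  have g_walk: "2 * (((3 * m + 1) * ((3 * m + 1) * (2 * k - 2)) + 3 * m) + 1) < g"
    by (rule le_less_trans[OF _ gm]) simp
  have c0: "0 < c" using k by (simp add: c_def)
  have cR: "c < R" using c0 by (simp add: R_def)
  have k0: "0 < k" using k by simp
  obtain B :: "nat \<Rightarrow> 'v set" where B: "\<And>\<rho>. \<rho> < R \<Longrightarrow> B \<rho> \<subseteq> V"
    "\<And>\<rho> b b'. \<rho> < R \<Longrightarrow> b \<in> B \<rho> \<Longrightarrow> b' \<in> B \<rho> \<Longrightarrow> b \<noteq> b' \<Longrightarrow> footprint b \<inter> footprint b' = {}"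
    "\<And>\<rho> v. \<rho> < R \<Longrightarrow> v \<in> V \<Longrightarrow> \<exists>b\<in>B \<rho>. \<exists>i\<le>3 * m. v = (\<sigma> ^^ (i + 6)) b"
    "\<And>\<rho> \<rho>'. \<rho> < R \<Longrightarrow> \<rho>' < R \<Longrightarrow> \<rho> \<noteq> \<rho>' \<Longrightarrow> B \<rho> \<inter> B \<rho>' = {}"
  proof -
    have "\<exists>B :: nat \<Rightarrow> 'v set. \<forall>\<rho><R. B \<rho> \<subseteq> V \<and>
      (\<forall>b\<in>B \<rho>. \<forall>b'\<in>B \<rho>. b \<noteq> b' \<longrightarrow> footprint b \<inter> footprint b' = {}) \<and>
      (\<forall>v\<in>V. \<exists>b\<in>B \<rho>. \<exists>i\<le>3 * m. v = (\<sigma> ^^ (i + 6)) b) \<and>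
      (\<forall>\<rho>'<R. \<rho> \<noteq> \<rho>' \<longrightarrow> B \<rho> \<inter> B \<rho>' = {})"
      by (rule bases_exist[OF finite_footprint _ _ finite_footprint_inverse m_def m_g])
        (simp_all only: c_def card_footprint[OF k0] card_footprint_inverse[OF k0])
    then obtain B :: "nat \<Rightarrow> 'v set" where B: "\<forall>\<rho><R. B \<rho> \<subseteq> V \<and>
      (\<forall>b\<in>B \<rho>. \<forall>b'\<in>B \<rho>. b \<noteq> b' \<longrightarrow> footprint b \<inter> footprint b' = {}) \<and>
      (\<forall>v\<in>V. \<exists>b\<in>B \<rho>. \<exists>i\<le>3 * m. v = (\<sigma> ^^ (i + 6)) b) \<and>
      (\<forall>\<rho>'<R. \<rho> \<noteq> \<rho>' \<longrightarrow> B \<rho> \<inter> B \<rho>' = {})" by (elim exE)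
    show thesis by (rule that[of B]) (use B in blast)+
  qed
  define sp where "sp = (\<lambda>v. {\<rho>. \<rho> < R \<and> (\<exists>i. tagged (B \<rho>) i v)})"
  have fin_sp: "finite (sp v)" for v unfolding sp_def by simp
  \<comment> \<open>The sets \<open>B \<rho>\<close> are disjoint, so different indices in
    \<open>sp v\<close> come with different bases whose footprints contain \<open>v\<close>.\<close>
  have card_sp: "card (sp v) \<le> c" for v
  proof -
    have "\<exists>b. b \<in> B \<rho> \<and> v \<in> footprint b" if "\<rho> \<in> sp v" for \<rho>
      using that unfolding sp_def tagged_def footprint_def by blast
    then obtain f where f: "\<And>\<rho>. \<rho> \<in> sp v \<Longrightarrow> f \<rho> \<in> B \<rho> \<and> v \<in> footprint (f \<rho>)" by metis
    have "inj_on f (sp v)"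
    proof (rule inj_onI)
      fix \<rho> \<rho>' assume *: "\<rho> \<in> sp v" "\<rho>' \<in> sp v" "f \<rho> = f \<rho>'"
      then have "f \<rho> \<in> B \<rho> \<inter> B \<rho>'" "\<rho> < R" "\<rho>' < R" using f[of \<rho>] f[of \<rho>'] by (auto simp: sp_def)
      then show "\<rho> = \<rho>'" using B(4) by blast
    qed
    moreover have "f ` sp v \<subseteq> {b. v \<in> footprint b}" using f by blast
    ultimately have "card (sp v) \<le> card {b. v \<in> footprint b}"
      using finite_footprint_inverse by (rule card_inj_on_le)
    then show ?thesis using card_footprint_inverse[OF k0, of v] by (simp add: c_def)
  qed
  define val where "val = (\<lambda>\<rho> v. profile (THE i. tagged (B \<rho>) i v))"
  have val: "\<bar>t - val \<rho> v\<bar> \<le> 1" if \<rho>: "\<rho> \<in> sp v" for \<rho> v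
  proof -
    obtain i where i: "\<rho> < R" "tagged (B \<rho>) i v" using \<rho> unfolding sp_def by blast
    have "(THE i. tagged (B \<rho>) i v) = i"
      using i(2) tagged_unique[OF B(1)[OF i(1)] B(2)[OF i(1)] g10] by (intro the_equality)
    moreover have "i \<le> 2 * k + 5" using i(2) slot_le unfolding tagged_def by blast
    moreover have "0 \<le> t" "t \<le> 1" unfolding t_def by simp_all
    ultimately show ?thesis using profile_range[of i] unfolding val_def by simp
  qed
  \<comment> \<open>In the \<open>R - card (sp v)\<close> summands where the value at
    \<open>v\<close> is not prescribed, this is the common value that brings the total to
    \<open>R * t\<close>.\<close>
  define \<tau> where "\<tau> = (\<lambda>v. (real R * t - (\<Sum>\<rho>\<in>sp v. val \<rho> v)) / (real R - real (card (sp v))))"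
  have pos: "0 < real R - real (card (sp v))" for v using card_sp[of v] cR by simp
  have marginal: "marginal (B \<rho>) \<tau> v = (if \<rho> \<in> sp v then val \<rho> v else \<tau> v)" if "\<rho> < R" for \<rho> v
    using that unfolding marginal_def val_def sp_def by simp
  have average: "(\<Sum>\<rho><R. marginal (B \<rho>) \<tau> v) = real R * t" for v
  proof -
    have sub: "sp v \<subseteq> {..<R}" unfolding sp_def by blast
    have "(\<Sum>\<rho><R. marginal (B \<rho>) \<tau> v) = (\<Sum>\<rho><R. if \<rho> \<in> sp v then val \<rho> v else \<tau> v)"
      by (intro sum.cong) (simp_all add: marginal)
    also have "\<dots> = (\<Sum>\<rho>\<in>sp v. val \<rho> v) + (\<Sum>\<rho>\<in>{..<R} - sp v. \<tau> v)"
      using sub by (subst sum.If_cases) (simp_all add: Int_absorb1 Diff_eq)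
    also have "(\<Sum>\<rho>\<in>{..<R} - sp v. \<tau> v) = (real R - real (card (sp v))) * \<tau> v"
      using sub fin_sp[of v] card_sp[of v] cR by (simp add: card_Diff_subset of_nat_diff)
    also have "\<dots> = real R * t - (\<Sum>\<rho>\<in>sp v. val \<rho> v)"
      unfolding \<tau>_def using pos[of v] by simp
    finally show ?thesis by simp
  qed
  define \<epsilon> where "\<epsilon> = 1 / (8 * (2 * real k + 1)\<^sup>2)"
  \<comment> \<open>At most \<open>c\<close> prescribed values, each off by at most 1, are balanced
    by at least \<open>R - c\<close> others. The definition of \<open>R\<close> makes
    \<open>c / (R - c)\<close> equal to \<epsilon>.\<close>
  have \<tau>: "\<bar>\<tau> v - t\<bar> \<le> \<epsilon>" for v
  proof -
    have "\<tau> v - t = (\<Sum>\<rho>\<in>sp v. t - val \<rho> v) / (real R - real (card (sp v)))"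
      unfolding \<tau>_def using pos[of v] by (simp add: sum_subtractf divide_simps) (simp add:
          algebra_simps)
    then have "\<bar>\<tau> v - t\<bar> = \<bar>\<Sum>\<rho>\<in>sp v. t - val \<rho> v\<bar> / (real R - real (card (sp v)))"
      using pos[of v] by simp
    also have "\<dots> \<le> real c / real (c * (8 * (2 * k + 1)\<^sup>2))"
    proof (rule frac_le)
      have "\<bar>\<Sum>\<rho>\<in>sp v. t - val \<rho> v\<bar> \<le> (\<Sum>\<rho>\<in>sp v. 1)"
        using val by (intro order_trans[OF sum_abs] sum_mono)
      then show "\<bar>\<Sum>\<rho>\<in>sp v. t - val \<rho> v\<bar> \<le> real c" using card_sp[of v] by simp
      show "0 < real (c * (8 * (2 * k + 1)\<^sup>2))" using c0 by simp
      have "real R = real c + real (c * (8 * (2 * k + 1)\<^sup>2))" by (simp only: R_def of_nat_add)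
      then show "real (c * (8 * (2 * k + 1)\<^sup>2)) \<le> real R - real (card (sp v))"
        using card_sp[of v] by linarith
    qed simp
    also have "\<dots> = \<epsilon>" using c0 by (simp add: \<epsilon>_def add.commute)
    finally show ?thesis .
  qed
  define valid :: "('v \<Rightarrow> cell) \<Rightarrow> bool" where
    "valid = (\<lambda>s. (\<forall>v\<in>V. (s v = Head \<longleftrightarrow> s (p v) = Tail) \<and> (s (p v) = Single \<longrightarrow> s v = Tail)) \<and>
      (\<forall>u v. N u v \<longrightarrow> \<not> (s u = Single \<and> s v = Single)))"
  define good where "good = (\<lambda>\<rho> D. distribution D \<and>
     (\<forall>v\<in>V. expect D (\<lambda>s. of_bool (s v = Tail)) = marginal (B \<rho>) \<tau> v \<and>
            expect D (\<lambda>s. of_bool (s v = Head)) = marginal (B \<rho>) \<tau> (p v)) \<and>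
     (\<forall>s\<in>supp D. valid s))"
  have "\<exists>D. good \<rho> D" if \<rho>: "\<rho> < R" for \<rho>
  proof -
    interpret r: reserved_lines V \<sigma> N k g adj "B \<rho>" \<tau> m \<epsilon>
      by unfold_locales (rule \<tau> | fact k B(1)[OF \<rho>] B(2)[OF \<rho>] B(3)[OF \<rho>] \<epsilon>_def g10 g_walk)+
    show ?thesis unfolding good_def valid_def by (rule r.reserved_tiling)
  qed
  then obtain D where "\<And>\<rho>. \<rho> < R \<Longrightarrow> good \<rho> (D \<rho>)" by metis
  then have D: "\<And>\<rho>. \<rho> < R \<Longrightarrow> distribution (D \<rho>)"
    "\<And>\<rho> v. \<rho> < R \<Longrightarrow> v \<in> V \<Longrightarrow> expect (D \<rho>) (\<lambda>s. of_bool (s v = Tail)) = marginal (B \<rho>) \<tau> v"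
    "\<And>\<rho> v. \<rho> < R \<Longrightarrow> v \<in> V \<Longrightarrow> expect (D \<rho>) (\<lambda>s. of_bool (s v = Head)) = marginal (B \<rho>) \<tau> (p v)"
    "\<And>\<rho> s. \<rho> < R \<Longrightarrow> s \<in> supp (D \<rho>) \<Longrightarrow> valid s"
    unfolding good_def by blast+
  have R0: "0 < R" using cR by simp
  obtain D' where D': "distribution D'" "\<And>g. expect D' g = (\<Sum>\<rho><R. expect (D \<rho>) g) / real R"
    "supp D' \<subseteq> (\<Union>\<rho><R. supp (D \<rho>))"
    using mixture_exists[of R D, OF R0 D(1)] by blast
  have "expect D' (\<lambda>s. of_bool (s v = Tail)) = t \<and> expect D' (\<lambda>s. of_bool (s v = Head)) = t"
    if "v \<in> V" for v
    using that R0 D(2,3) average[of v] average[of "p v"] unfolding D'(2) by simp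
  moreover have "valid s" if s: "s \<in> supp D'" for s
  proof -
    obtain \<rho> where "\<rho> < R" "s \<in> supp (D \<rho>)" using s D'(3) by blast
    then show ?thesis by (rule D(4))
  qed
  ultimately show ?thesis using D'(1) unfolding valid_def[symmetric] by blast
qed

end


lemma expect_map: "expect (map (\<lambda>(q, s). (q, f s)) D) g = expect D (\<lambda>s. g (f s))"
  by (induction D) auto

lemma supp_map: "supp (map (\<lambda>(q, s). (q, f s)) D) = f ` supp D"
  unfolding supp_def by force

lemma distribution_map: "distribution D \<Longrightarrow> distribution (map (\<lambda>(q, s). (q, f s)) D)"
  unfolding distribution_def expect_map by auto

section \<open>Fractional colourings of total graphs\<close>

lemma finite_independent_sets:
  assumes "simple_graph H" shows "finite (independent_sets H)"
  by (rule finite_subset[of _ "Pow (verts H)"])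
    (use assms in \<open>auto simp: simple_graph_def independent_sets_def\<close>)

text \<open>The weights are truncated at 1, as a fractional colouring requires; a truncated weight alone
  covers its set.\<close>

lemma fractional_chromatic_number_le:
  assumes H: "simple_graph H" and D: "distribution D" "supp D \<subseteq> independent_sets H" and r: "0 < r"
    and cover: "\<And>v. v \<in> verts H \<Longrightarrow> 1 \<le> r * expect D (\<lambda>I. of_bool (v \<in> I))"
  shows "fractional_chromatic_number H \<le> r"
proof -
  let ?S = "independent_sets H"
  have fin: "finite ?S" using finite_independent_sets[OF H] .
  define P where "P = (\<lambda>I. expect D (\<lambda>J. of_bool (J = I)))"
  have P0: "0 \<le> P I" for I unfolding P_def by (rule expect_nonneg[OF D(1)]) simp
  have total: "(\<Sum>I\<in>A. P I) = expect D (\<lambda>J. of_bool (J \<in> A))" if "A \<subseteq> ?S" for A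
  proof -
    have "finite A" using that fin finite_subset by blast
    have "(\<Sum>I\<in>A. P I) = expect D (\<lambda>J. \<Sum>I\<in>A. of_bool (J = I))"
      unfolding P_def by (rule expect_sum[symmetric])
    also have "\<dots> = expect D (\<lambda>J. of_bool (J \<in> A))"
      using \<open>finite A\<close> by (intro expect_cong) (simp add: sum.delta of_bool_def)
    finally show ?thesis .
  qed
  define w where "w = (\<lambda>I. min 1 (r * P I))"
  have w: "0 \<le> w I" "w I \<le> 1" "w I \<le> r * P I" for I using P0 r by (simp_all add: w_def)
  have "fractional_colouring H w"
    unfolding fractional_colouring_def
  proof (intro conjI ballI)
    fix v assume v: "v \<in> verts H"
    let ?A = "{I \<in> ?S. v \<in> I}"
    have finA: "finite ?A" using fin by simp
    show "1 \<le> (\<Sum>I\<in>?A. w I)"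
    proof (cases "\<exists>I\<in>?A. 1 \<le> r * P I")
      case True
      then obtain I where I: "I \<in> ?A" "1 \<le> r * P I" by blast
      then have "1 = w I" by (simp add: w_def)
      also have "\<dots> \<le> (\<Sum>I\<in>?A. w I)" using I finA w by (intro member_le_sum) auto
      finally show ?thesis .
    next
      case False
      then have "(\<Sum>I\<in>?A. w I) = (\<Sum>I\<in>?A. r * P I)"
        by (intro sum.cong refl) (force simp: w_def not_le)
      also have "\<dots> = r * expect D (\<lambda>J. of_bool (J \<in> ?A))"
        by (simp add: sum_distrib_left[symmetric] total)
      also have "expect D (\<lambda>J. of_bool (J \<in> ?A)) = expect D (\<lambda>J. of_bool (v \<in> J))"
        using D(2) by (intro expect_cong) auto
      finally show ?thesis using cover[OF v] by simp
    qed
  qed (use w in auto)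
  moreover have "colouring_size H w \<le> r"
  proof -
    have "colouring_size H w \<le> (\<Sum>I\<in>?S. r * P I)"
      unfolding colouring_size_def using w by (intro sum_mono)
    also have "\<dots> = r * expect D (\<lambda>J. of_bool (J \<in> ?S))"
      by (simp add: sum_distrib_left[symmetric] total)
    also have "expect D (\<lambda>J. of_bool (J \<in> ?S)) = expect D (\<lambda>_. 1)"
      using D(2) by (intro expect_cong) auto
    finally show ?thesis using D(1) by (simp add: distribution_def)
  qed
  moreover have "bdd_below {colouring_size H w | w. fractional_colouring H w}"
    by (rule bdd_belowI[of _ 0]) (auto dest: colouring_size_nonneg)
  ultimately show ?thesis
    unfolding fractional_chromatic_number_def by (intro cInf_lower2[of "colouring_size H w"]) auto
qed

text \<open>Double counting: an independent set contains at most one vertex of the clique.\<close>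

lemma clique_le_fractional_chromatic_number:
  assumes H: "simple_graph H" and Q: "Q \<subseteq> verts H"
    and clique: "\<And>u v. u \<in> Q \<Longrightarrow> v \<in> Q \<Longrightarrow> u \<noteq> v \<Longrightarrow> adjacent H u v"
  shows "real (card Q) \<le> fractional_chromatic_number H"
proof -
  let ?S = "independent_sets H"
  have fin: "finite ?S" using finite_independent_sets[OF H] .
  have finQ: "finite Q" using Q H finite_subset by (auto simp: simple_graph_def)
  have "real (card Q) \<le> colouring_size H w" if w: "fractional_colouring H w" for w
  proof -
    have "real (card Q) = (\<Sum>v\<in>Q. 1)" by simp
    also have "\<dots> \<le> (\<Sum>v\<in>Q. \<Sum>I | I \<in> ?S \<and> v \<in> I. w I)"
      using w Q by (intro sum_mono) (auto simp: fractional_colouring_def)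
    also have "\<dots> = (\<Sum>I\<in>?S. \<Sum>v | v \<in> Q \<and> v \<in> I. w I)"
      by (rule sum.swap_restrict[OF finQ fin])
    also have "\<dots> \<le> (\<Sum>I\<in>?S. w I)"
    proof (rule sum_mono)
      fix I assume I: "I \<in> ?S"
      then have w0: "0 \<le> w I" using w by (simp add: fractional_colouring_def)
      have "card {v \<in> Q. v \<in> I} \<le> 1"
      proof (rule ccontr)
        assume "\<not> card {v \<in> Q. v \<in> I} \<le> 1"
        then obtain u v where "u \<in> Q" "u \<in> I" "v \<in> Q" "v \<in> I" "u \<noteq> v"
          using finQ by (auto simp: card_le_Suc0_iff_eq)
        then show False using I clique[of u v] by (auto simp: independent_sets_def)
      qed
      then have "real (card {v \<in> Q. v \<in> I}) * w I \<le> 1 * w I"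
        using w0 by (intro mult_right_mono) simp_all
      then show "(\<Sum>v | v \<in> Q \<and> v \<in> I. w I) \<le> w I" by simp
    qed
    finally show ?thesis by (simp add: colouring_size_def)
  qed
  then show ?thesis
    unfolding fractional_chromatic_number_def
    using fractional_colouring_exists[OF H] by (intro cInf_greatest) auto
qed

lemma edge_cases:
  assumes "simple_graph G" "e \<in> edges G"
  obtains u v where "e = {u, v}" "u \<noteq> v" "u \<in> verts G" "v \<in> verts G"
  using assms unfolding simple_graph_def by blast

lemma finite_edges: "simple_graph G \<Longrightarrow> finite (edges G)"
  by (rule finite_subset[of _ "Pow (verts G)"]) (auto elim: edge_cases simp: simple_graph_def)

lemma adjacent_total_graph [simp]:
  "adjacent (total_graph G) (Inl u) (Inl v) \<longleftrightarrow> adjacent G u v"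
  "adjacent (total_graph G) (Inl v) (Inr e) \<longleftrightarrow> e \<in> edges G \<and> v \<in> e"
  "adjacent (total_graph G) (Inr e) (Inl v) \<longleftrightarrow> e \<in> edges G \<and> v \<in> e"
  "adjacent (total_graph G) (Inr e) (Inr f) \<longleftrightarrow> e \<in> edges G \<and> f \<in> edges G \<and> e \<noteq> f \<and> e \<inter> f \<noteq> {}"
  unfolding adjacent_def total_graph_def by (auto simp: doubleton_eq_iff insert_commute)

text \<open>A vertex of maximum degree and its incident edges form a clique of the total
  graph.\<close>

lemma Suc_max_degree_le:
  assumes G: "simple_graph G"
  shows "real (max_degree G) + 1 \<le> fractional_total_chromatic_number G"
proof -
  have "Max (degree G ` verts G) \<in> degree G ` verts G"
    using G by (intro Max_in) (auto simp: simple_graph_def)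
  then obtain v where v: "v \<in> verts G" "degree G v = max_degree G" by (auto simp: max_degree_def)
  define Q where "Q = insert (Inl v) (Inr ` {e \<in> edges G. v \<in> e})"
  have "card Q = max_degree G + 1"
    using finite_edges[OF G] v(2) by (simp add: Q_def card_image degree_def card_insert_if
        image_iff)
  moreover have "real (card Q) \<le> fractional_chromatic_number (total_graph G)"
  proof (rule clique_le_fractional_chromatic_number[OF simple_graph_total_graph[OF G]])
    show "Q \<subseteq> verts (total_graph G)" using v by (auto simp: Q_def total_graph_def)
    fix x y assume "x \<in> Q" "y \<in> Q" "x \<noteq> y"
    then show "adjacent (total_graph G) x y"
      unfolding Q_def by auto
  qed
  ultimately show ?thesis by (simp add: fractional_total_chromatic_number_def)
qed

section \<open>From a colour class to a line system\<close>

lemma cyclic_walk_neighbours: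
  assumes c: "cyclic_walk adj c" and x: "x \<in> set c"
  shows "\<exists>y\<in>set c. \<exists>z\<in>set c. y \<noteq> z \<and> adj x y \<and> adj z x"
proof -
  define n where "n = length c"
  have n: "3 \<le> n" "distinct c" "\<And>i. i < n \<Longrightarrow> adj (c ! i) (c ! (Suc i mod n))"
    using c by (auto simp: cyclic_walk_def n_def)
  obtain i where i: "i < n" "x = c ! i" using x by (auto simp: in_set_conv_nth n_def)
  define j where "j = (if i = 0 then n - 1 else i - 1)"
  have j: "j < n" "Suc j mod n = i" using i n(1) by (auto simp: j_def)
  have "Suc i mod n \<noteq> j" using i n(1) by (cases "Suc i = n") (auto simp: j_def)
  moreover have "Suc i mod n < n" using n(1) by simp
  ultimately have "c ! (Suc i mod n) \<noteq> c ! j"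
    using n(2) j(1) by (simp add: nth_eq_iff_index_eq n_def)
  moreover have "adj x (c ! (Suc i mod n))" "adj (c ! j) x"
    using n(3)[OF i(1)] n(3)[OF j(1)] i(2) j(2) by auto
  ultimately show ?thesis using j(1) \<open>Suc i mod n < n\<close> by (metis n_def nth_mem)
qed

text \<open>The lines of one colour class are closed up to long cycles: every end of a path is linked to
  the start of a path by \<open>g\<close> new vertices \<open>(v, 1), \<dots>, (v, g)\<close>.\<close>

locale path_factor =
  fixes G :: "'a ugraph" and tl hd :: "'a set \<Rightarrow> 'a" and col :: "'a set \<Rightarrow> nat" and i k g :: nat
  assumes G: "simple_graph G"
    and ends_of: "e \<in> edges G \<Longrightarrow> e = {tl e, hd e} \<and> tl e \<noteq> hd e \<and> col e < k"
    and proper: "e \<in> edges G \<Longrightarrow> f \<in> edges G \<Longrightarrow> e \<noteq> f \<Longrightarrow> col e = col f \<Longrightarrow>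
      tl e \<noteq> tl f \<and> hd e \<noteq> hd f"
    and i: "i < k"
    and girth: "is_cycle G c \<Longrightarrow> g \<le> length c"
    and g: "3 \<le> g"
begin

definition F :: "'a set set" where "F = {e \<in> edges G. col e = i}"

definition ends :: "'a set" where "ends = verts G - tl ` F"

definition starts :: "'a set" where "starts = verts G - hd ` F"

definition link :: "'a \<Rightarrow> 'a" where "link = (SOME f. bij_betw f ends starts)"

definition out :: "'a \<Rightarrow> 'a set" where "out v = (THE e. e \<in> F \<and> tl e = v)"

definition V :: "('a \<times> nat) set" where
  "V = {(v, j). v \<in> verts G \<and> (j = 0 \<or> v \<in> ends \<and> j \<le> g)}"

definition \<sigma> :: "'a \<times> nat \<Rightarrow> 'a \<times> nat" where
  "\<sigma> x = (if x \<in> V then (case x of (v, j) \<Rightarrow>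
     if v \<notin> ends then (hd (out v), 0) else if j < g then (v, Suc j) else (link v, 0)) else x)"

definition N :: "'a \<times> nat \<Rightarrow> 'a \<times> nat \<Rightarrow> bool" where
  "N x y \<longleftrightarrow> snd x = 0 \<and> snd y = 0 \<and> {fst x, fst y} \<in> edges G \<and> col {fst x, fst y} \<noteq> i"

abbreviation adj :: "'a \<times> nat \<Rightarrow> 'a \<times> nat \<Rightarrow> bool" where
  "adj u v \<equiv> u \<in> V \<and> v \<in> V \<and> (\<sigma> u = v \<or> \<sigma> v = u \<or> N u v)"

lemma finite_verts: "finite (verts G)" using G by (simp add: simple_graph_def)

lemma edge_verts:
  assumes "e \<in> edges G" shows "e \<subseteq> verts G"
  by (rule edge_cases[OF G assms]) simp

lemma edge_ends:
  assumes "e \<in> edges G"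
  shows "{tl e, hd e} = e" "tl e \<in> e" "hd e \<in> e" "tl e \<noteq> hd e" "col e < k"
proof -
  show eq: "{tl e, hd e} = e" and "tl e \<noteq> hd e" "col e < k" using ends_of[OF assms] by metis+
  show "tl e \<in> e" "hd e \<in> e" using eq by blast+
qed

lemma edge_end: "e \<in> edges G \<Longrightarrow> v \<in> e \<Longrightarrow> v = tl e \<or> v = hd e"
  using edge_ends(1)[of e] by blast

lemma F_edge: "e \<in> F \<Longrightarrow> e \<in> edges G" and F_col: "e \<in> F \<Longrightarrow> col e = i"
  by (simp_all add: F_def)

lemma tl_hd_in: "e \<in> F \<Longrightarrow> tl e \<in> verts G \<and> hd e \<in> verts G"
  using edge_ends(2,3)[OF F_edge] edge_verts[OF F_edge] by blast

lemma inj_tl: "inj_on tl F" and inj_hd: "inj_on hd F"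
  using proper F_edge F_col unfolding inj_on_def by metis+

text \<open>Both sets have \<open>card (verts G) - card F\<close> elements because \<open>tl\<close>
  and \<open>hd\<close> are injective on \<open>F\<close>. The bijection may be arbitrary, even send
  a vertex to itself: the chain of \<open>g\<close> new vertices keeps every closed line
  long.\<close>

lemma link: "bij_betw link ends starts"
proof -
  have F: "finite F" using finite_edges[OF G] by (simp add: F_def)
  have sub: "tl ` F \<subseteq> verts G" "hd ` F \<subseteq> verts G" using tl_hd_in by auto
  have "card ends = card (verts G) - card F"
    unfolding ends_def using F sub by (simp add: card_Diff_subset card_image inj_tl)
  also have "\<dots> = card starts"
    unfolding starts_def using F sub by (simp add: card_Diff_subset card_image inj_hd)
  finally have "\<exists>f. bij_betw f ends starts"
    using finite_verts by (intro finite_same_card_bij) (auto simp: ends_def starts_def)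
  then show ?thesis unfolding link_def by (rule someI_ex)
qed

lemma link_in: "v \<in> ends \<Longrightarrow> link v \<in> verts G" "v \<in> ends \<Longrightarrow> link v \<notin> hd ` F"
  using bij_betwE[OF link] by (auto simp: starts_def)

lemma out_tl: "e \<in> F \<Longrightarrow> out (tl e) = e"
  unfolding out_def using inj_tl by (auto intro!: the_equality dest: inj_onD)

lemma out: assumes "v \<in> verts G" "v \<notin> ends" shows "out v \<in> F" "tl (out v) = v"
  using assms out_tl by (auto simp: ends_def)

lemma V_0 [simp]: "(v, 0) \<in> V \<longleftrightarrow> v \<in> verts G" by (simp add: V_def)

lemma V_Suc [simp]: "(v, Suc j) \<in> V \<longleftrightarrow> v \<in> ends \<and> Suc j \<le> g"
  by (auto simp: V_def ends_def)

lemma V_not_end: "(v, j) \<in> V \<Longrightarrow> v \<notin> ends \<Longrightarrow> j = 0 \<and> v \<in> verts G" by (auto simp: V_def)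

lemma V_end: "v \<in> ends \<Longrightarrow> (v, j) \<in> V \<longleftrightarrow> j \<le> g" by (auto simp: V_def ends_def)

lemma \<sigma>_not_end: "v \<in> verts G \<Longrightarrow> v \<notin> ends \<Longrightarrow> \<sigma> (v, 0) = (hd (out v), 0)"
  by (simp add: \<sigma>_def)

lemma \<sigma>_tl: "e \<in> F \<Longrightarrow> \<sigma> (tl e, 0) = (hd e, 0)"
  using \<sigma>_not_end[of "tl e"] tl_hd_in[of e] out_tl[of e] by (auto simp: ends_def)

lemma \<sigma>_end: "v \<in> ends \<Longrightarrow> j < g \<Longrightarrow> \<sigma> (v, j) = (v, Suc j)"
  "v \<in> ends \<Longrightarrow> \<sigma> (v, g) = (link v, 0)"
  by (simp_all add: \<sigma>_def V_end)

lemma \<sigma>_cases: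
  assumes "x \<in> V"
  obtains (edge) e where "e \<in> F" "x = (tl e, 0)" "\<sigma> x = (hd e, 0)"
    | (chain) v j where "v \<in> ends" "j < g" "x = (v, j)" "\<sigma> x = (v, Suc j)"
    | (last) v where "v \<in> ends" "x = (v, g)" "\<sigma> x = (link v, 0)"
proof -
  obtain v j where x: "x = (v, j)" by fastforce
  consider "v \<notin> ends" | "v \<in> ends" "j < g" | "v \<in> ends" "j = g"
    using assms V_end[of v j] x by fastforce
  then show thesis
  proof cases
    case 1
    then have "j = 0" "v \<in> verts G" using V_not_end assms x by blast+
    then show thesis using out[of v] 1 edge[of "out v"] \<sigma>_not_end x by simp
  next
    case 2
    then show thesis using chain[of v j] \<sigma>_end x by simp
  next
    case 3
    then show thesis using last[of v] \<sigma>_end x by simp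
  qed
qed

lemma \<sigma>_in: "x \<in> V \<Longrightarrow> \<sigma> x \<in> V"
  by (erule \<sigma>_cases) (use tl_hd_in link_in in \<open>auto simp del: split_paired_All\<close>)

lemma inj_\<sigma>: "inj_on \<sigma> V"
proof (rule inj_onI)
  fix x y assume xy: "x \<in> V" "y \<in> V" "\<sigma> x = \<sigma> y"
  have link_inj: "link v = link w \<longleftrightarrow> v = w" if "v \<in> ends" "w \<in> ends" for v w
    using bij_betw_imp_inj_on[OF link] that by (auto dest: inj_onD)
  show "x = y"
    using xy(1)
  proof (cases rule: \<sigma>_cases)
    case x: (edge e)
    show ?thesis
      using xy(2)
      by (cases rule: \<sigma>_cases)
        (use x xy(3) link_in(2) imageI[OF x(1), of hd] inj_onD[OF inj_hd, of e] in auto)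
  next
    case x: (chain v j)
    show ?thesis
      using xy(2) by (cases rule: \<sigma>_cases) (use x xy(3) in auto)
  next
    case x: (last v)
    show ?thesis
      using xy(2)
    proof (cases rule: \<sigma>_cases)
      case (edge e)
      then have "hd e = link v" using x xy(3) by simp
      then show ?thesis using imageI[OF edge(1), of hd] link_in(2)[OF x(1)] by simp
    qed (use x xy(3) link_inj[of v] in auto)
  qed
qed

lemma finite_V: "finite V"
  by (rule finite_subset[of _ "verts G \<times> {..g}"]) (use finite_verts in \<open>auto simp: V_def\<close>)

lemma \<sigma>_permutes: "\<sigma> permutes V"
proof (rule bij_imp_permutes)
  have "\<sigma> ` V = V" using \<sigma>_in inj_\<sigma> finite_V by (intro endo_inj_surj) auto
  then show "bij_betw \<sigma> V V" using inj_\<sigma> by (simp add: bij_betw_def)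
qed (simp add: \<sigma>_def)

lemma edge_F_eq: "e \<in> F \<Longrightarrow> {tl e, hd e} = e" and tl_neq_hd: "e \<in> F \<Longrightarrow> tl e \<noteq> hd e"
  using edge_ends(1,4)[OF F_edge] by blast+

lemma no_fixed: assumes "x \<in> V" shows "\<sigma> x \<noteq> x"
  using assms
proof (cases rule: \<sigma>_cases)
  case (edge e)
  then show ?thesis using tl_neq_hd[of e] by auto
qed (use g in auto)

lemma no_2_cycle: assumes x: "x \<in> V" shows "\<sigma> (\<sigma> x) \<noteq> x"
  using x
proof (cases rule: \<sigma>_cases)
  case x: (edge e)
  show ?thesis
    using \<sigma>_in[OF assms]
  proof (cases rule: \<sigma>_cases)
    case (edge f)
    have "f \<noteq> e" using edge x tl_neq_hd[of e] by auto
    moreover have "f = e" if "hd f = tl e"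
    proof -
      have "tl f = hd e" using edge(2) x(3) by simp
      then have "{tl f, hd f} = {tl e, hd e}" using that by (simp add: insert_commute)
      then show ?thesis unfolding edge_F_eq[OF edge(1)] edge_F_eq[OF x(1)] .
    qed
    ultimately show ?thesis using edge x by auto
  qed (use x g in auto)
next
  case x: (chain v j)
  show ?thesis using \<sigma>_in[OF assms] by (cases rule: \<sigma>_cases) (use x g in auto)
next
  case x: (last v)
  show ?thesis using \<sigma>_in[OF assms] by (cases rule: \<sigma>_cases) (use x g in auto)
qed

lemma N_fst: "N x y \<Longrightarrow> fst x \<in> verts G \<and> fst y \<in> verts G \<and> fst x \<noteq> fst y"
  unfolding N_def using edge_ends(2-4)[of "{fst x, fst y}"] edge_verts[of "{fst x, fst y}"] by auto

lemma N_in: "N x y \<Longrightarrow> x \<in> V"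
  using N_fst[of x y] by (cases x) (auto simp: N_def)

lemma N_irrefl: "\<not> N x x" using N_fst by blast

lemma N_sym: "N x y \<Longrightarrow> N y x" by (simp add: N_def insert_commute)

lemma N_\<sigma>: "\<not> N x (\<sigma> x)"
proof
  assume N: "N x (\<sigma> x)"
  from N_in[OF N] show False
  proof (cases rule: \<sigma>_cases)
    case (edge e)
    then show False using N edge_F_eq[of e] by (simp add: N_def F_def)
  qed (use N g in \<open>auto simp: N_def\<close>)
qed

text \<open>Each of the \<open>k - 1\<close> other colours occurs on at most one edge leaving the
  vertex and at most one entering it.\<close>

lemma card_N: "card {y. N x y} \<le> 2 * k - 2"
proof -
  define E' where "E' = {e \<in> edges G. col e \<noteq> i}"
  have bound: "card {e \<in> E'. p e = fst x} \<le> k - 1"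
    if "\<And>e f. e \<in> edges G \<Longrightarrow> f \<in> edges G \<Longrightarrow> e \<noteq> f \<Longrightarrow> col e = col f \<Longrightarrow> p e \<noteq> p f" for p
  proof -
    have "card {e \<in> E'. p e = fst x} \<le> card ({..<k} - {i})"
    proof (rule card_inj_on_le)
      show "inj_on col {e \<in> E'. p e = fst x}"
      proof (rule inj_onI, rule ccontr)
        fix e f assume ef: "e \<in> {e \<in> E'. p e = fst x}" "f \<in> {e \<in> E'. p e = fst x}" "col e = col f"
            "e \<noteq> f"
        then show False using that[of e f] by (simp add: E'_def)
      qed
      show "col ` {e \<in> E'. p e = fst x} \<subseteq> {..<k} - {i}" using edge_ends(5) by (auto simp: E'_def)
    qed simp
    then show ?thesis using i by simp
  qed
  have fin: "finite E'" using finite_edges[OF G] by (simp add: E'_def)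
  have "card {y. N x y} \<le> card ({e \<in> E'. tl e = fst x} \<union> {e \<in> E'. hd e = fst x})"
  proof (rule card_inj_on_le)
    show "inj_on (\<lambda>y. {fst x, fst y}) {y. N x y}"
      by (rule inj_onI) (auto simp: N_def doubleton_eq_iff prod_eq_iff)
    show "(\<lambda>y. {fst x, fst y}) ` {y. N x y} \<subseteq> {e \<in> E'. tl e = fst x} \<union> {e \<in> E'. hd e = fst x}"
    proof clarify
      fix a b assume N: "N x (a, b)" and "\<not> (({fst x, fst (a, b)} \<in> E' \<and> hd {fst x, fst (a, b)} =
          fst x))"
      moreover have e: "{fst x, a} \<in> E'" using N by (simp add: N_def E'_def)
      moreover have "fst x \<in> {tl {fst x, a}, hd {fst x, a}}"
        using edge_end[of "{fst x, a}" "fst x"] e unfolding E'_def by blast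
      ultimately show "{fst x, fst (a, b)} \<in> E' \<and> tl {fst x, fst (a, b)} = fst x" by auto
    qed
  qed (use fin in simp)
  also have "\<dots> \<le> card {e \<in> E'. tl e = fst x} + card {e \<in> E'. hd e = fst x}" by (rule card_Un_le)
  also have "\<dots> \<le> (k - 1) + (k - 1)" using bound[of tl] bound[of hd] proper by (intro add_mono) auto
  finally show ?thesis by simp
qed

text \<open>A new vertex has just two neighbours, its predecessor and its successor. A cycle through
  one of them therefore runs through the whole chain and has at least \<open>g\<close> vertices; any
  other cycle is a cycle of \<open>G\<close>.\<close>

lemma cyclic_walk_length:
  assumes c: "cyclic_walk adj c" shows "g \<le> length c"
proof (cases "\<exists>x\<in>set c. snd x \<noteq> 0")
  case True
  then obtain v j where vj: "(v, Suc j) \<in> set c" by (metis not0_implies_Suc prod.collapse)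
  have step: "\<sigma> (v, Suc l) \<in> set c \<and> (v, l) \<in> set c" if l: "(v, Suc l) \<in> set c" for l
  proof -
    obtain y z where yz: "y \<in> set c" "z \<in> set c" "y \<noteq> z" "adj (v, Suc l) y" "adj z (v, Suc l)"
      using cyclic_walk_neighbours[OF c l] by blast
    have "v \<in> ends" "Suc l \<le> g" using yz(4) by auto
    then have \<sigma>: "\<sigma> (v, l) = (v, Suc l)" "(v, l) \<in> V" by (auto intro: \<sigma>_end simp: V_end)
    have "y = \<sigma> (v, Suc l) \<or> y = (v, l)" "z = \<sigma> (v, Suc l) \<or> z = (v, l)"
    proof -
      have "w = (v, l)" if "w \<in> V" "\<sigma> w = (v, Suc l)" for w
        by (rule inj_onD[OF inj_\<sigma>]) (use that \<sigma> in simp_all)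
      moreover have "\<not> N (v, Suc l) w" "\<not> N w (v, Suc l)" for w by (simp_all add: N_def)
      ultimately show "y = \<sigma> (v, Suc l) \<or> y = (v, l)" "z = \<sigma> (v, Suc l) \<or> z = (v, l)"
        using yz(4,5) by metis+
    qed
    then show ?thesis using yz(1-3) by metis
  qed
  have in_V: "x \<in> V" if "x \<in> set c" for x using cyclic_walk_neighbours[OF c that] by blast
  have V: "v \<in> ends" "Suc j \<le> g" using in_V[OF vj] by simp_all
  have down: "(v, Suc j - l) \<in> set c" for l
  proof (induction l)
    case (Suc l)
    show ?case
    proof (cases "Suc j - l")
      case 0
      then have "Suc j - Suc l = Suc j - l" by simp
      then show ?thesis using Suc.IH by metis
    next
      case (Suc l')
      then have "(v, l') \<in> set c" using step[of l'] \<open>(v, Suc j - l) \<in> set c\<close> by metis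
      moreover have "Suc j - Suc l = l'" using Suc by simp
      ultimately show ?thesis by metis
    qed
  qed (use vj in simp)
  have up: "Suc j + l \<le> g \<Longrightarrow> (v, Suc j + l) \<in> set c" for l
  proof (induction l)
    case (Suc l)
    then have "(v, Suc (j + l)) \<in> set c" by simp
    then have "\<sigma> (v, Suc (j + l)) \<in> set c" using step by blast
    moreover have "\<sigma> (v, Suc (j + l)) = (v, Suc j + Suc l)" using \<sigma>_end(1)[OF V(1)] Suc.prems
        by simp
    ultimately show ?case by metis
  qed (use vj in simp)
  have "(\<lambda>l. (v, l)) ` {1..g} \<subseteq> set c"
  proof clarify
    fix l assume l: "l \<in> {1..g}"
    show "(v, l) \<in> set c"
    proof (cases "l \<le> Suc j")
      case True
      then show ?thesis using down[of "Suc j - l"] by simp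
    next
      case False
      then show ?thesis using up[of "l - Suc j"] l by simp
    qed
  qed
  then have "card ((\<lambda>l. (v, l)) ` {1..g}) \<le> card (set c)" by (intro card_mono) auto
  then have "g \<le> card (set c)" by (simp add: card_image inj_on_def)
  also have "\<dots> \<le> length c" by (rule card_length)
  finally show ?thesis .
next
  case False
  have adj_edge: "adjacent G (fst x) (fst y)" if xy: "adj x y" "x \<in> set c" "y \<in> set c" for x y
  proof -
    have step: "{fst x, fst y} \<in> edges G" if "\<sigma> x = y" "x \<in> V" "x \<in> set c" "y \<in> set c" for x y
      using that(2)
    proof (cases rule: \<sigma>_cases)
      case (edge e)
      then have "{fst x, fst y} = {tl e, hd e}" unfolding that(1)[symmetric] by simp
      then show ?thesis using edge_F_eq[OF edge(1)] F_edge[OF edge(1)] by simp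
    next
      case (chain v j)
      then have "snd y \<noteq> 0" unfolding that(1)[symmetric] by simp
      then show ?thesis using False that(4) by blast
    next
      case (last v)
      then have "snd x \<noteq> 0" using g by simp
      then show ?thesis using False that(3) by blast
    qed
    consider "\<sigma> x = y" | "\<sigma> y = x" | "N x y" using xy(1) by blast
    then show ?thesis
    proof cases
      case 1
      then show ?thesis using step[of x y] xy by (simp add: adjacent_def)
    next
      case 2
      then show ?thesis using step[of y x] xy by (simp add: adjacent_def insert_commute)
    qed (simp add: adjacent_def N_def)
  qed
  have n: "3 \<le> length c" "distinct c" "\<And>i. i < length c \<Longrightarrow> adj (c ! i) (c ! (Suc i mod length c))"
    using c unfolding cyclic_walk_def by blast+
  have "is_cycle G (map fst c)"
    unfolding is_cycle_def
  proof (intro conjI allI impI)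
    show "distinct (map fst c)"
      using n(2) False by (auto simp: distinct_map inj_on_def prod_eq_iff)
    show "set (map fst c) \<subseteq> verts G"
    proof clarsimp
      fix v j assume "(v, j) \<in> set c"
      then have "(v, j) \<in> V" using cyclic_walk_neighbours[OF c] by blast
      then show "v \<in> verts G" by (simp add: V_def)
    qed
    fix i assume i: "i < length (map fst c)"
    then have "Suc i mod length c < length c" using n(1) by (intro mod_less_divisor) linarith
    then show "adjacent G (map fst c ! i) (map fst c ! (Suc i mod length (map fst c)))"
      using adj_edge[OF n(3)] i by simp
  qed (use n in simp)
  then show ?thesis using girth[of "map fst c"] by simp
qed

lemma line_system: "line_system V \<sigma> N k g"
  by unfold_locales
    (erule N_in N_sym no_fixed no_2_cycle cyclic_walk_length |
      rule finite_V \<sigma>_permutes N_irrefl N_\<sigma> card_N)+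

text \<open>New vertices are dropped. A vertex of \<open>G\<close> matched with a new one is
  covered, although neither it nor any of its class edges then enters the set.\<close>

definition uncovered_or_matched :: "('a \<times> nat \<Rightarrow> cell) \<Rightarrow> ('a + 'a set) set" where
  "uncovered_or_matched s = {Inl v | v. v \<in> verts G \<and> s (v, 0) = Single} \<union>
     {Inr e | e. e \<in> F \<and> s (tl e, 0) = Tail}"

lemma random_total_independent_set:
  assumes "2 \<le> k" "tiling_girth k < g"
  shows "\<exists>D. distribution D \<and> supp D \<subseteq> independent_sets (total_graph G) \<and>
    (\<forall>v\<in>verts G. expect D (\<lambda>I. of_bool (Inl v \<in> I)) = 1 / (2 * real k + 1)) \<and>
    (\<forall>e\<in>edges G. expect D (\<lambda>I. of_bool (Inr e \<in> I)) = (if col e = i then real k / (2 * real k + 1)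
        else 0))"
proof -
  interpret L: line_system V \<sigma> N k g adj by (rule line_system)
  let ?p = "inv \<sigma>"
  obtain D where D0: "distribution D"
    "\<forall>v\<in>V. expect D (\<lambda>s. of_bool (s v = Tail)) = L.t \<and> expect D (\<lambda>s. of_bool (s v = Head)) = L.t"
    "\<forall>s\<in>supp D. (\<forall>v\<in>V. (s v = Head \<longleftrightarrow> s (?p v) = Tail) \<and> (s (?p v) = Single \<longrightarrow> s v = Tail)) \<and>
        (\<forall>u v. N u v \<longrightarrow> \<not> (s u = Single \<and> s v = Single))"
    using L.uniform_tiling[OF assms] by (elim exE conjE)
  have D: "distribution D"
    "\<And>v. v \<in> V \<Longrightarrow> expect D (\<lambda>s. of_bool (s v = Tail)) = L.t"
    "\<And>v. v \<in> V \<Longrightarrow> expect D (\<lambda>s. of_bool (s v = Head)) = L.t"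
    "\<And>s v. s \<in> supp D \<Longrightarrow> v \<in> V \<Longrightarrow> s v = Head \<longleftrightarrow> s (?p v) = Tail"
    "\<And>s v. s \<in> supp D \<Longrightarrow> v \<in> V \<Longrightarrow> s (?p v) = Single \<Longrightarrow> s v = Tail"
    "\<And>s u v. s \<in> supp D \<Longrightarrow> N u v \<Longrightarrow> \<not> (s u = Single \<and> s v = Single)"
    using D0 by blast+
  have edge: "s (tl e, 0) = Tail \<longleftrightarrow> s (hd e, 0) = Head" "s (tl e, 0) = Single \<Longrightarrow> s (hd e, 0) = Tail"
    if "s \<in> supp D" "e \<in> F" for s e
  proof -
    have "?p (hd e, 0) = (tl e, 0)" unfolding \<sigma>_tl[OF that(2), symmetric] by (rule L.p_\<sigma>)
    moreover have "(hd e, 0) \<in> V" using tl_hd_in[OF that(2)] by simp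
    ultimately show "s (tl e, 0) = Tail \<longleftrightarrow> s (hd e, 0) = Head" "s (tl e, 0) = Single \<Longrightarrow> s (hd e, 0)
        = Tail"
      using D(4)[OF that(1), of "(hd e, 0)"] D(5)[OF that(1), of "(hd e, 0)"] by auto
  qed
  let ?I = uncovered_or_matched
  have indep: "?I s \<in> independent_sets (total_graph G)" if s: "s \<in> supp D" for s
  proof -
    have matched: "s (v, 0) \<noteq> Single" if "e \<in> F" "s (tl e, 0) = Tail" "v \<in> e" for e v
      using that edge_end[OF F_edge[OF that(1)], of v] edge(1)[OF s that(1)] by auto
    \<comment> \<open>Edges of class \<open>i\<close> join consecutive vertices of a line, where a
      single vertex is followed by a tail; all other edges belong to \<open>N\<close>.\<close>
    have no_edge: "\<not> adjacent G u v" if "s (u, 0) = Single" "s (v, 0) = Single" for u v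
    proof
      assume "adjacent G u v"
      then have E: "{u, v} \<in> edges G" by (simp add: adjacent_def)
      show False
      proof (cases "col {u, v} = i")
        case True
        then have F: "{u, v} \<in> F" using E by (simp add: F_def)
        have "tl {u, v} \<in> {u, v}" "hd {u, v} \<in> {u, v}" using edge_ends(2,3)[OF E] .
        then have "s (tl {u, v}, 0) = Single" "s (hd {u, v}, 0) = Single"
          using that by (metis insertE singletonD)+
        then show False using edge(2)[OF s F] by simp
      next
        case False
        then show False using D(6)[OF s, of "(u, 0)" "(v, 0)"] E that by (simp add: N_def)
      qed
    qed
    \<comment> \<open>Equal tails or equal heads are excluded within one colour, and a vertex that
      is the head of one edge and the tail of the other would have two states.\<close>
    have disjoint: "e \<inter> f = {}"
      if e: "e \<in> F" "s (tl e, 0) = Tail" and f: "f \<in> F" "s (tl f, 0) = Tail" and "e \<noteq> f" for e f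
    proof -
      have "tl e \<noteq> tl f" "hd e \<noteq> hd f"
        using proper[OF F_edge[OF e(1)] F_edge[OF f(1)] \<open>e \<noteq> f\<close>] F_col e(1) f(1) by simp_all
      moreover have "tl e \<noteq> hd f" "tl f \<noteq> hd e"
        using e f edge(1)[OF s] by (metis cell.distinct(5))+
      ultimately show ?thesis
        using edge_end[OF F_edge[OF e(1)]] edge_end[OF F_edge[OF f(1)]] by (metis disjoint_iff)
    qed
    have mem: "Inl u \<in> ?I s \<longleftrightarrow> u \<in> verts G \<and> s (u, 0) = Single"
      "Inr e \<in> ?I s \<longleftrightarrow> e \<in> F \<and> s (tl e, 0) = Tail" for u e
      by (simp_all add: uncovered_or_matched_def)
    show ?thesis
      unfolding independent_sets_def mem_Collect_eq
    proof (intro conjI ballI)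
      show "?I s \<subseteq> verts (total_graph G)"
        by (auto simp: uncovered_or_matched_def total_graph_def F_def)
      fix x y assume xy: "x \<in> ?I s" "y \<in> ?I s"
      show "\<not> adjacent (total_graph G) x y"
      proof (cases x; cases y)
        fix u v assume "x = Inl u" "y = Inl v"
        then show ?thesis using xy no_edge[of u v] by (simp add: mem)
      next
        fix u e assume "x = Inl u" "y = Inr e"
        then show ?thesis using xy matched[of e u] by (auto simp: mem)
      next
        fix u e assume "x = Inr e" "y = Inl u"
        then show ?thesis using xy matched[of e u] by (auto simp: mem)
      next
        fix e f assume "x = Inr e" "y = Inr f"
        then show ?thesis using xy disjoint[of e f] by (auto simp: mem)
      qed
    qed
  qed
  define D' where "D' = map (\<lambda>(q, s). (q, ?I s)) D"
  have E': "expect D' g = expect D (\<lambda>s. g (?I s))" for g unfolding D'_def by (rule expect_map)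
  have "expect D' (\<lambda>I. of_bool (Inl v \<in> I)) = 1 / (2 * real k + 1)" if v: "v \<in> verts G" for v
  proof -
    have "of_bool (Inl v \<in> ?I s) = 1 - of_bool (s (v, 0) = Tail) - (of_bool (s (v, 0) = Head) ::
        real)" for s
      using v by (cases "s (v, 0)") (auto simp: uncovered_or_matched_def)
    then have "expect D' (\<lambda>I. of_bool (Inl v \<in> I)) = 1 - L.t - L.t"
      unfolding E' using D(1) D(2,3)[of "(v, 0)"] v by (simp add: expect_diff distribution_def)
    then show ?thesis by (simp add: L.t_def field_simps)
  qed
  moreover have "expect D' (\<lambda>I. of_bool (Inr e \<in> I)) = (if col e = i then real k / (2 * real k +
      1) else 0)"
    if e: "e \<in> edges G" for e
  proof (cases "col e = i")
    case True
    then have F: "e \<in> F" using e by (simp add: F_def)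
    then have "expect D' (\<lambda>I. of_bool (Inr e \<in> I)) = expect D (\<lambda>s. of_bool (s (tl e, 0) = Tail))"
      unfolding E' by (simp add: uncovered_or_matched_def)
    then show ?thesis using D(2)[of "(tl e, 0)"] tl_hd_in[OF F] True by (simp add: L.t_def)
  next
    case False
    then have "expect D' (\<lambda>I. of_bool (Inr e \<in> I)) = expect D (\<lambda>s. 0 * 1)"
      unfolding E' by (simp add: uncovered_or_matched_def F_def)
    then show ?thesis using False by (simp only: expect_cmult) simp
  qed
  moreover have "supp D' \<subseteq> independent_sets (total_graph G)"
    unfolding D'_def supp_map using indep by blast
  ultimately show ?thesis using distribution_map[OF D(1), of ?I] unfolding D'_def by blast
qed

end

section \<open>Combining the colour classes\<close>

lemma fractional_total_chromatic_number_le: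
  fixes G :: "'a ugraph"
  assumes G: "simple_graph G" and deg: "max_degree G \<le> 2 * k" and k: "2 \<le> k"
    and girth: "enat (tiling_girth k + 3) \<le> girth G"
  shows "fractional_total_chromatic_number G \<le> 2 * real k + 1"
proof -
  have "degree G v \<le> 2 * k" for v
  proof (cases "v \<in> verts G")
    case True
    then have "degree G v \<le> max_degree G"
      using G unfolding max_degree_def by (intro Max_ge) (auto simp: simple_graph_def)
    then show ?thesis using deg by simp
  next
    case False
    then have no: "{e \<in> edges G. v \<in> e} = {}" using G by (auto elim: edge_cases)
    show ?thesis unfolding degree_def no by simp
  qed
  then have "\<exists>tl hd :: 'a set \<Rightarrow> 'a. \<exists>col :: 'a set \<Rightarrow> nat.
    (\<forall>e\<in>edges G. e = {tl e, hd e} \<and> tl e \<noteq> hd e \<and> col e < k) \<and>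
    (\<forall>e\<in>edges G. \<forall>e'\<in>edges G. e \<noteq> e' \<and> col e = col e' \<longrightarrow> tl e \<noteq> tl e' \<and> hd e \<noteq> hd e')"
  proof (intro two_factorisation finite_edges[OF G])
    fix e assume "e \<in> edges G"
    from edge_cases[OF G this] show "\<exists>u v. u \<noteq> v \<and> e = {u, v}" by blast
  qed (simp add: degree_def)
  then obtain tl hd :: "'a set \<Rightarrow> 'a" and col :: "'a set \<Rightarrow> nat" where col0:
    "\<forall>e\<in>edges G. e = {tl e, hd e} \<and> tl e \<noteq> hd e \<and> col e < k"
    "\<forall>e\<in>edges G. \<forall>e'\<in>edges G. e \<noteq> e' \<and> col e = col e' \<longrightarrow> tl e \<noteq> tl e' \<and> hd e \<noteq> hd e'"
    by (elim exE conjE)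
  have col: "e = {tl e, hd e} \<and> tl e \<noteq> hd e \<and> col e < k" if "e \<in> edges G" for e
    using col0(1) that by (rule bspec)
  have proper: "tl e \<noteq> tl e' \<and> hd e \<noteq> hd e'"
    if "e \<in> edges G" "e' \<in> edges G" "e \<noteq> e'" "col e = col e'" for e e'
    using bspec[OF bspec[OF col0(2) that(1)] that(2)] that(3,4) by blast
  have long: "tiling_girth k + 3 \<le> length c" if "is_cycle G c" for c
  proof -
    have "girth G \<le> enat (length c)" unfolding girth_def using that by (intro INF_lower) simp
    then show ?thesis using girth by (meson enat_ord_simps(1) order_trans)
  qed
  define good where "good = (\<lambda>i D. distribution D \<and> supp D \<subseteq> independent_sets (total_graph G) \<and>
    (\<forall>v\<in>verts G. expect D (\<lambda>I. of_bool (Inl v \<in> I)) = 1 / (2 * real k + 1)) \<and>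
    (\<forall>e\<in>edges G. expect D (\<lambda>I. of_bool (Inr e \<in> I)) =
       (if col e = i then real k / (2 * real k + 1) else 0)))"
  have "\<exists>D. good i D" if i: "i < k" for i
  proof -
    \<comment> \<open>The summand 3 provides both \<open>3 \<le> g\<close> and the strict inequality
      \<open>tiling_girth k < g\<close>.\<close>
    interpret P: path_factor G tl hd col i k "tiling_girth k + 3"
      by unfold_locales (rule G i le_add2 | erule col long | rule proper; assumption)+
    show ?thesis unfolding good_def by (rule P.random_total_independent_set[OF k]) simp
  qed
  then obtain D where "\<And>i. i < k \<Longrightarrow> good i (D i)" by metis
  then have D: "\<And>i. i < k \<Longrightarrow> distribution (D i)"
    "\<And>i. i < k \<Longrightarrow> supp (D i) \<subseteq> independent_sets (total_graph G)"
    "\<And>i v. i < k \<Longrightarrow> v \<in> verts G \<Longrightarrow> expect (D i) (\<lambda>I. of_bool (Inl v \<in> I)) = 1 / (2 * real k + 1)"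
    "\<And>i e. i < k \<Longrightarrow> e \<in> edges G \<Longrightarrow> expect (D i) (\<lambda>I. of_bool (Inr e \<in> I)) =
       (if col e = i then real k / (2 * real k + 1) else 0)"
    unfolding good_def by blast+
  have k0: "0 < k" using k by simp
  obtain D' where D': "distribution D'" "\<And>g. expect D' g = (\<Sum>i<k. expect (D i) g) / real k"
    "supp D' \<subseteq> (\<Union>i<k. supp (D i))"
    using mixture_exists[of k D, OF k0 D(1)] by blast
  show ?thesis
    unfolding fractional_total_chromatic_number_def
  proof (rule fractional_chromatic_number_le[OF simple_graph_total_graph[OF G] D'(1)])
    show "supp D' \<subseteq> independent_sets (total_graph G)" using D'(3) D(2) by blast
    fix x assume "x \<in> verts (total_graph G)"
    then consider v where "x = Inl v" "v \<in> verts G" | e where "x = Inr e" "e \<in> edges G"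
      by (auto simp: total_graph_def)
    then have "expect D' (\<lambda>I. of_bool (x \<in> I)) = 1 / (2 * real k + 1)"
    proof cases
      case 1
      then show ?thesis unfolding D'(2) using D(3) k0 by simp
    next
      case 2
      have "(\<Sum>i<k. expect (D i) (\<lambda>I. of_bool (x \<in> I))) =
          (\<Sum>i<k. if col e = i then real k / (2 * real k + 1) else 0)"
        using D(4) 2 by (intro sum.cong) simp_all
      also have "\<dots> = real k / (2 * real k + 1)" using col[OF 2(2)] by simp
      finally show ?thesis unfolding D'(2) using k0 by simp
    qed
    moreover have "2 * real k + 1 \<noteq> 0" by linarith
    ultimately show "1 \<le> (2 * real k + 1) * expect D' (\<lambda>I. of_bool (x \<in> I))" by simp
  qed linarith
qed

lemma fractional_total_chromatic_number_edgeless: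
  assumes G: "simple_graph G" and deg: "max_degree G = 0"
  shows "fractional_total_chromatic_number G \<le> 1"
proof -
  have "edges G = {}"
  proof (rule ccontr)
    assume "edges G \<noteq> {}"
    then obtain e u v where e: "e \<in> edges G" "e = {u, v}" "u \<in> verts G" using G
        by (blast elim: edge_cases)
    have "degree G u \<le> max_degree G"
      using G e(3) unfolding max_degree_def by (intro Max_ge) (auto simp: simple_graph_def)
    then show False using e deg finite_edges[OF G] by (auto simp: degree_def)
  qed
  then have "Inl ` verts G \<in> independent_sets (total_graph G)" "verts (total_graph G) = Inl `
      verts G"
    by (auto simp: independent_sets_def total_graph_def adjacent_def)
  then show ?thesis
    unfolding fractional_total_chromatic_number_def
    by (intro fractional_chromatic_number_le[of _ "[(1, Inl ` verts G)]"]
        simple_graph_total_graph[OF G])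
      (auto simp: distribution_def supp_def)
qed

text \<open>The value 2 has to be excluded. The total graph of a cycle with \<open>n\<close>
  vertices is the square of a cycle with \<open>2 * n\<close> vertices, whose independent sets have
  at most \<open>2 * n div 3\<close> elements, so the fractional total chromatic number exceeds 3
  unless 3 divides \<open>n\<close>, however large the girth \<open>n\<close> is.\<close>

theorem theorem1p7:
  fixes \<Delta> :: nat
  assumes "even \<Delta>" and "\<Delta> \<noteq> 2"
  shows "\<exists>g :: nat. \<forall>G :: 'a ugraph.
           simple_graph G \<and> max_degree G = \<Delta> \<and> enat g \<le> girth G \<longrightarrow>
           fractional_total_chromatic_number G = real \<Delta> + 1"
proof -
  obtain k where k: "\<Delta> = 2 * k" using assms(1) by (elim evenE)
  have "fractional_total_chromatic_number G = real \<Delta> + 1"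
    if G: "simple_graph G" "max_degree G = \<Delta>" "enat (tiling_girth k + 3) \<le> girth G"
        for G :: "'a ugraph"
  proof (rule antisym)
    show "real \<Delta> + 1 \<le> fractional_total_chromatic_number G"
      using Suc_max_degree_le[OF G(1)] G(2) by simp
    show "fractional_total_chromatic_number G \<le> real \<Delta> + 1"
    proof (cases "k = 0")
      case True
      then show ?thesis using fractional_total_chromatic_number_edgeless[OF G(1)] G(2) k by simp
    next
      case False
      then have "2 \<le> k" using assms(2) k by simp
      then show ?thesis
        using fractional_total_chromatic_number_le[OF G(1) _ _ G(3)] G(2) k by simp
    qed
  qed
  then show ?thesis by blast
qed

end
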